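(* Consider two independent samples of size $n$ from the linear models $y_A=x_A^\top\beta_A+u_A$ and $y_B=x_B^\top\beta_B+u_B$ with $\beta_A,\beta_B\in\mathbb{R}^p$, where $u_A,u_B$ have mean zero and are independent of the designs. Put $\gamma_*=(\beta_A-\beta_B)/2$ and suppose $\gamma_*\ne0$. Suppose: (i) $x_A\sim\mathcal{N}(0,\Sigma_A)$ and $x_B\sim\mathcal{N}(0,\Sigma_B)$; (ii) there exist constants $\kappa_1,\kappa_2\in(0,\infty)$ such that all eigenvalues of $\Sigma_A$ and $\Sigma_B$ lie in $(\kappa_1,\kappa_2)$; (iii) $s_\Pi:=\max_{1\le j\le p}\|\Pi_{*,j}\|_0$ satisfies $s_\Pi=o\big(\sqrt{n/\log^3 p}\big)$; (iv) $s_\Pi\|\beta_A-\beta_B\|_0+\|\beta_A+\beta_B\|_0=o(\sqrt n/\log p)$; (v) there exist constants $\delta,\kappa_3\in(0,\infty)$ such that $\mathbb{E}|u_A|^{2+\delta}\le\kappa_3$ and $\mathbb{E}|u_B|^{2+\delta}\le\kappa_3$. Let $n\to\infty$ and $p\to\infty$ with $\log p=o(\sqrt n)$. Then there exist constants $K_1,K_2>0$, depending only on the constants in (i)--(v), such that whenever $$\|\Sigma_V\gamma_*\|_\infty\ge\sqrt{n^{-1}\log p}\,\big(K_1\|\gamma_*\|_2+K_2\big),\qquad \Sigma_V:=4(\Sigma_A^{-1}+\Sigma_B^{-1})^{-1},$$ the TIERS test (tuning parameter $\eta\asymp\sqrt{n^{-1}\log p}$) satisfies $$\mathbb{P}\big(T_n>\Gamma^{-1}(1-\alpha,\hat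 Q)\big)\to1\qquad\text{for every }\alpha\in(0,1).$$
   Context: Asymptotic framework: $n\to\infty$, $p=p_n$ and all model quantities may depend on $n$; "constants" do not. $a_n\asymp b_n$ means that each is bounded by a constant multiple of the other. For a vector $v$, $\|v\|_0=\#\{i:v_i\ne0\}$, $\|v\|_q$ is the usual $\ell_q$ norm. Data and notation: for $k\in\{A,B\}$, $(x_{k,i},y_{k,i})_{i=1}^n$ are i.i.d. copies of $(x_k,y_k)$, and the two samples are independent. $X_k\in\mathbb{R}^{n\times p}$ has rows $x_{k,i}^\top$ and $Y_k=(y_{k,1},\dots,y_{k,n})^\top$. Put $W=X_A+X_B$, $Z=X_A-X_B$, $Y=Y_A+Y_B$; $Z_j$ is the $j$-th column of $Z$. With $w=x_A+x_B$ and $z=x_A-x_B$, let $\Pi_{*,j}=(\mathbb{E}[ww^\top])^{-1}\mathbb{E}[wz_j]\in\mathbb{R}^p$, so that $\Pi_*=(\Pi_{*,1},\dots,\Pi_{*,p})=(\Sigma_A+\Sigma_B)^{-1}(\Sigma_A-\Sigma_B)$. The vector $v=z-\Pi_*^\top w$ satisfies $\mathbb{E}[vv^\top]=4(\Sigma_A^{-1}+\Sigma_B^{-1})^{-1}=\Sigma_V$. ADDS estimators: with tuning parameter $\eta$, for $\sigma\ge0$ let $\hat\theta(\sigma)$ be a minimizer of $\|\theta\|_1$ over $\theta\in\mathbb{R}^p$ subject to $\|n^{-1}W^\top(Y-W\theta)\|_\infty\le\eta\sigma$; let $\tilde\sigma_u$ be the largest $\sigma\ge0$ with $\|Y-W\hat\theta(\sigma)\|_2^2\ge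 n\sigma^2/2$; put $\widetilde\theta=\hat\theta(\tilde\sigma_u)$. For each $j$, let $\hat\Pi_j(\sigma)$ be a minimizer of $\|\pi\|_1$ subject to $\|n^{-1}W^\top(Z_j-W\pi)\|_\infty\le\eta\sigma$, let $\tilde\sigma_j$ be the largest $\sigma\ge0$ with $\|Z_j-W\hat\Pi_j(\sigma)\|_2^2\ge n\sigma^2/2$, put $\widetilde\Pi_j=\hat\Pi_j(\tilde\sigma_j)$ and $\widetilde\Pi=(\widetilde\Pi_1,\dots,\widetilde\Pi_p)$. TIERS test: $\hat\sigma_u=n^{-1/2}\|Y-W\widetilde\theta\|_2$; $T_n=n^{-1/2}\hat\sigma_u^{-1}\|(Z-W\widetilde\Pi)^\top(Y-W\widetilde\theta)\|_\infty$; $\hat Q=n^{-1}\sum_{i=1}^n\hat v_i\hat v_i^\top$, where $\hat v_i^\top$ is the $i$-th row of $Z-W\widetilde\Pi$. For a covariance matrix $A$, $\Gamma(x,A)=\mathbb{P}(\|\xi\|_\infty\le x)$ with $\xi\sim\mathcal{N}(0,A)$, and $\Gamma^{-1}(\cdot,A)$ is the inverse of $\Gamma(\cdot,A)$. The test rejects $\beta_A=\beta_B$ iff $T_n>\Gamma^{-1}(1-\alpha,\hat Q)$.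
   Formalization: The tuning parameter η ≍ √(n⁻¹ log p) is additionally required to be eventually at least C√(n⁻¹ log p), with C>0 depending only on the constants in (i)–(v); for a too small multiplicative constant the ADDS fits can interpolate and the test is undefined. *)

theory Defs
  imports
    "HOL-Probability.Probability"
    "Jordan_Normal_Form.Gauss_Jordan_Elimination"
    "Jordan_Normal_Form.Char_Poly"
begin

text \<open>
  The dimension \<open>p\<close> varies with \<open>n\<close>, so vectors and matrices are those of
  \<open>Jordan_Normal_Form\<close> (all indices start at 0).  Their names are qualified below because
  \<open>HOL-Analysis\<close> has fixed-dimension objects of the same names.
\<close>

definition l0_norm :: "real Matrix.vec \<Rightarrow> nat" where
  "l0_norm v = card {i. i < dim_vec v \<and> vec_index v i \<noteq> 0}"

definition l1_norm :: "real Matrix.vec \<Rightarrow> real" where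
  "l1_norm v = (\<Sum>i<dim_vec v. \<bar>vec_index v i\<bar>)"

definition l2_norm :: "real Matrix.vec \<Rightarrow> real" where
  "l2_norm v = sqrt (\<Sum>i<dim_vec v. (vec_index v i)\<^sup>2)"

text \<open>The inserted 0 only matters in dimension 0.\<close>

definition linf_norm :: "real Matrix.vec \<Rightarrow> real" where
  "linf_norm v = Max (insert 0 ((\<lambda>i. \<bar>vec_index v i\<bar>) ` {..<dim_vec v}))"

definition inv_mat :: "real Matrix.mat \<Rightarrow> real Matrix.mat" where
  "inv_mat A = the (mat_inverse A)"

text \<open>
  \<open>\<mu>\<close> is \<open>N(0, A)\<close> iff it is the law of \<open>L g\<close> for a vector \<open>g\<close> of independent standard normal
  variables and some \<open>L\<close> with \<open>L L\<^sup>T = A\<close>.  In particular \<open>A\<close> is then symmetric and positive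
  semidefinite; singular \<open>A\<close> are allowed (the plug-in covariance of the test is singular when \<open>p > n\<close>).
  The law depends on \<open>A\<close> only, not on \<open>L\<close> or its number of columns.
\<close>

definition is_centered_normal ::
    "nat \<Rightarrow> real Matrix.mat \<Rightarrow> (nat \<Rightarrow> real) measure \<Rightarrow> bool" where
  "is_centered_normal p A \<mu> \<longleftrightarrow>
     (\<exists>m. \<exists>L \<in> carrier_mat p m. L * transpose_mat L = A \<and>
        \<mu> = distr (\<Pi>\<^sub>M k\<in>{..<m}. density lborel (\<lambda>t. ennreal (std_normal_density t)))
                  (\<Pi>\<^sub>M j\<in>{..<p}. borel)
                  (\<lambda>g. \<lambda>j\<in>{..<p}. \<Sum>k<m. L $$ (j, k) * g k))"

definition centered_normal :: "nat \<Rightarrow> real Matrix.mat \<Rightarrow> (nat \<Rightarrow> real) measure" where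
  "centered_normal p A = (SOME \<mu>. is_centered_normal p A \<mu>)"

definition gauss_max_cdf :: "real \<Rightarrow> real Matrix.mat \<Rightarrow> real" where
  "gauss_max_cdf x A =
     (let \<mu> = centered_normal (dim_row A) A
      in measure \<mu> {\<xi> \<in> space \<mu>. linf_norm (Matrix.vec (dim_row A) \<xi>) \<le> x})"

text \<open>
  For a covariance matrix \<open>A \<noteq> 0\<close>, \<open>x \<mapsto> gauss_max_cdf x A\<close> is a bijection from
  \<open>[0,\<infinity>)\<close> onto \<open>[0,1)\<close>, and this is its inverse.
\<close>

definition gauss_max_quantile :: "real \<Rightarrow> real Matrix.mat \<Rightarrow> real" where
  "gauss_max_quantile q A = inv_into {0..} (\<lambda>x. gauss_max_cdf x A) q"

datatype group_label = GA | GB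

text \<open>
  A (covariate, response) pair as one random element of \<open>obs_space p\<close>;
  coordinate \<open>j < p\<close> of the covariate vector is the random variable \<open>x j\<close>.
\<close>

definition obs_space :: "nat \<Rightarrow> ((nat \<Rightarrow> real) \<times> real) measure" where
  "obs_space p = (\<Pi>\<^sub>M j\<in>{..<p}. borel) \<Otimes>\<^sub>M borel"

definition covariate_vec :: "nat \<Rightarrow> (nat \<Rightarrow> 'w \<Rightarrow> real) \<Rightarrow> 'w \<Rightarrow> nat \<Rightarrow> real" where
  "covariate_vec p x \<omega> = (\<lambda>j\<in>{..<p}. x j \<omega>)"

definition obs ::
    "nat \<Rightarrow> (nat \<Rightarrow> 'w \<Rightarrow> real) \<Rightarrow> ('w \<Rightarrow> real) \<Rightarrow> 'w \<Rightarrow> (nat \<Rightarrow> real) \<times> real" where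
  "obs p x y \<omega> = (covariate_vec p x \<omega>, y \<omega>)"

text \<open>
  \<open>x k\<close>, \<open>u k\<close> are the population variables \<open>x\<^sub>k\<close>, \<open>u\<^sub>k\<close> (with \<open>y\<^sub>k\<close> determined by the linear
  model), and \<open>xs k i j\<close>, \<open>ys k i\<close> for \<open>i < n\<close> are the data: \<open>xs k i j\<close> is coordinate \<open>j\<close> of the
  \<open>i\<close>-th covariate vector of group \<open>k\<close>.  No relation between the population
  variables and the data is imposed beyond equality of laws.
\<close>

locale two_sample_model = prob_space M for M :: "'w measure" +
  fixes n p :: nat
    and Cov :: "group_label \<Rightarrow> real Matrix.mat"
    and beta :: "group_label \<Rightarrow> real Matrix.vec"
    and x :: "group_label \<Rightarrow> nat \<Rightarrow> 'w \<Rightarrow> real"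
    and u :: "group_label \<Rightarrow> 'w \<Rightarrow> real"
    and xs :: "group_label \<Rightarrow> nat \<Rightarrow> nat \<Rightarrow> 'w \<Rightarrow> real"
    and ys :: "group_label \<Rightarrow> nat \<Rightarrow> 'w \<Rightarrow> real"
  assumes Cov_carrier: "Cov k \<in> carrier_mat p p"
    and beta_carrier: "beta k \<in> carrier_vec p"
    and x_normal:
      "is_centered_normal p (Cov k) (distr M (\<Pi>\<^sub>M j\<in>{..<p}. borel) (covariate_vec p (x k)))"
    and u_mean_zero: "integrable M (u k)" "expectation (u k) = 0"
    and u_indep_x:
      "indep_set (sets (vimage_algebra (space M) (covariate_vec p (x k)) (\<Pi>\<^sub>M j\<in>{..<p}. borel)))
         (sets (vimage_algebra (space M) (u k) borel))"
    and groups_indep: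
      "indep_var (obs_space p) (obs p (x GA) (u GA)) (obs_space p) (obs p (x GB) (u GB))"
    and sample_indep:
      "indep_vars (\<lambda>_. obs_space p) (\<lambda>(k, i). obs p (xs k i) (ys k i)) (UNIV \<times> {..<n})"
    and sample_law:
      "i < n \<Longrightarrow> distr M (obs_space p) (obs p (xs k i) (ys k i)) =
         distr M (obs_space p)
           (obs p (x k) (\<lambda>\<omega>. (\<Sum>j<p. vec_index (beta k) j * x k j \<omega>) + u k \<omega>))"

text \<open>\<open>\<Pi>\<^sub>* = (E[w w\<^sup>T])\<^sup>-\<^sup>1 E[w z\<^sup>T]\<close> for \<open>w = x\<^sub>A + x\<^sub>B\<close>, \<open>z = x\<^sub>A - x\<^sub>B\<close>; its columns are \<open>\<Pi>\<^sub>*\<^sub>,\<^sub>j\<close>.\<close>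

definition Pi_star ::
    "'w measure \<Rightarrow> nat \<Rightarrow> (group_label \<Rightarrow> nat \<Rightarrow> 'w \<Rightarrow> real) \<Rightarrow> real Matrix.mat" where
  "Pi_star M p x =
     (let w = (\<lambda>j \<omega>. x GA j \<omega> + x GB j \<omega>); z = (\<lambda>j \<omega>. x GA j \<omega> - x GB j \<omega>)
      in inv_mat (Matrix.mat p p (\<lambda>(i, j). \<integral>\<omega>. w i \<omega> * w j \<omega> \<partial>M))
         * Matrix.mat p p (\<lambda>(i, j). \<integral>\<omega>. w i \<omega> * z j \<omega> \<partial>M))"

definition max_col_sparsity :: "real Matrix.mat \<Rightarrow> nat" where
  "max_col_sparsity P = Max ((\<lambda>j. l0_norm (col P j)) ` {..<dim_col P})"

definition Sigma_V :: "(group_label \<Rightarrow> real Matrix.mat) \<Rightarrow> real Matrix.mat" where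
  "Sigma_V Cov = 4 \<cdot>\<^sub>m inv_mat (inv_mat (Cov GA) + inv_mat (Cov GB))"

definition X_mat ::
    "nat \<Rightarrow> nat \<Rightarrow> (group_label \<Rightarrow> nat \<Rightarrow> nat \<Rightarrow> 'w \<Rightarrow> real) \<Rightarrow> group_label \<Rightarrow> 'w \<Rightarrow> real Matrix.mat"
  where "X_mat n p xs k \<omega> = Matrix.mat n p (\<lambda>(i, j). xs k i j \<omega>)"

definition W_mat ::
    "nat \<Rightarrow> nat \<Rightarrow> (group_label \<Rightarrow> nat \<Rightarrow> nat \<Rightarrow> 'w \<Rightarrow> real) \<Rightarrow> 'w \<Rightarrow> real Matrix.mat" where
  "W_mat n p xs \<omega> = X_mat n p xs GA \<omega> + X_mat n p xs GB \<omega>"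

definition Z_mat ::
    "nat \<Rightarrow> nat \<Rightarrow> (group_label \<Rightarrow> nat \<Rightarrow> nat \<Rightarrow> 'w \<Rightarrow> real) \<Rightarrow> 'w \<Rightarrow> real Matrix.mat" where
  "Z_mat n p xs \<omega> = X_mat n p xs GA \<omega> - X_mat n p xs GB \<omega>"

definition Y_vec :: "nat \<Rightarrow> (group_label \<Rightarrow> nat \<Rightarrow> 'w \<Rightarrow> real) \<Rightarrow> 'w \<Rightarrow> real Matrix.vec" where
  "Y_vec n ys \<omega> = Matrix.vec n (\<lambda>i. ys GA i \<omega>) + Matrix.vec n (\<lambda>i. ys GB i \<omega>)"

definition is_dantzig ::
    "real \<Rightarrow> real Matrix.mat \<Rightarrow> real Matrix.vec \<Rightarrow> real \<Rightarrow> real Matrix.vec \<Rightarrow> bool" where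
  "is_dantzig eta W Y \<sigma> \<theta> \<longleftrightarrow>
     is_arg_min l1_norm
       (\<lambda>\<theta>. \<theta> \<in> carrier_vec (dim_col W) \<and>
            linf_norm ((1 / real (dim_row W)) \<cdot>\<^sub>v (transpose_mat W *\<^sub>v (Y - W *\<^sub>v \<theta>))) \<le> eta * \<sigma>)
       \<theta>"

text \<open>
  \<open>t\<close> is an ADDS estimate: \<open>t = th s\<close> for some choice \<open>th \<sigma>\<close> of minimizers for all \<open>\<sigma> \<ge> 0\<close>, where
  \<open>s\<close> is the largest admissible noise level for that choice.  A relation rather than a function,
  since minimizers need not be unique.
\<close>

definition is_adds ::
    "real \<Rightarrow> real Matrix.mat \<Rightarrow> real Matrix.vec \<Rightarrow> real Matrix.vec \<Rightarrow> bool" where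
  "is_adds eta W Y t \<longleftrightarrow>
     (\<exists>th s. let admissible = (\<lambda>\<sigma>::real. \<sigma> \<ge> 0 \<and>
                   (l2_norm (Y - W *\<^sub>v th \<sigma>))\<^sup>2 \<ge> real (dim_row W) * \<sigma>\<^sup>2 / 2)
        in (\<forall>\<sigma>\<ge>0. is_dantzig eta W Y \<sigma> (th \<sigma>)) \<and>
           admissible s \<and> (\<forall>\<sigma>. admissible \<sigma> \<longrightarrow> \<sigma> \<le> s) \<and>
           t = th s)"

definition sigma_hat_u ::
    "real Matrix.mat \<Rightarrow> real Matrix.vec \<Rightarrow> real Matrix.vec \<Rightarrow> real" where
  "sigma_hat_u W Y theta = l2_norm (Y - W *\<^sub>v theta) / sqrt (real (dim_row W))"

definition tiers_stat ::
    "real Matrix.mat \<Rightarrow> real Matrix.mat \<Rightarrow> real Matrix.vec \<Rightarrow> real Matrix.vec \<Rightarrow> real Matrix.mat \<Rightarrow> real"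
  where
  "tiers_stat W Z Y theta P =
     linf_norm (transpose_mat (Z - W * P) *\<^sub>v (Y - W *\<^sub>v theta))
       / (sqrt (real (dim_row W)) * sigma_hat_u W Y theta)"

definition Q_hat :: "real Matrix.mat \<Rightarrow> real Matrix.mat \<Rightarrow> real Matrix.mat \<Rightarrow> real Matrix.mat" where
  "Q_hat W Z P =
     (let V = Z - W * P
      in Matrix.mat (dim_col V) (dim_col V)
           (\<lambda>(a, b). (\<Sum>i<dim_row V. V $$ (i, a) * V $$ (i, b)) / real (dim_row W)))"

definition tiers_rejects ::
    "real \<Rightarrow> real Matrix.mat \<Rightarrow> real Matrix.mat \<Rightarrow> real Matrix.vec \<Rightarrow> real Matrix.vec \<Rightarrow>
     real Matrix.mat \<Rightarrow> bool" where
  "tiers_rejects \<alpha> W Z Y theta P \<longleftrightarrow>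
     tiers_stat W Z Y theta P > gauss_max_quantile (1 - \<alpha>) (Q_hat W Z P)"

text \<open>
  The minimizers behind the test are arbitrary, so its rejection region need not be an event.  Inner
  probability extends the probability to all sets: it is the probability itself on events and
  the most conservative value otherwise.
\<close>

definition inner_prob :: "'w measure \<Rightarrow> 'w set \<Rightarrow> real" where
  "inner_prob M S = (SUP E\<in>{E \<in> sets M. E \<subseteq> S}. measure M E)"

lemma (in finite_measure) inner_prob_eq_measure:
  assumes "S \<in> sets M"
  shows "inner_prob M S = measure M S"
  unfolding inner_prob_def
proof (rule cSup_eq_maximum)
  show "measure M S \<in> measure M ` {E \<in> sets M. E \<subseteq> S}"
    using assms by auto
  show "\<And>y. y \<in> measure M ` {E \<in> sets M. E \<subseteq> S} \<Longrightarrow> y \<le> measure M S"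
    using assms by (auto intro: finite_measure_mono)
qed

end

theory Submission
  imports Defs "HOL-Real_Asymp.Real_Asymp"
begin

text \<open>
  Let \<open>r = sqrt (ln p / n)\<close> and \<open>\<gamma> = (\<beta>\<^sub>A - \<beta>\<^sub>B) / 2\<close>.  Since \<open>z = \<Pi>\<^sub>*\<^sup>T w + v\<close>, the data satisfy two sparse linear
  models with the same design, \<open>Z = W \<Pi>\<^sub>* + V\<close> and \<open>Y = W \<theta> + e\<close>, where
  \<open>\<theta> = (\<beta>\<^sub>A + \<beta>\<^sub>B) / 2 + \<Pi>\<^sub>* \<gamma>\<close>, \<open>e = V \<gamma> + U\<close> and \<open>U = u\<^sub>A + u\<^sub>B\<close>.  The number \<open>s\<close> of nonzero coefficients of
  \<open>\<theta>\<close> and of the columns of \<open>\<Pi>\<^sub>*\<close> is \<open>o(sqrt n / ln p)\<close>, so \<open>s r\<close> tends to 0.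

  Estimation.  The Gram matrix \<open>W\<^sup>T W / n\<close> is entrywise within \<open>O(r)\<close> of its expectation.  On vectors whose
  \<open>\<ell>\<^sub>1\<close> norm is dominated by \<open>s\<close> of their coordinates this costs only \<open>O(s r)\<close> times the squared \<open>\<ell>\<^sub>2\<close> norm, so a
  restricted eigenvalue bound holds there and the Dantzig selector has \<open>\<ell>\<^sub>1\<close> error \<open>O(s \<eta> \<sigma>)\<close>
  (\<open>dantzig_error\<close>).  Consequently the largest admissible noise level of ADDS lies between the root mean
  square of the noise and three times that value, and the residuals have the size of the noise up to a
  factor 2 (\<open>adds_error\<close>).

  Signal.  With estimates \<open>\<Pi>'\<close> and \<open>\<theta>'\<close>, the score \<open>(Z - W \<Pi>')\<^sup>T (Y - W \<theta>') / n\<close> differs from \<open>V\<^sup>T e / n\<close>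
  by \<open>O(s \<eta>\<^sup>2)\<close> times the root mean square of \<open>e\<close>, and \<open>V\<^sup>T e / n\<close> differs from \<open>\<Sigma>\<^sub>V \<gamma>\<close> by \<open>O(r (\<parallel>\<gamma>\<parallel>\<^sub>2 + rms U))\<close>, while the root mean square of \<open>e\<close> is of the
  exact order \<open>\<parallel>\<gamma>\<parallel>\<^sub>2 + rms U\<close> (\<open>effective_noise_scale\<close>, \<open>score_lower_bound\<close>).  Under the signal condition the
  studentized statistic therefore exceeds a multiple of \<open>sqrt (ln p)\<close> that grows with \<open>K\<^sub>1\<close> and \<open>K\<^sub>2\<close>, whereas a
  union bound keeps the critical value below a fixed multiple of \<open>sqrt (ln p)\<close> (\<open>gauss_max_quantile_le\<close>).  The
  upper constant in \<open>\<eta> \<asymp> r\<close> enters only through terms of order \<open>s \<eta>\<^sup>2\<close>, which are negligible against \<open>r\<close>; this is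
  why \<open>K\<^sub>1\<close>, \<open>K\<^sub>2\<close> and \<open>C\<close> can be chosen before \<open>\<eta>\<close>.

  Probability.  All of this is deterministic on an event described by at most \<open>3 p\<close> linear functionals of the rows
  of \<open>(X\<^sub>A, X\<^sub>B)\<close>.  Products of two functionals concentrate at rate \<open>r\<close>, by polarization and a Chernoff bound for
  sums of squared normal variables (\<open>product_concentration\<close>); their means vanish for \<open>w\<close> against \<open>v\<close> and produce
  \<open>\<Sigma>\<^sub>V\<close> for \<open>v\<close> against \<open>v\<close> (locale \<open>cov_pair\<close>).  A functional against the noise \<open>U\<close> is, given \<open>U\<close>, a centered normal
  variable with standard deviation proportional to the norm of \<open>U\<close>, so the bound \<open>noise_bound\<close> is
  self-normalized and holds for every noise law.  The moments of order \<open>2 + \<delta>\<close> keep \<open>rms U\<close> bounded with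
  probability tending to 1 (\<open>mean_square_bound\<close>).
\<close>

section \<open>The Dantzig selector and the ADDS estimator\<close>

lemma abs_sum_mult_le:
  fixes f g :: "'a \<Rightarrow> real"
  assumes "\<And>j. j \<in> J \<Longrightarrow> \<bar>g j\<bar> \<le> c"
  shows "\<bar>\<Sum>j\<in>J. f j * g j\<bar> \<le> (\<Sum>j\<in>J. \<bar>f j\<bar>) * c"
proof -
  have "\<bar>\<Sum>j\<in>J. f j * g j\<bar> \<le> (\<Sum>j\<in>J. \<bar>f j\<bar> * \<bar>g j\<bar>)"
    by (rule order_trans[OF sum_abs]) (simp add: abs_mult)
  also have "\<dots> \<le> (\<Sum>j\<in>J. \<bar>f j\<bar> * c)"
    using assms by (intro sum_mono mult_left_mono) auto
  finally show ?thesis by (simp add: sum_distrib_right)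
qed

lemma sum_square_expand:
  fixes W :: "'i \<Rightarrow> 'j \<Rightarrow> real"
  shows "(\<Sum>i\<in>I. (\<Sum>j\<in>J. W i j * x j)\<^sup>2) = (\<Sum>j\<in>J. x j * (\<Sum>k\<in>J. x k * (\<Sum>i\<in>I. W i j * W i k)))"
proof -
  have "(\<Sum>i\<in>I. (\<Sum>j\<in>J. W i j * x j)\<^sup>2) = (\<Sum>i\<in>I. \<Sum>j\<in>J. \<Sum>k\<in>J. x j * (x k * (W i j * W i k)))"
    by (simp add: power2_eq_square sum_product algebra_simps)
  also have "\<dots> = (\<Sum>j\<in>J. \<Sum>k\<in>J. \<Sum>i\<in>I. x j * (x k * (W i j * W i k)))"
    by (subst sum.swap) (intro sum.cong refl, subst sum.swap, simp)
  finally show ?thesis by (simp add: sum_distrib_left)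
qed

text \<open>Both \<open>\<beta>\<close> and \<open>\<theta>\<close> are feasible at level \<open>l\<close>, so the Gram matrix maps \<open>\<theta> - \<beta>\<close> to
  a vector with entries at most \<open>2 l\<close>, and
  minimality of the \<open>\<ell>\<^sub>1\<close> norm puts most of \<open>\<theta> - \<beta>\<close> on the support of \<open>\<beta>\<close>.  There the \<open>\<ell>\<^sub>1\<close> norm is at most
  \<open>2 sqrt s\<close> times the \<open>\<ell>\<^sub>2\<close> norm, so an entrywise error \<open>d\<close> of the Gram matrix perturbs the quadratic form by at
  most \<open>4 s d\<close> times the squared \<open>\<ell>\<^sub>2\<close> norm, which \<open>8 s d \<le> m\<close> absorbs.\<close>

lemma dantzig_error:
  fixes W S :: "nat \<Rightarrow> nat \<Rightarrow> real" and n p s :: nat and l m d :: real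
  assumes gram: "\<And>j k. j < p \<Longrightarrow> k < p \<Longrightarrow> \<bar>(\<Sum>i<n. W i j * W i k) / n - S j k\<bar> \<le> d"
    and pd: "\<And>x::nat\<Rightarrow>real. m * (\<Sum>j<p. (x j)\<^sup>2) \<le> (\<Sum>j<p. x j * (\<Sum>k<p. x k * S j k))"
    and y: "\<And>i. i < n \<Longrightarrow> y i = (\<Sum>j<p. W i j * \<beta> j) + \<epsilon> i"
    and feas0: "\<And>j. j < p \<Longrightarrow> \<bar>(\<Sum>i<n. W i j * \<epsilon> i) / n\<bar> \<le> l"
    and feas: "\<And>j. j < p \<Longrightarrow> \<bar>(\<Sum>i<n. W i j * (y i - (\<Sum>j<p. W i j * \<theta> j))) / n\<bar> \<le> l"
    and l1: "(\<Sum>j<p. \<bar>\<theta> j\<bar>) \<le> (\<Sum>j<p. \<bar>\<beta> j\<bar>)"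
    and s: "card {j. j < p \<and> \<beta> j \<noteq> 0} \<le> s"
    and sd: "8 * real s * d \<le> m" and m: "m > 0" and l: "l \<ge> 0"
  shows "(\<Sum>j<p. \<bar>\<theta> j - \<beta> j\<bar>) \<le> 16 * real s * l / m"
    and "(\<Sum>i<n. (\<Sum>j<p. W i j * (\<theta> j - \<beta> j))\<^sup>2) / n \<le> 32 * real s * l\<^sup>2 / m"
proof -
  define D where "D j = \<theta> j - \<beta> j" for j
  define T where "T = {j. j < p \<and> \<beta> j \<noteq> 0}"
  define N1 where "N1 = (\<Sum>j<p. \<bar>D j\<bar>)"
  define N2 where "N2 = (\<Sum>j<p. (D j)\<^sup>2)"
  define q where "q = (\<Sum>i<n. (\<Sum>j<p. W i j * D j)\<^sup>2) / n"
  have T: "T \<subseteq> {..<p}" "finite T" by (auto simp: T_def)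
  have N1_0: "N1 \<ge> 0" by (auto simp: N1_def intro: sum_nonneg)
  have split: "(\<Sum>j<p. f j) = (\<Sum>j\<in>T. f j) + (\<Sum>j\<in>{..<p} - T. f j)" for f :: "nat \<Rightarrow> real"
    using T by (simp add: sum.subset_diff[OF T(1)])
  \<comment> \<open>the error is dominated by its part on the support of \<open>\<beta>\<close>\<close>
  have cone: "N1 \<le> 2 * (\<Sum>j\<in>T. \<bar>D j\<bar>)"
  proof -
    have "(\<Sum>j\<in>{..<p} - T. \<bar>\<theta> j\<bar>) = (\<Sum>j\<in>{..<p} - T. \<bar>D j\<bar>)"
      by (intro sum.cong) (auto simp: D_def T_def)
    moreover have "(\<Sum>j\<in>{..<p} - T. \<bar>\<beta> j\<bar>) = 0"
      by (intro sum.neutral) (auto simp: T_def)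
    moreover have "(\<Sum>j\<in>T. \<bar>\<beta> j\<bar>) - (\<Sum>j\<in>T. \<bar>D j\<bar>) \<le> (\<Sum>j\<in>T. \<bar>\<theta> j\<bar>)"
      unfolding sum_subtractf[symmetric] by (intro sum_mono) (auto simp: D_def)
    ultimately show ?thesis
      using l1 unfolding N1_def split[of "\<lambda>j. \<bar>\<theta> j\<bar>"] split[of "\<lambda>j. \<bar>\<beta> j\<bar>"] split[of "\<lambda>j. \<bar>D j\<bar>"]
      by simp
  qed
  have N12: "N1\<^sup>2 \<le> 4 * real s * N2"
  proof -
    have "N1\<^sup>2 \<le> (2 * (\<Sum>j\<in>T. \<bar>D j\<bar>))\<^sup>2" using cone N1_0 by (intro power_mono) auto
    also have "\<dots> = 4 * (\<Sum>j\<in>T. 1 * \<bar>D j\<bar>)\<^sup>2" by (simp add: power_mult_distrib)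
    also have "\<dots> \<le> 4 * ((\<Sum>j\<in>T. 1\<^sup>2) * (\<Sum>j\<in>T. \<bar>D j\<bar>\<^sup>2))"
      by (intro mult_left_mono Cauchy_Schwarz_ineq_sum) auto
    also have "\<dots> = 4 * (card T * (\<Sum>j\<in>T. (D j)\<^sup>2))" by simp
    also have "\<dots> \<le> 4 * (real s * N2)"
      using s T unfolding N2_def
      by (intro mult_left_mono mult_mono sum_mono2 sum_nonneg) (auto simp: T_def)
    finally show ?thesis by simp
  qed
  \<comment> \<open>The restricted eigenvalue bound: replacing the Gram matrix by \<open>S\<close>
     costs at most \<open>d\<close> times the squared \<open>\<ell>\<^sub>1\<close> norm.\<close>
  have q_low: "m * N2 - d * N1\<^sup>2 \<le> q"
  proof -
    define G where "G j k = (\<Sum>i<n. W i j * W i k) / n" for j k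
    have qG: "q = (\<Sum>j<p. D j * (\<Sum>k<p. D k * G j k))"
      unfolding q_def sum_square_expand G_def by (simp add: sum_divide_distrib sum_distrib_left)
    have in1: "\<bar>\<Sum>k<p. D k * (G j k - S j k)\<bar> \<le> N1 * d" if "j < p" for j
      unfolding N1_def by (intro abs_sum_mult_le) (use gram[OF that] in \<open>auto simp: G_def\<close>)
    have "\<bar>\<Sum>j<p. D j * (\<Sum>k<p. D k * (G j k - S j k))\<bar> \<le> N1 * (N1 * d)"
      using abs_sum_mult_le[of "{..<p}" "\<lambda>j. \<Sum>k<p. D k * (G j k - S j k)" "N1 * d" D] in1
      unfolding N1_def by simp
    moreover have "(\<Sum>j<p. D j * (\<Sum>k<p. D k * (G j k - S j k)))
        = q - (\<Sum>j<p. D j * (\<Sum>k<p. D k * S j k))"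
      unfolding qG by (simp add: sum_subtractf right_diff_distrib)
    ultimately show ?thesis
      using pd[of D] by (simp add: N2_def power2_eq_square algebra_simps abs_le_iff)
  qed
  have res: "y i - (\<Sum>j<p. W i j * \<theta> j) = \<epsilon> i - (\<Sum>j<p. W i j * D j)" if "i < n" for i
    using y[OF that] by (simp add: D_def right_diff_distrib sum_subtractf)
  have q_up: "q \<le> N1 * (2 * l)"
  proof -
    have b: "\<bar>(\<Sum>i<n. W i j * (\<Sum>k<p. W i k * D k)) / n\<bar> \<le> 2 * l" if "j < p" for j
    proof -
      have "(\<Sum>i<n. W i j * (y i - (\<Sum>j<p. W i j * \<theta> j))) =
         (\<Sum>i<n. W i j * \<epsilon> i) - (\<Sum>i<n. W i j * (\<Sum>k<p. W i k * D k))"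
        unfolding sum_subtractf[symmetric] by (intro sum.cong) (auto simp: res right_diff_distrib)
      then show ?thesis using feas0[OF that] feas[OF that] by (simp only: diff_divide_distrib)
    qed
    have "q = (\<Sum>j<p. D j * ((\<Sum>i<n. W i j * (\<Sum>k<p. W i k * D k)) / n))"
      unfolding q_def power2_eq_square sum_distrib_left sum_distrib_right sum_divide_distrib
      by (subst sum.swap) (simp add: algebra_simps)
    also have "\<bar>\<dots>\<bar> \<le> N1 * (2 * l)" unfolding N1_def using b by (intro abs_sum_mult_le) auto
    finally show ?thesis by simp
  qed
  have half: "m * N1\<^sup>2 \<le> 8 * real s * q"
  proof -
    have "m * N1\<^sup>2 \<le> m * (4 * real s * N2)" using N12 m by (intro mult_left_mono) auto
    also have "\<dots> = 4 * real s * (m * N2)" by simp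
    also have "\<dots> \<le> 4 * real s * (q + d * N1\<^sup>2)" using q_low by (intro mult_left_mono) auto
    also have "\<dots> = 4 * real s * q + (8 * real s * d) * N1\<^sup>2 / 2" by (simp add: algebra_simps)
    also have "\<dots> \<le> 4 * real s * q + m * N1\<^sup>2 / 2"
      using mult_right_mono[OF sd, of "N1\<^sup>2"] by (simp add: mult_ac)
    finally show ?thesis by simp
  qed
  have N1: "N1 \<le> 16 * real s * l / m"
  proof (cases "N1 = 0")
    case False
    then have pos: "N1 > 0" using N1_0 by simp
    have "m * N1\<^sup>2 \<le> 8 * real s * (N1 * (2 * l))"
      by (rule order_trans[OF half]) (intro mult_left_mono q_up, auto)
    then have "N1 * (m * N1) \<le> N1 * (16 * real s * l)" by (simp add: power2_eq_square algebra_simps)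
    then have "m * N1 \<le> 16 * real s * l" using pos by simp
    then show ?thesis using m by (simp add: field_simps)
  qed (use l m in auto)
  then show "(\<Sum>j<p. \<bar>\<theta> j - \<beta> j\<bar>) \<le> 16 * real s * l / m" by (simp add: N1_def D_def)
  have "q \<le> N1 * (2 * l)" by (rule q_up)
  also have "\<dots> \<le> (16 * real s * l / m) * (2 * l)" using N1 l by (intro mult_right_mono) auto
  also have "\<dots> = 32 * real s * l\<^sup>2 / m" by (simp add: power2_eq_square)
  finally show "(\<Sum>i<n. (\<Sum>j<p. W i j * (\<theta> j - \<beta> j))\<^sup>2) / n \<le> 32 * real s * l\<^sup>2 / m"
    by (simp add: q_def D_def)
qed

lemma linf_norm_le_iff:
  "c \<ge> 0 \<Longrightarrow> linf_norm v \<le> c \<longleftrightarrow> (\<forall>i<dim_vec v. \<bar>vec_index v i\<bar> \<le> c)"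
  unfolding linf_norm_def by auto

lemma linf_norm_attained:
  "linf_norm v \<noteq> 0 \<Longrightarrow> \<exists>i<dim_vec v. \<bar>vec_index v i\<bar> = linf_norm v"
proof -
  assume "linf_norm v \<noteq> 0"
  moreover have "linf_norm v \<in> insert 0 ((\<lambda>i. \<bar>vec_index v i\<bar>) ` {..<dim_vec v})"
    unfolding linf_norm_def by (rule Max_in) auto
  ultimately show ?thesis by auto
qed

lemma linf_norm_ge: "i < dim_vec v \<Longrightarrow> \<bar>vec_index v i\<bar> \<le> linf_norm v"
  unfolding linf_norm_def by (intro Max_ge) auto

lemma linf_norm_nonneg: "linf_norm v \<ge> 0"
  unfolding linf_norm_def by (intro Max_ge) auto

lemma mult_mat_vec_index:
  assumes "A \<in> carrier_mat n p" "v \<in> carrier_vec p" "i < n"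
  shows "vec_index (A *\<^sub>v v) i = (\<Sum>j<p. A $$ (i, j) * vec_index v j)"
  using assms by (auto simp: scalar_prod_def lessThan_atLeast0 intro!: sum.cong)

lemma dantzig_feasible_iff:
  assumes W: "W \<in> carrier_mat n p" and Y: "Y \<in> carrier_vec n" and \<theta>: "\<theta> \<in> carrier_vec p"
    and c: "c \<ge> 0"
  shows "linf_norm ((1 / real (dim_row W)) \<cdot>\<^sub>v (transpose_mat W *\<^sub>v (Y - W *\<^sub>v \<theta>))) \<le> c \<longleftrightarrow>
    (\<forall>j<p. \<bar>(\<Sum>i<n. W $$ (i, j) * (vec_index Y i - (\<Sum>k<p. W $$ (i, k) * vec_index \<theta> k))) / n\<bar> \<le> c)"
proof -
  define X where "X = (1 / real (dim_row W)) \<cdot>\<^sub>v (transpose_mat W *\<^sub>v (Y - W *\<^sub>v \<theta>))"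
  have ix: "vec_index X j =
      (\<Sum>i<n. W $$ (i, j) * (vec_index Y i - (\<Sum>k<p. W $$ (i, k) * vec_index \<theta> k))) / n" if "j < p" for j
  proof -
    have "vec_index (transpose_mat W *\<^sub>v (Y - W *\<^sub>v \<theta>)) j =
       (\<Sum>i<n. transpose_mat W $$ (j, i) * vec_index (Y - W *\<^sub>v \<theta>) i)"
      using assms that by (intro mult_mat_vec_index) auto
    also have "\<dots> = (\<Sum>i<n. W $$ (i, j) * (vec_index Y i - (\<Sum>k<p. W $$ (i, k) * vec_index \<theta> k)))"
      using assms that
      by (intro sum.cong) (auto simp: mult_mat_vec_index[OF W \<theta>] simp del: index_mult_mat_vec)
    finally show ?thesis using assms that by (simp add: X_def del: index_mult_mat_vec)
  qed
  have "dim_vec X = p" using W by (simp add: X_def)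
  then have "linf_norm X \<le> c \<longleftrightarrow> (\<forall>j<p. \<bar>vec_index X j\<bar> \<le> c)" using linf_norm_le_iff[OF c] by simp
  then show ?thesis unfolding X_def[symmetric] by (simp add: ix)
qed

definition rms :: "nat \<Rightarrow> (nat \<Rightarrow> real) \<Rightarrow> real" where
  "rms n f = L2_set f {..<n} / sqrt (real n)"

definition residual :: "real Matrix.mat \<Rightarrow> real Matrix.vec \<Rightarrow> real Matrix.vec \<Rightarrow> nat \<Rightarrow> real" where
  "residual W Y t i = vec_index Y i - (\<Sum>j<dim_col W. W $$ (i, j) * vec_index t j)"

lemma rms_nonneg: "rms n f \<ge> 0"
  by (simp add: rms_def)

lemma rms_square: "(rms n f)\<^sup>2 = (\<Sum>i<n. (f i)\<^sup>2) / n"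
  by (simp add: rms_def L2_set_def power_divide sum_nonneg)

text \<open>At \<open>\<sigma> = rms e\<close> the true vector is feasible and the prediction error is at most \<open>\<sigma> / 4\<close>; hence the
  residual stays above \<open>\<sigma> / sqrt 2\<close> and the selected level is at least \<open>rms e\<close>.  At the selected level
  the true vector is then feasible as well, and admissibility together with the prediction error
  bound gives at most \<open>3 rms e\<close>.\<close>

lemma adds_error:
  fixes W :: "real Matrix.mat" and S :: "nat \<Rightarrow> nat \<Rightarrow> real"
  assumes W: "W \<in> carrier_mat n p" and n: "n > 0" and Y: "Y \<in> carrier_vec n"
    and y: "\<And>i. i < n \<Longrightarrow> vec_index Y i = (\<Sum>j<p. W $$ (i, j) * \<beta> j) + \<epsilon> i"
    and gram: "\<And>j k. j < p \<Longrightarrow> k < p \<Longrightarrow> \<bar>(\<Sum>i<n. W $$ (i, j) * W $$ (i, k)) / n - S j k\<bar> \<le> d"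
    and pd: "\<And>x::nat\<Rightarrow>real. m * (\<Sum>j<p. (x j)\<^sup>2) \<le> (\<Sum>j<p. x j * (\<Sum>k<p. x k * S j k))"
    and feas0: "\<And>j. j < p \<Longrightarrow> \<bar>(\<Sum>i<n. W $$ (i, j) * \<epsilon> i) / n\<bar> \<le> eta * rms n \<epsilon>"
    and s: "card {j. j < p \<and> \<beta> j \<noteq> 0} \<le> s"
    and sd: "8 * real s * d \<le> m" and m: "m > 0" and eta: "eta \<ge> 0"
    and small: "32 * real s * eta\<^sup>2 / m \<le> 1 / 16"
    and t: "is_adds eta W Y t"
  defines "R \<equiv> residual W Y t"
  shows "t \<in> carrier_vec p"
    and "(\<Sum>j<p. \<bar>vec_index t j - \<beta> j\<bar>) \<le> 48 * real s * eta * rms n \<epsilon> / m"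
    and "rms n \<epsilon> / 2 \<le> rms n R" and "rms n R \<le> 2 * rms n \<epsilon>"
    and "\<And>j. j < p \<Longrightarrow> \<bar>(\<Sum>i<n. W $$ (i, j) * R i) / n\<bar> \<le> 3 * eta * rms n \<epsilon>"
proof -
  define e where "e = rms n \<epsilon>"
  have e0: "e \<ge> 0" by (auto simp: e_def rms_def)
  obtain th \<sigma>s where th: "\<And>\<sigma>. \<sigma> \<ge> 0 \<Longrightarrow> is_dantzig eta W Y \<sigma> (th \<sigma>)"
    and adm: "\<sigma>s \<ge> 0" "(l2_norm (Y - W *\<^sub>v th \<sigma>s))\<^sup>2 \<ge> real (dim_row W) * \<sigma>s\<^sup>2 / 2"
    and max: "\<And>\<sigma>. \<sigma> \<ge> 0 \<Longrightarrow> (l2_norm (Y - W *\<^sub>v th \<sigma>))\<^sup>2 \<ge> real (dim_row W) * \<sigma>\<^sup>2 / 2 \<Longrightarrow> \<sigma> \<le> \<sigma>s"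
    and tth: "t = th \<sigma>s"
    using t unfolding is_adds_def Let_def by auto
  define res where "res \<sigma> i = vec_index Y i - (\<Sum>j<p. W $$ (i, j) * vec_index (th \<sigma>) j)" for \<sigma> i
  have carr: "th \<sigma> \<in> carrier_vec p" if "\<sigma> \<ge> 0" for \<sigma>
    using th[OF that] W unfolding is_dantzig_def is_arg_min_def by auto
  have l2: "(l2_norm (Y - W *\<^sub>v th \<sigma>))\<^sup>2 = n * (rms n (res \<sigma>))\<^sup>2" if "\<sigma> \<ge> 0" for \<sigma>
  proof -
    have "(l2_norm (Y - W *\<^sub>v th \<sigma>))\<^sup>2 = (\<Sum>i<n. (res \<sigma> i)\<^sup>2)"
      using W Y mult_mat_vec_index[OF W carr[OF that]]
      by (simp add: l2_norm_def res_def sum_nonneg del: index_mult_mat_vec)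
    also have "\<dots> = n * (rms n (res \<sigma>))\<^sup>2"
      using n by (simp add: rms_def L2_set_def power_divide sum_nonneg)
    finally show ?thesis .
  qed
  have adm_iff: "(l2_norm (Y - W *\<^sub>v th \<sigma>))\<^sup>2 \<ge> real (dim_row W) * \<sigma>\<^sup>2 / 2 \<longleftrightarrow> (rms n (res \<sigma>))\<^sup>2 \<ge> \<sigma>\<^sup>2 / 2"
    if "\<sigma> \<ge> 0" for \<sigma>
    using n W by (simp add: l2[OF that] field_simps)
  have feas: "\<bar>(\<Sum>i<n. W $$ (i, j) * res \<sigma> i) / n\<bar> \<le> eta * \<sigma>" if "\<sigma> \<ge> 0" "j < p" for \<sigma> j
    using th[OF that(1)] that eta dantzig_feasible_iff[OF W Y carr[OF that(1)], of "eta * \<sigma>"]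
    unfolding is_dantzig_def is_arg_min_def res_def by auto
  have err: "(\<Sum>j<p. \<bar>vec_index (th \<sigma>) j - \<beta> j\<bar>) \<le> 16 * real s * (eta * \<sigma>) / m"
      "rms n (res \<sigma>) \<le> e + \<sigma> / 4" "e - \<sigma> / 4 \<le> rms n (res \<sigma>)" if "\<sigma> \<ge> e" for \<sigma>
  proof -
    have \<sigma>0: "\<sigma> \<ge> 0" using that e0 by simp
    define v0 where "v0 = Matrix.vec p \<beta>"
    have v0: "v0 \<in> carrier_vec p" "\<And>j. j < p \<Longrightarrow> vec_index v0 j = \<beta> j" by (auto simp: v0_def)
    have fe: "\<bar>(\<Sum>i<n. W $$ (i, j) * \<epsilon> i) / n\<bar> \<le> eta * \<sigma>" if "j < p" for j
      using feas0[OF that] mult_left_mono[OF \<open>\<sigma> \<ge> e\<close> eta] by (simp add: e_def)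
    have "(\<Sum>i<n. W $$ (i, j) * (vec_index Y i - (\<Sum>k<p. W $$ (i, k) * vec_index v0 k))) =
       (\<Sum>i<n. W $$ (i, j) * \<epsilon> i)" for j
      by (intro sum.cong) (auto simp: y v0)
    then have "linf_norm ((1 / real (dim_row W)) \<cdot>\<^sub>v (transpose_mat W *\<^sub>v (Y - W *\<^sub>v v0))) \<le> eta * \<sigma>"
      using dantzig_feasible_iff[OF W Y v0(1), of "eta * \<sigma>"] fe eta \<sigma>0 by auto
    then have "l1_norm (th \<sigma>) \<le> l1_norm v0"
      using th[OF \<sigma>0] v0(1) W unfolding is_dantzig_def is_arg_min_def by auto
    then have l1: "(\<Sum>j<p. \<bar>vec_index (th \<sigma>) j\<bar>) \<le> (\<Sum>j<p. \<bar>\<beta> j\<bar>)"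
      using carr[OF \<sigma>0] v0 by (simp add: l1_norm_def)
    have l0: "0 \<le> eta * \<sigma>" using eta \<sigma>0 by simp
    note D = dantzig_error[where W="\<lambda>i j. W $$ (i, j)" and S=S and n=n and p=p and s=s and d=d
        and m=m and y="vec_index Y" and \<beta>=\<beta> and \<epsilon>=\<epsilon> and \<theta>="vec_index (th \<sigma>)" and l="eta * \<sigma>",
        OF gram pd y fe feas[OF \<sigma>0, unfolded res_def] l1 s sd m l0]
    show "(\<Sum>j<p. \<bar>vec_index (th \<sigma>) j - \<beta> j\<bar>) \<le> 16 * real s * (eta * \<sigma>) / m"
      by (rule D(1))
    define w where "w i = (\<Sum>j<p. W $$ (i, j) * (vec_index (th \<sigma>) j - \<beta> j))" for i
    have "(\<Sum>i<n. (w i)\<^sup>2) / n \<le> 32 * real s * (eta * \<sigma>)\<^sup>2 / m"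
      unfolding w_def by (rule D(2))
    also have "\<dots> = 32 * real s * eta\<^sup>2 / m * \<sigma>\<^sup>2" by (simp add: power_mult_distrib)
    also have "\<dots> \<le> 1 / 16 * \<sigma>\<^sup>2" by (intro mult_right_mono small) auto
    also have "\<dots> = (\<sigma> / 4)\<^sup>2" by (simp add: power_divide)
    finally have "sqrt ((\<Sum>i<n. (w i)\<^sup>2) / n) \<le> \<sigma> / 4"
      using \<sigma>0 by (intro real_le_lsqrt) (auto intro!: divide_nonneg_nonneg sum_nonneg)
    then have wl: "L2_set w {..<n} / sqrt n \<le> \<sigma> / 4" by (simp add: L2_set_def real_sqrt_divide)
    have rw: "res \<sigma> i = \<epsilon> i - w i" if "i < n" for i
      using y[OF that] by (simp add: res_def w_def right_diff_distrib sum_subtractf)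
    have "L2_set (res \<sigma>) {..<n} = L2_set (\<lambda>i. \<epsilon> i + (- w i)) {..<n}"
      by (intro L2_set_cong) (auto simp: rw)
    also have "\<dots> \<le> L2_set \<epsilon> {..<n} + L2_set w {..<n}"
      using L2_set_triangle_ineq[of \<epsilon> "\<lambda>i. - w i" "{..<n}"] by (simp add: L2_set_def)
    finally have "L2_set (res \<sigma>) {..<n} / sqrt n \<le> L2_set \<epsilon> {..<n} / sqrt n + L2_set w {..<n} / sqrt n"
      using n by (simp add: add_divide_distrib[symmetric] divide_right_mono)
    then show "rms n (res \<sigma>) \<le> e + \<sigma> / 4"
      using wl unfolding rms_def e_def by linarith
    have "L2_set \<epsilon> {..<n} = L2_set (\<lambda>i. res \<sigma> i + w i) {..<n}"
      by (intro L2_set_cong) (auto simp: rw)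
    also have "\<dots> \<le> L2_set (res \<sigma>) {..<n} + L2_set w {..<n}" by (rule L2_set_triangle_ineq)
    finally have "L2_set \<epsilon> {..<n} / sqrt n \<le> L2_set (res \<sigma>) {..<n} / sqrt n + L2_set w {..<n} / sqrt n"
      using n by (simp add: add_divide_distrib[symmetric] divide_right_mono)
    then show "e - \<sigma> / 4 \<le> rms n (res \<sigma>)"
      using wl unfolding rms_def e_def by linarith
  qed
  \<comment> \<open>The level \<open>e\<close> is admissible, because \<open>(3/4)\<^sup>2 \<ge>
     1/2\<close>.\<close>
  have "e \<le> \<sigma>s"
  proof (rule max[OF e0])
    have "(3 / 4 * e)\<^sup>2 \<le> (rms n (res e))\<^sup>2" using err(3)[of e] e0 by (intro power_mono) auto
    moreover have "(3 / 4 * e)\<^sup>2 = 9 / 16 * e\<^sup>2" by (simp add: power_mult_distrib power_divide)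
    ultimately have "e\<^sup>2 / 2 \<le> (rms n (res e))\<^sup>2" using zero_le_power2[of e] by linarith
    then show "real (dim_row W) * e\<^sup>2 / 2 \<le> (l2_norm (Y - W *\<^sub>v th e))\<^sup>2" using adm_iff[OF e0] by simp
  qed
  note E = err[OF this]
  have Rres: "R = res \<sigma>s" using W by (auto simp: R_def residual_def res_def tth)
  have r0: "rms n (res \<sigma>s) \<ge> 0" by (auto simp: rms_def)
  \<comment> \<open>The rational number 7/10 stands for a lower bound of \<open>1 / sqrt
     2\<close>.\<close>
  have "(7 / 10 * \<sigma>s)\<^sup>2 \<le> (rms n (res \<sigma>s))\<^sup>2"
  proof -
    have "(7 / 10 * \<sigma>s)\<^sup>2 = 49 / 100 * \<sigma>s\<^sup>2" by (simp add: power_mult_distrib power_divide)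
    moreover have "\<sigma>s\<^sup>2 / 2 \<le> (rms n (res \<sigma>s))\<^sup>2" using adm adm_iff by simp
    ultimately show ?thesis using zero_le_power2[of \<sigma>s] by linarith
  qed
  then have r1: "7 / 10 * \<sigma>s \<le> rms n (res \<sigma>s)" using r0 by (rule power2_le_imp_le)
  then have s3: "\<sigma>s \<le> 3 * e" using E(2) e0 adm(1) by linarith
  show "t \<in> carrier_vec p" using carr[OF adm(1)] tth by simp
  have "16 * real s * (eta * \<sigma>s) / m \<le> 16 * real s * (eta * (3 * e)) / m"
    using s3 eta m by (intro divide_right_mono mult_left_mono) auto
  then show "(\<Sum>j<p. \<bar>vec_index t j - \<beta> j\<bar>) \<le> 48 * real s * eta * rms n \<epsilon> / m"
    using E(1) unfolding e_def tth by simp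
  show "rms n \<epsilon> / 2 \<le> rms n R" "rms n R \<le> 2 * rms n \<epsilon>"
    using r1 E(2) s3 \<open>e \<le> \<sigma>s\<close> e0 adm(1) unfolding Rres e_def by linarith+
  fix j assume "j < p"
  then show "\<bar>(\<Sum>i<n. W $$ (i, j) * R i) / n\<bar> \<le> 3 * eta * rms n \<epsilon>"
    using feas[OF adm(1), of j] mult_left_mono[OF s3 eta] unfolding Rres e_def by simp
qed

section \<open>The deterministic lower bound for the score\<close>

lemma mean_square_add:
  "(\<Sum>i<n. (f i + h i)\<^sup>2) / n = (\<Sum>i<n. (f i)\<^sup>2) / n + 2 * ((\<Sum>i<n. f i * h i) / n) + (\<Sum>i<n. (h i)\<^sup>2) / n" for f h :: "nat \<Rightarrow> real"
  by (simp add: power2_sum sum.distrib sum_distrib_left add_divide_distrib algebra_simps)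

text \<open>The two parts of the effective noise \<open>v + u\<close> are nearly uncorrelated, so their mean squares add up to
  the order of \<open>g\<^sup>2 + (rms u)\<^sup>2\<close>.  This makes the self-normalized bounds for \<open>v\<close> and \<open>u\<close> usable relative
  to their sum even when \<open>g\<close> and \<open>u\<close> are both small.\<close>

lemma effective_noise_scale:
  assumes vv: "\<bar>(\<Sum>i<n. (v i)\<^sup>2) / n - q\<bar> \<le> d * g\<^sup>2" and q: "2 * k1 * g\<^sup>2 \<le> q" "q \<le> 2 * k2 * g\<^sup>2"
    and vu: "\<bar>(\<Sum>i<n. v i * u i) / n\<bar> \<le> d * g * rms n u"
    and d: "0 \<le> d" "d \<le> k1 / 2" "d \<le> 1 / 4" and g: "g \<ge> 0" and k2: "k2 \<ge> 0"
  shows "sqrt (min k1 (1/2) / 2) * (g + rms n u) \<le> rms n (\<lambda>i. v i + u i)"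
    and "rms n (\<lambda>i. v i + u i) \<le> sqrt (2 * k2 + 2) * (g + rms n u)"
proof -
  define s where "s = rms n u"
  define e where "e = rms n (\<lambda>i. v i + u i)"
  define V2 where "V2 = (\<Sum>i<n. (v i)\<^sup>2) / n"
  define X where "X = (\<Sum>i<n. v i * u i) / n"
  have s0: "s \<ge> 0" by (simp add: s_def rms_nonneg)
  have e2: "e\<^sup>2 = V2 + 2 * X + s\<^sup>2"
    unfolding e_def s_def rms_square V2_def X_def by (rule mean_square_add)
  have gs: "2 * (g * s) \<le> g\<^sup>2 + s\<^sup>2" using zero_le_power2[of "g - s"] by (simp add: power2_diff)
  have X: "\<bar>2 * X\<bar> \<le> d * (g\<^sup>2 + s\<^sup>2)"
  proof -
    have "\<bar>2 * X\<bar> \<le> d * (2 * (g * s))" using vu by (simp add: X_def s_def)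
    also have "\<dots> \<le> d * (g\<^sup>2 + s\<^sup>2)" using gs d by (intro mult_left_mono) auto
    finally show ?thesis .
  qed
  have V: "2 * k1 * g\<^sup>2 - d * g\<^sup>2 \<le> V2" "V2 \<le> 2 * k2 * g\<^sup>2 + d * g\<^sup>2"
    using vv q by (auto simp: V2_def abs_le_iff)
  have dg: "d * g\<^sup>2 \<le> k1 / 2 * g\<^sup>2" "d * g\<^sup>2 \<le> 1 / 4 * g\<^sup>2" "d * s\<^sup>2 \<le> 1 / 4 * s\<^sup>2"
    using mult_right_mono[OF d(2), of "g\<^sup>2"] mult_right_mono[OF d(3), of "g\<^sup>2"] mult_right_mono[OF d(3), of "s\<^sup>2"] by auto
  define a where "a = min k1 (1/2)"
  have a: "0 \<le> a" "a \<le> k1" "a \<le> 1/2" using d by (auto simp: a_def)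
  have low: "a * (g\<^sup>2 + s\<^sup>2) \<le> e\<^sup>2"
  proof -
    have "a * g\<^sup>2 \<le> k1 * g\<^sup>2" "a * s\<^sup>2 \<le> 1 / 2 * s\<^sup>2" using mult_right_mono[OF a(2), of "g\<^sup>2"] mult_right_mono[OF a(3), of "s\<^sup>2"] by auto
    moreover have "- (d * g\<^sup>2 + d * s\<^sup>2) \<le> 2 * X" using X by (simp add: distrib_left abs_le_iff)
    ultimately show ?thesis using V(1) dg zero_le_power2[of s] unfolding e2 distrib_left by linarith
  qed
  have "(sqrt (a / 2) * (g + s))\<^sup>2 = a / 2 * (g + s)\<^sup>2" using a by (simp add: power_mult_distrib)
  also have "\<dots> \<le> a / 2 * (2 * (g\<^sup>2 + s\<^sup>2))" using a gs by (intro mult_left_mono) (auto simp: power2_sum)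
  also have "\<dots> \<le> e\<^sup>2" using low by (simp add: algebra_simps)
  finally show "sqrt (min k1 (1/2) / 2) * (g + rms n u) \<le> rms n (\<lambda>i. v i + u i)"
    unfolding a_def[symmetric] s_def[symmetric] e_def[symmetric]
    by (rule power2_le_imp_le) (simp add: e_def rms_nonneg)
  have "e\<^sup>2 \<le> (2 * k2 + 2) * (g\<^sup>2 + s\<^sup>2)"
  proof -
    have "2 * X \<le> d * g\<^sup>2 + d * s\<^sup>2" using X by (simp add: distrib_left abs_le_iff)
    moreover have "(2 * k2 + 2) * (g\<^sup>2 + s\<^sup>2) = 2 * k2 * g\<^sup>2 + 2 * (k2 * s\<^sup>2) + 2 * g\<^sup>2 + 2 * s\<^sup>2"
      by (simp add: algebra_simps)
    ultimately show ?thesis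
      using V(2) dg zero_le_power2[of s] zero_le_power2[of g] mult_nonneg_nonneg[OF k2 zero_le_power2[of s]]
      unfolding e2 by linarith
  qed
  also have "\<dots> \<le> (2 * k2 + 2) * (g + s)\<^sup>2"
    using k2 g s0 by (intro mult_left_mono) (auto simp: power2_sum)
  also have "\<dots> = (sqrt (2 * k2 + 2) * (g + s))\<^sup>2" using k2 by (simp add: power_mult_distrib)
  finally show "rms n (\<lambda>i. v i + u i) \<le> sqrt (2 * k2 + 2) * (g + rms n u)"
    unfolding s_def[symmetric] e_def[symmetric]
    by (rule power2_le_imp_le) (use g s0 k2 in auto)
qed

lemma max_col_sparsity_ge:
  "j < dim_col P \<Longrightarrow> card {l. l < dim_row P \<and> P $$ (l, j) \<noteq> 0} \<le> max_col_sparsity P"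
proof -
  assume j: "j < dim_col P"
  have "l0_norm (col P j) = card {l. l < dim_row P \<and> P $$ (l, j) \<noteq> 0}"
    unfolding l0_norm_def using j by (auto intro!: arg_cong[where f=card])
  moreover have "l0_norm (col P j) \<le> max_col_sparsity P"
    unfolding max_col_sparsity_def using j by (intro Max_ge) auto
  ultimately show ?thesis by simp
qed

text \<open>The nonzero entries of \<open>P c\<close> lie in the columns selected by the support of \<open>c\<close>.  This is the source
  of the product \<open>s\<^sub>\<Pi> \<parallel>\<beta>\<^sub>A - \<beta>\<^sub>B\<parallel>\<^sub>0\<close> in the sparsity condition.\<close>

lemma support_of_combination:
  fixes P :: "real Matrix.mat"
  assumes P: "P \<in> carrier_mat p p"
  shows "card {l. l < p \<and> b l + (\<Sum>j<p. P $$ (l, j) * c j) \<noteq> 0}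
    \<le> max_col_sparsity P * card {j. j < p \<and> c j \<noteq> 0} + card {l. l < p \<and> b l \<noteq> 0}"
proof -
  let ?J = "{j. j < p \<and> c j \<noteq> 0}"
  have "{l. l < p \<and> b l + (\<Sum>j<p. P $$ (l, j) * c j) \<noteq> 0} \<subseteq>
      (\<Union>j\<in>?J. {l. l < p \<and> P $$ (l, j) \<noteq> 0}) \<union> {l. l < p \<and> b l \<noteq> 0}"
  proof
    fix l assume l: "l \<in> {l. l < p \<and> b l + (\<Sum>j<p. P $$ (l, j) * c j) \<noteq> 0}"
    show "l \<in> (\<Union>j\<in>?J. {l. l < p \<and> P $$ (l, j) \<noteq> 0}) \<union> {l. l < p \<and> b l \<noteq> 0}"
    proof (rule ccontr)
      assume "\<not> ?thesis"
      then have "b l = 0" "\<And>j. j < p \<Longrightarrow> P $$ (l, j) * c j = 0" using l by auto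
      moreover from this(2) have "(\<Sum>j<p. P $$ (l, j) * c j) = 0" by (intro sum.neutral) simp
      ultimately show False using l by simp
    qed
  qed
  then have "card {l. l < p \<and> b l + (\<Sum>j<p. P $$ (l, j) * c j) \<noteq> 0} \<le>
      card ((\<Union>j\<in>?J. {l. l < p \<and> P $$ (l, j) \<noteq> 0}) \<union> {l. l < p \<and> b l \<noteq> 0})"
    by (rule card_mono[rotated]) auto
  also have "\<dots> \<le> card (\<Union>j\<in>?J. {l. l < p \<and> P $$ (l, j) \<noteq> 0}) + card {l. l < p \<and> b l \<noteq> 0}"
    by (rule card_Un_le)
  also have "card (\<Union>j\<in>?J. {l. l < p \<and> P $$ (l, j) \<noteq> 0}) \<le> (\<Sum>j\<in>?J. card {l. l < p \<and> P $$ (l, j) \<noteq> 0})"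
    by (rule card_UN_le) simp
  also have "\<dots> \<le> (\<Sum>j\<in>?J. max_col_sparsity P)"
    using max_col_sparsity_ge[of _ P] P by (intro sum_mono) auto
  finally show ?thesis by (simp add: mult.commute)
qed

text \<open>With \<open>\<Delta>\<^sub>\<theta>\<close> and \<open>\<Delta>\<^sub>j\<close> the estimation errors, the score of column \<open>j\<close> is
  \<open>V\<^sub>j\<^sup>T e - \<Delta>\<^sub>j\<^sup>T W\<^sup>T e - \<Delta>\<^sub>\<theta>\<^sup>T W\<^sup>T (Z\<^sub>j - W \<Pi>\<^sub>j)\<close> with \<open>\<Pi>\<^sub>j\<close> the estimated column.  In both correction terms the \<open>\<ell>\<^sub>1\<close> error is
  \<open>O(s \<eta>)\<close> and the entries of the other factor are \<open>O(n \<eta>)\<close>: in the first because \<open>\<eta>\<close> dominates the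
  noise, in the second because the estimate is feasible.  The conclusions collect what the studentized statistic and its critical value need.\<close>

lemma score_lower_bound:
  fixes W Z P Pt :: "real Matrix.mat" and Y t :: "real Matrix.vec" and V S :: "nat \<Rightarrow> nat \<Rightarrow> real" and u \<gamma> \<theta> SV q :: "nat \<Rightarrow> real" and k1 k2 c r eta g :: real and n p s :: nat
  defines "v \<equiv> (\<lambda>i. \<Sum>j<p. V i j * \<gamma> j)"
  defines "e \<equiv> (\<lambda>i. v i + u i)"
  assumes W: "W \<in> carrier_mat n p" and Z: "Z \<in> carrier_mat n p" and Y: "Y \<in> carrier_vec n" and n: "n > 0"
    and Zeq: "\<And>i j. i < n \<Longrightarrow> j < p \<Longrightarrow> Z $$ (i, j) = (\<Sum>k<p. W $$ (i, k) * P $$ (k, j)) + V i j"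
    and Yeq: "\<And>i. i < n \<Longrightarrow> vec_index Y i = (\<Sum>j<p. W $$ (i, j) * \<theta> j) + e i"
    and pd: "\<And>x::nat\<Rightarrow>real. 2 * k1 * (\<Sum>j<p. (x j)\<^sup>2) \<le> (\<Sum>j<p. x j * (\<Sum>k<p. x k * S j k))"
    and WW: "\<And>j k. j < p \<Longrightarrow> k < p \<Longrightarrow> \<bar>(\<Sum>i<n. W $$ (i, j) * W $$ (i, k)) / n - S j k\<bar> \<le> c * r"
    and WV: "\<And>j k. j < p \<Longrightarrow> k < p \<Longrightarrow> \<bar>(\<Sum>i<n. W $$ (i, j) * V i k) / n\<bar> \<le> c * r"
    and VV: "\<And>j. j < p \<Longrightarrow> \<bar>(\<Sum>i<n. (V i j)\<^sup>2) / n - q j\<bar> \<le> c * r"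
    and q: "\<And>j. j < p \<Longrightarrow> 2 * k1 \<le> q j" "\<And>j. j < p \<Longrightarrow> q j \<le> 2 * k2"
    and Wv: "\<And>j. j < p \<Longrightarrow> \<bar>(\<Sum>i<n. W $$ (i, j) * v i) / n\<bar> \<le> c * r * g"
    and Vv: "\<And>j. j < p \<Longrightarrow> \<bar>(\<Sum>i<n. V i j * v i) / n - SV j\<bar> \<le> c * r * g"
    and vv: "\<bar>(\<Sum>i<n. (v i)\<^sup>2) / n - q0\<bar> \<le> c * r * g\<^sup>2" and q0: "2 * k1 * g\<^sup>2 \<le> q0" "q0 \<le> 2 * k2 * g\<^sup>2"
    and Wu: "\<And>j. j < p \<Longrightarrow> \<bar>(\<Sum>i<n. W $$ (i, j) * u i) / n\<bar> \<le> c * r * rms n u"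
    and Vu: "\<And>j. j < p \<Longrightarrow> \<bar>(\<Sum>i<n. V i j * u i) / n\<bar> \<le> c * r * rms n u"
    and vu: "\<bar>(\<Sum>i<n. v i * u i) / n\<bar> \<le> c * r * g * rms n u"
    and sP: "\<And>j. j < p \<Longrightarrow> card {k. k < p \<and> P $$ (k, j) \<noteq> 0} \<le> s"
    and s\<theta>: "card {j. j < p \<and> \<theta> j \<noteq> 0} \<le> s"
    and k: "k1 > 0" "k2 > 0" and c: "c > 0" and r: "r > 0" and g: "g > 0"
    and eta: "eta \<ge> c / sqrt (min k1 (1/2) / 2) * r"
    and small: "c * r \<le> k1 / 2" "c * r \<le> 1 / 4" "8 * real s * (c * r) \<le> 2 * k1" "32 * real s * eta\<^sup>2 / (2 * k1) \<le> 1 / 16"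
    and addsY: "is_adds eta W Y t"
    and addsZ: "\<And>j. j < p \<Longrightarrow> is_adds eta W (col Z j) (col Pt j)" and Pt: "Pt \<in> carrier_mat p p"
  defines "Ry \<equiv> residual W Y t" and "Rv \<equiv> (\<lambda>j. residual W (col Z j) (col Pt j))"
  shows "t \<in> carrier_vec p" and "0 < rms n e" and "rms n e \<le> sqrt (2 * k2 + 2) * (g + rms n u)"
    and "rms n e / 2 \<le> rms n Ry" "rms n Ry \<le> 2 * rms n e"
    and "\<And>j. j < p \<Longrightarrow> 0 < rms n (Rv j)" "\<And>j. j < p \<Longrightarrow> (rms n (Rv j))\<^sup>2 \<le> 4 * (2 * k2 + 1)"
    and "\<And>j. j < p \<Longrightarrow> \<bar>SV j\<bar> - c * r * (g + rms n u) - 96 * real s * eta\<^sup>2 * sqrt (2 * k2 + 1) / k1 * rms n e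
        \<le> \<bar>\<Sum>i<n. Rv j i * Ry i\<bar> / n"
proof -
  define a where "a = sqrt (min k1 (1/2) / 2)"
  have a: "a > 0" using k by (simp add: a_def)
  have a_k: "a \<le> sqrt k1" using k by (auto simp: a_def)
  have cr: "c * r > 0" using c r by simp
  have u0: "rms n u \<ge> 0" by (rule rms_nonneg)
  note ns = effective_noise_scale[where v=v and u=u and d="c * r", OF vv q0 vu less_imp_le[OF cr] small(1,2) less_imp_le[OF g] less_imp_le[OF k(2)]]
  have elow: "a * (g + rms n u) \<le> rms n e" and eup: "rms n e \<le> sqrt (2 * k2 + 2) * (g + rms n u)"
    using ns unfolding e_def a_def by auto
  show "rms n e \<le> sqrt (2 * k2 + 2) * (g + rms n u)" by (rule eup)
  have e0: "0 < rms n e" using elow a g u0 by (smt (verit) mult_pos_pos)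
  show "0 < rms n e" by (rule e0)
  have eta0: "eta > 0" using eta a c r by (smt (verit) a_def divide_pos_pos mult_pos_pos)
  have m: "2 * k1 > 0" using k by simp
  have We: "\<bar>(\<Sum>i<n. W $$ (i, j) * e i) / n\<bar> \<le> eta * rms n e" if j: "j < p" for j
  proof -
    have "(\<Sum>i<n. W $$ (i, j) * e i) / n = (\<Sum>i<n. W $$ (i, j) * v i) / n + (\<Sum>i<n. W $$ (i, j) * u i) / n"
      by (simp add: e_def distrib_left sum.distrib add_divide_distrib)
    then have "\<bar>(\<Sum>i<n. W $$ (i, j) * e i) / n\<bar> \<le> c * r * g + c * r * rms n u"
      using Wv[OF j] Wu[OF j] by linarith
    also have "\<dots> = c / a * r * (a * (g + rms n u))" using a by (simp add: field_simps)
    also have "\<dots> \<le> c / a * r * rms n e" using elow a c r by (intro mult_left_mono) auto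
    also have "\<dots> \<le> eta * rms n e" using eta unfolding a_def[symmetric] by (intro mult_right_mono rms_nonneg)
    finally show ?thesis .
  qed
  have small4: "32 * real s * eta\<^sup>2 / (2 * k1) \<le> 1 / 16" by (rule small(4))
  note AY = adds_error[where S=S and \<epsilon>=e and \<beta>=\<theta>, OF W n Y Yeq WW pd We s\<theta> small(3) m less_imp_le[OF eta0] small4 addsY]
  show tc: "t \<in> carrier_vec p" by (rule AY(1))
  have AYl1: "(\<Sum>j<p. \<bar>vec_index t j - \<theta> j\<bar>) \<le> 48 * real s * eta * rms n e / (2 * k1)" by (rule AY(2))
  show Re1: "rms n e / 2 \<le> rms n Ry" unfolding Ry_def by (rule AY(3))
  show Re2: "rms n Ry \<le> 2 * rms n e" unfolding Ry_def by (rule AY(4))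
  define Vr where "Vr j = rms n (\<lambda>i. V i j)" for j
  have Vr: "sqrt k1 \<le> Vr j" "Vr j \<le> sqrt (2 * k2 + 1)" if j: "j < p" for j
  proof -
    have "k1 \<le> (Vr j)\<^sup>2" "(Vr j)\<^sup>2 \<le> 2 * k2 + 1"
      unfolding Vr_def rms_square using VV[OF j] q[OF j] small k by (auto simp: abs_le_iff)
    then show "sqrt k1 \<le> Vr j" "Vr j \<le> sqrt (2 * k2 + 1)"
      by (auto simp: Vr_def rms_nonneg intro: real_le_lsqrt real_le_rsqrt)
  qed
  have AZ: "(\<Sum>k<p. \<bar>Pt $$ (k, j) - P $$ (k, j)\<bar>) \<le> 48 * real s * eta * Vr j / (2 * k1)"
      "Vr j / 2 \<le> rms n (Rv j)" "rms n (Rv j) \<le> 2 * Vr j"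
      "\<And>k. k < p \<Longrightarrow> \<bar>(\<Sum>i<n. W $$ (i, k) * Rv j i) / n\<bar> \<le> 3 * eta * Vr j" if j: "j < p" for j
  proof -
    have cz: "col Z j \<in> carrier_vec n" using Z by auto
    have yz: "vec_index (col Z j) i = (\<Sum>k<p. W $$ (i, k) * P $$ (k, j)) + V i j" if "i < n" for i
      using Zeq[OF that j] Z j that by simp
    have fz: "\<bar>(\<Sum>i<n. W $$ (i, k) * V i j) / n\<bar> \<le> eta * rms n (\<lambda>i. V i j)" if "k < p" for k
    proof -
      have "\<bar>(\<Sum>i<n. W $$ (i, k) * V i j) / n\<bar> \<le> c * r" by (rule WV[OF that j])
      also have "\<dots> = c / a * r * a" using a by simp
      also have "\<dots> \<le> eta * Vr j"
        using eta a_k Vr(1)[OF j] eta0 a unfolding a_def[symmetric] by (intro mult_mono) auto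
      finally show ?thesis by (simp add: Vr_def)
    qed
    note A = adds_error[where S=S and \<epsilon>="\<lambda>i. V i j" and \<beta>="\<lambda>k. P $$ (k, j)",
       OF W n cz yz WW pd fz sP[OF j] small(3) m less_imp_le[OF eta0] small4 addsZ[OF j]]
    have "(\<Sum>k<p. \<bar>vec_index (col Pt j) k - P $$ (k, j)\<bar>) \<le> 48 * real s * eta * rms n (\<lambda>i. V i j) / (2 * k1)"
      by (rule A(2))
    then show "(\<Sum>k<p. \<bar>Pt $$ (k, j) - P $$ (k, j)\<bar>) \<le> 48 * real s * eta * Vr j / (2 * k1)"
      using Pt j by (simp add: Vr_def)
    show "Vr j / 2 \<le> rms n (Rv j)" unfolding Rv_def Vr_def by (rule A(3))
    show "rms n (Rv j) \<le> 2 * Vr j" unfolding Rv_def Vr_def by (rule A(4))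
    show "\<bar>(\<Sum>i<n. W $$ (i, k) * Rv j i) / n\<bar> \<le> 3 * eta * Vr j" if "k < p" for k
      unfolding Rv_def Vr_def by (rule A(5); (assumption | rule that))
  qed
  have k1s: "0 < sqrt k1" using k by simp
  show "0 < rms n (Rv j)" if "j < p" for j using AZ(2)[OF that] Vr(1)[OF that] k1s by linarith
  show "(rms n (Rv j))\<^sup>2 \<le> 4 * (2 * k2 + 1)" if "j < p" for j
  proof -
    have "(rms n (Rv j))\<^sup>2 \<le> (2 * sqrt (2 * k2 + 1))\<^sup>2"
      using AZ(3)[OF that] Vr(2)[OF that] by (intro power_mono rms_nonneg) auto
    also have "\<dots> = 4 * (2 * k2 + 1)" using k by (simp add: power_mult_distrib)
    finally show ?thesis .
  qed
  fix j assume j: "j < p"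
  define Dt where "Dt l = vec_index t l - \<theta> l" for l
  define Dp where "Dp l = Pt $$ (l, j) - P $$ (l, j)" for l
  have ReE: "Ry i = e i - (\<Sum>l<p. W $$ (i, l) * Dt l)" if "i < n" for i
    using Yeq[OF that] W by (simp add: Ry_def residual_def Dt_def right_diff_distrib sum_subtractf)
  have RvE: "Rv j i = V i j - (\<Sum>l<p. W $$ (i, l) * Dp l)" if "i < n" for i
    using Zeq[OF that j] W Z Pt j that by (simp add: Rv_def residual_def Dp_def right_diff_distrib sum_subtractf)
  \<comment> \<open>The main term and the two correction terms of the score.\<close>
  define N0 where "N0 = (\<Sum>i<n. V i j * e i) / n"
  define N1 where "N1 = (\<Sum>l<p. Dp l * ((\<Sum>i<n. W $$ (i, l) * e i) / n))"
  define N2 where "N2 = (\<Sum>l<p. Dt l * ((\<Sum>i<n. W $$ (i, l) * Rv j i) / n))"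
  have swap: "(\<Sum>i<n. (\<Sum>l<p. W $$ (i, l) * d l) * f i) / n = (\<Sum>l<p. d l * ((\<Sum>i<n. W $$ (i, l) * f i) / n))" for d f :: "nat \<Rightarrow> real"
    unfolding sum_distrib_left sum_distrib_right sum_divide_distrib
    by (subst sum.swap) (simp add: algebra_simps)
  have "(\<Sum>i<n. Rv j i * Ry i) / n = N0 - N1 - N2"
  proof -
    have "(\<Sum>i<n. Rv j i * Ry i) = (\<Sum>i<n. V i j * e i) - (\<Sum>i<n. (\<Sum>l<p. W $$ (i, l) * Dp l) * e i)
        - (\<Sum>i<n. (\<Sum>l<p. W $$ (i, l) * Dt l) * Rv j i)"
      unfolding sum_subtractf[symmetric]
    proof (rule sum.cong[OF refl])
      fix i assume "i \<in> {..<n}"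
      then have i: "i < n" by simp
      have "Rv j i * Ry i = Rv j i * e i - (\<Sum>l<p. W $$ (i, l) * Dt l) * Rv j i"
        unfolding ReE[OF i] by (simp add: algebra_simps)
      also have "Rv j i * e i = V i j * e i - (\<Sum>l<p. W $$ (i, l) * Dp l) * e i"
        unfolding RvE[OF i] by (simp add: algebra_simps)
      finally show "Rv j i * Ry i = V i j * e i - (\<Sum>l<p. W $$ (i, l) * Dp l) * e i - (\<Sum>l<p. W $$ (i, l) * Dt l) * Rv j i" .
    qed
    then have "(\<Sum>i<n. Rv j i * Ry i) / n = (\<Sum>i<n. V i j * e i) / n - (\<Sum>i<n. (\<Sum>l<p. W $$ (i, l) * Dp l) * e i) / n
        - (\<Sum>i<n. (\<Sum>l<p. W $$ (i, l) * Dt l) * Rv j i) / n"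
      by (simp only: diff_divide_distrib)
    then show ?thesis unfolding swap[of Dp e] swap[of Dt "Rv j"] N0_def N1_def N2_def .
  qed
  then have "\<bar>\<Sum>i<n. Rv j i * Ry i\<bar> / n = \<bar>N0 - N1 - N2\<bar>" by (metis abs_divide abs_of_nat)
  then have N: "\<bar>N0\<bar> - \<bar>N1\<bar> - \<bar>N2\<bar> \<le> \<bar>\<Sum>i<n. Rv j i * Ry i\<bar> / n"
    by linarith
  have "\<bar>N1\<bar> \<le> (\<Sum>l<p. \<bar>Dp l\<bar>) * (eta * rms n e)" unfolding N1_def by (intro abs_sum_mult_le We) simp
  also have "\<dots> \<le> (48 * real s * eta * Vr j / (2 * k1)) * (eta * rms n e)"
    using AZ(1)[OF j] eta0 e0 unfolding Dp_def by (intro mult_right_mono) auto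
  finally have N1: "\<bar>N1\<bar> \<le> (24 * real s * eta\<^sup>2 / k1 * rms n e) * Vr j" by (simp add: power2_eq_square mult_ac)
  have "\<bar>N2\<bar> \<le> (\<Sum>l<p. \<bar>Dt l\<bar>) * (3 * eta * Vr j)" unfolding N2_def by (intro abs_sum_mult_le AZ(4)[OF j]) simp
  also have "\<dots> \<le> (48 * real s * eta * rms n e / (2 * k1)) * (3 * eta * Vr j)"
    using AYl1 eta0 rms_nonneg[of n "\<lambda>i. V i j"] unfolding Dt_def Vr_def by (intro mult_right_mono) auto
  finally have N2: "\<bar>N2\<bar> \<le> 3 * ((24 * real s * eta\<^sup>2 / k1 * rms n e) * Vr j)" by (simp add: power2_eq_square mult_ac)
  have coef: "0 \<le> 24 * real s * eta\<^sup>2 / k1 * rms n e" using k e0 by simp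
  have N12: "\<bar>N1\<bar> + \<bar>N2\<bar> \<le> 96 * real s * eta\<^sup>2 * sqrt (2 * k2 + 1) / k1 * rms n e"
  proof -
    have "\<bar>N1\<bar> + \<bar>N2\<bar> \<le> 4 * ((24 * real s * eta\<^sup>2 / k1 * rms n e) * Vr j)" using N1 N2 by linarith
    also have "\<dots> \<le> 4 * ((24 * real s * eta\<^sup>2 / k1 * rms n e) * sqrt (2 * k2 + 1))"
      using Vr(2)[OF j] coef by (intro mult_left_mono) auto
    finally show ?thesis by (simp add: mult_ac)
  qed
  have N0: "\<bar>SV j\<bar> - c * r * (g + rms n u) \<le> \<bar>N0\<bar>"
  proof -
    have "N0 = (\<Sum>i<n. V i j * v i) / n + (\<Sum>i<n. V i j * u i) / n"
      by (simp add: N0_def e_def distrib_left sum.distrib add_divide_distrib)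
    then show ?thesis using Vv[OF j] Vu[OF j] by (simp add: distrib_left abs_le_iff abs_if split: if_splits)
  qed
  show "\<bar>SV j\<bar> - c * r * (g + rms n u) - 96 * real s * eta\<^sup>2 * sqrt (2 * k2 + 1) / k1 * rms n e
        \<le> \<bar>\<Sum>i<n. Rv j i * Ry i\<bar> / n"
    using N N12 N0 by linarith
qed

section \<open>Quadratic forms and the covariance of the linear statistics\<close>

definition qform :: "nat \<Rightarrow> real Matrix.mat \<Rightarrow> (nat \<Rightarrow> real) \<Rightarrow> (nat \<Rightarrow> real) \<Rightarrow> real" where
  "qform p A a b = (\<Sum>j<p. a j * (\<Sum>k<p. b k * A $$ (j, k)))"

lemma qform_add_left: "qform p A (\<lambda>j. a j + a' j) b = qform p A a b + qform p A a' b"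
  by (simp add: qform_def distrib_right sum.distrib)

lemma qform_add_right: "qform p A a (\<lambda>j. b j + b' j) = qform p A a b + qform p A a b'"
  by (simp add: qform_def distrib_left distrib_right sum.distrib)

lemma qform_scale_left: "qform p A (\<lambda>j. c * a j) b = c * qform p A a b"
  by (simp add: qform_def mult.assoc sum_distrib_left)

lemma qform_scale_right: "qform p A a (\<lambda>j. c * b j) = c * qform p A a b"
  by (simp add: qform_def mult.assoc mult.left_commute sum_distrib_left)

lemma qform_sym:
  assumes "\<And>j k. j < p \<Longrightarrow> k < p \<Longrightarrow> A $$ (j, k) = A $$ (k, j)"
  shows "qform p A a b = qform p A b a"
  unfolding qform_def sum_distrib_left
  by (subst sum.swap) (intro sum.cong refl, auto simp: assms mult_ac)

lemma qform_eq_inner: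
  assumes "A \<in> carrier_mat p p"
  shows "qform p A a b = (\<Sum>j<p. a j * vec_index (A *\<^sub>v Matrix.vec p b) j)"
  unfolding qform_def by (intro sum.cong refl arg_cong2[where f="(*)"])
     (use assms in \<open>auto simp: mult_mat_vec_index[OF assms] mult.commute simp del: index_mult_mat_vec\<close>)

lemma qform_one: "qform p (1\<^sub>m p) a b = (\<Sum>j<p. a j * b j)"
  by (simp add: qform_def if_distrib cong: if_cong)

text \<open>Cauchy-Schwarz for a positive semidefinite form, by minimizing \<open>t \<mapsto> Q(a + t b)\<close>.\<close>

lemma qform_CS:
  assumes sym: "\<And>j k. j < p \<Longrightarrow> k < p \<Longrightarrow> A $$ (j, k) = A $$ (k, j)"
    and psd: "\<And>x. qform p A x x \<ge> 0"
  shows "(qform p A a b)\<^sup>2 \<le> qform p A a a * qform p A b b"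
proof -
  define u v w where "u = qform p A a a" and "v = qform p A a b" and "w = qform p A b b"
  have e: "0 \<le> u + 2 * t * v + t\<^sup>2 * w" for t
  proof -
    have "qform p A (\<lambda>j. a j + t * b j) (\<lambda>j. a j + t * b j) = u + 2 * t * v + t\<^sup>2 * w"
      using qform_sym[where a=b and b=a, OF sym]
      by (simp add: qform_add_left qform_add_right qform_scale_left qform_scale_right u_def v_def w_def
        power2_eq_square algebra_simps)
    then show ?thesis using psd[of "\<lambda>j. a j + t * b j"] by simp
  qed
  have w0: "w \<ge> 0" using psd by (simp add: w_def)
  show ?thesis
  proof (cases "w = 0")
    case False
    have "0 \<le> u + 2 * (- v / w) * v + (- v / w)\<^sup>2 * w" by (rule e)
    also have "\<dots> = u - v\<^sup>2 / w" using False by (simp add: power2_eq_square field_simps)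
    finally show ?thesis using False w0 unfolding u_def[symmetric] v_def[symmetric] w_def[symmetric]
      by (simp add: field_simps)
  next
    case True
    have "v = 0"
    proof (rule ccontr)
      assume v: "v \<noteq> 0"
      have "2 * (- (u + 1) / (2 * v)) * v = - (u + 1)" using v by (simp add: field_simps)
      then show False using e[of "- (u + 1) / (2 * v)"] True by simp
    qed
    then show ?thesis using True by (simp add: v_def w_def)
  qed
qed

lemma qform_abs_bound: "\<exists>c>0. \<forall>x. \<bar>qform p A x x\<bar> \<le> c * (\<Sum>j<p. (x j)\<^sup>2)"
proof -
  define c where "c = 1 + (\<Sum>j<p. \<Sum>k<p. \<bar>A $$ (j, k)\<bar>)"
  have "\<bar>qform p A x x\<bar> \<le> c * (\<Sum>j<p. (x j)\<^sup>2)" for x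
  proof -
    define q where "q = (\<Sum>j<p. (x j)\<^sup>2)"
    have xx: "\<bar>x j * x k\<bar> \<le> q" if "j < p" "k < p" for j k
    proof -
      have "2 * \<bar>x j * x k\<bar> \<le> (x j)\<^sup>2 + (x k)\<^sup>2"
        using zero_le_power2[of "\<bar>x j\<bar> - \<bar>x k\<bar>"] by (simp add: power2_diff abs_mult)
      moreover have "(x j)\<^sup>2 \<le> q" "(x k)\<^sup>2 \<le> q" unfolding q_def using that by (auto intro!: member_le_sum)
      ultimately show ?thesis by linarith
    qed
    have q0: "q \<ge> 0" by (simp add: q_def sum_nonneg)
    have "\<bar>qform p A x x\<bar> \<le> (\<Sum>j<p. \<bar>x j * (\<Sum>k<p. x k * A $$ (j, k))\<bar>)"
      unfolding qform_def by (rule sum_abs)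
    also have "\<dots> \<le> (\<Sum>j<p. \<Sum>k<p. \<bar>x j * x k * A $$ (j, k)\<bar>)"
      by (intro sum_mono) (simp add: sum_distrib_left mult.assoc sum_abs)
    also have "\<dots> \<le> (\<Sum>j<p. \<Sum>k<p. q * \<bar>A $$ (j, k)\<bar>)"
      unfolding abs_mult[of "_ * _" "A $$ _"] by (intro sum_mono mult_right_mono xx) auto
    also have "\<dots> = q * (\<Sum>j<p. \<Sum>k<p. \<bar>A $$ (j, k)\<bar>)" by (simp add: sum_distrib_left)
    also have "\<dots> \<le> q * c" unfolding c_def using q0 by (intro mult_left_mono) auto
    finally show ?thesis by (simp add: q_def mult.commute)
  qed
  moreover have "c > 0" unfolding c_def by (intro add_pos_nonneg sum_nonneg) auto
  ultimately show ?thesis by blast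
qed

lemma inverse_exists:
  assumes A: "A \<in> carrier_mat p p" and inj: "\<And>v. v \<in> carrier_vec p \<Longrightarrow> A *\<^sub>v v = 0\<^sub>v p \<Longrightarrow> v = 0\<^sub>v p"
  shows "inv_mat A \<in> carrier_mat p p" "A * inv_mat A = 1\<^sub>m p" "inv_mat A * A = 1\<^sub>m p"
proof -
  have "Determinant.det A \<noteq> 0" using det_0_iff_vec_prod_zero_field[OF A] inj by blast
  then have "A \<in> Units (ring_mat TYPE(real) p ())" by (rule det_non_zero_imp_unit[OF A])
  then obtain B where "mat_inverse A = Some B" using mat_inverse(1)[OF A, of "()"] by (cases "mat_inverse A") auto
  then show "inv_mat A \<in> carrier_mat p p" "A * inv_mat A = 1\<^sub>m p" "inv_mat A * A = 1\<^sub>m p"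
    using mat_inverse(2)[OF A] by (auto simp: inv_mat_def)
qed

text \<open>Cauchy-Schwarz with \<open>y = A x\<close> gives \<open>\<parallel>A x\<parallel>\<^sup>2 \<le> C Q(x)\<close>, and invertibility bounds \<open>\<parallel>x\<parallel>\<close> by
  \<open>\<parallel>A x\<parallel>\<close>.\<close>

lemma psd_invertible_imp_pd:
  assumes A: "A \<in> carrier_mat p p"
    and sym: "\<And>j k. j < p \<Longrightarrow> k < p \<Longrightarrow> A $$ (j, k) = A $$ (k, j)"
    and psd: "\<And>x. qform p A x x \<ge> 0"
    and inj: "\<And>v. v \<in> carrier_vec p \<Longrightarrow> A *\<^sub>v v = 0\<^sub>v p \<Longrightarrow> v = 0\<^sub>v p"
  shows "\<exists>c>0. \<forall>x. c * (\<Sum>j<p. (x j)\<^sup>2) \<le> qform p A x x"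
proof -
  define B where "B = inv_mat A"
  have B: "B \<in> carrier_mat p p" "B * A = 1\<^sub>m p"
    using inverse_exists[of A p] A inj unfolding B_def by blast+
  obtain c where c: "c > 0" "\<And>x. \<bar>qform p A x x\<bar> \<le> c * (\<Sum>j<p. (x j)\<^sup>2)" using qform_abs_bound by blast
  define T where "T = transpose_mat B * B"
  have T: "T \<in> carrier_mat p p" using B by (simp add: T_def)
  obtain d where d: "d > 0" "\<And>x. \<bar>qform p T x x\<bar> \<le> d * (\<Sum>j<p. (x j)\<^sup>2)" using qform_abs_bound by blast
  have "1 / (c * d) * (\<Sum>j<p. (x j)\<^sup>2) \<le> qform p A x x" for x
  proof -
    define y where "y = vec_index (A *\<^sub>v Matrix.vec p x)"
    define Y where "Y = (\<Sum>j<p. (y j)\<^sup>2)"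
    define X where "X = (\<Sum>j<p. (x j)\<^sup>2)"
    have yv: "Matrix.vec p y = A *\<^sub>v Matrix.vec p x" using A by (auto simp: y_def)
    have "qform p A y x = Y"
      unfolding Y_def qform_eq_inner[OF A] y_def by (simp add: power2_eq_square)
    then have "Y\<^sup>2 \<le> qform p A y y * qform p A x x" using qform_CS[OF sym psd, of y x] by simp
    also have "\<dots> \<le> c * Y * qform p A x x"
      using c(2)[of y] psd by (intro mult_right_mono) (auto simp: Y_def)
    finally have YY: "Y * Y \<le> Y * (c * qform p A x x)" by (simp add: power2_eq_square mult_ac)
    have Y0: "Y \<ge> 0" by (simp add: Y_def sum_nonneg)
    have Yle: "Y \<le> c * qform p A x x"
    proof (cases "Y = 0")
      case True then show ?thesis using c psd by simp
    next
      case False then show ?thesis using YY Y0 by simp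
    qed
    have xB: "x j = vec_index (B *\<^sub>v Matrix.vec p y) j" if "j < p" for j
    proof -
      have "B *\<^sub>v Matrix.vec p y = (B * A) *\<^sub>v Matrix.vec p x"
        unfolding yv using A B by (intro assoc_mult_mat_vec[symmetric]) auto
      then show ?thesis using that B by simp
    qed
    have "X = (\<Sum>i<p. (\<Sum>j<p. B $$ (i, j) * y j)\<^sup>2)"
      unfolding X_def by (intro sum.cong) (auto simp: xB mult_mat_vec_index[OF B(1)] simp del: index_mult_mat_vec)
    also have "\<dots> = qform p T y y"
      unfolding sum_square_expand qform_def
      by (intro sum.cong refl arg_cong2[where f="(*)"])
         (use B in \<open>auto simp: T_def scalar_prod_def lessThan_atLeast0\<close>)
    also have "\<dots> \<le> d * Y" using d(2)[of y] by (simp add: Y_def)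
    also have "\<dots> \<le> d * (c * qform p A x x)" using Yle d by (intro mult_left_mono) auto
    finally show ?thesis using c d by (simp add: X_def field_simps)
  qed
  then show ?thesis using c d by (intro exI[of _ "1 / (c * d)"]) auto
qed

text \<open>The infimum \<open>m\<close> of the Rayleigh quotient is an eigenvalue: otherwise \<open>A - m I\<close> is positive
  semidefinite and injective, hence bounded below, and the infimum would exceed \<open>m\<close>.\<close>

lemma rayleigh_lower:
  assumes A: "A \<in> carrier_mat p p"
    and sym: "\<And>j k. j < p \<Longrightarrow> k < p \<Longrightarrow> A $$ (j, k) = A $$ (k, j)"
    and ev: "\<And>e. eigenvalue A e \<Longrightarrow> a < e"
  shows "a * (\<Sum>j<p. (x j)\<^sup>2) \<le> qform p A x x"
proof (cases "p = 0")
  case False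
  define R where "R = {qform p A x x | x. (\<Sum>j<p. (x j)\<^sup>2) = 1}"
  obtain c where c: "c > 0" "\<And>x. \<bar>qform p A x x\<bar> \<le> c * (\<Sum>j<p. (x j)\<^sup>2)" using qform_abs_bound by blast
  have ne: "R \<noteq> {}"
  proof -
    have "(\<Sum>j<p. ((if j = 0 then 1 else 0)::real)\<^sup>2) = 1"
      using False by (simp add: if_distrib[of "\<lambda>x. x\<^sup>2"] cong: if_cong)
    then have "qform p A (\<lambda>j. if j = 0 then 1 else 0) (\<lambda>j. if j = 0 then 1 else 0) \<in> R"
      unfolding R_def by blast
    then show ?thesis by blast
  qed
  have bdd: "bdd_below R" 
  proof (rule bdd_belowI[of _ "- c"])
    fix r assume "r \<in> R"
    then obtain x where "r = qform p A x x" "(\<Sum>j<p. (x j)\<^sup>2) = 1" by (auto simp: R_def)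
    then show "- c \<le> r" using c(2)[of x] by (simp add: abs_le_iff)
  qed
  define m where "m = Inf R"
  have m_le: "m * (\<Sum>j<p. (x j)\<^sup>2) \<le> qform p A x x" for x
  proof -
    define s where "s = (\<Sum>j<p. (x j)\<^sup>2)"
    have s0: "s \<ge> 0" by (simp add: s_def sum_nonneg)
    show ?thesis
    proof (cases "s = 0")
      case True
      then show ?thesis using c(2)[of x] by (simp add: s_def)
    next
      case False
      define y where "y = (\<lambda>j. 1 / sqrt s * x j)"
      have "(\<Sum>j<p. (y j)\<^sup>2) = 1"
        using False s0 by (simp add: y_def power_divide power_mult_distrib sum_divide_distrib[symmetric] s_def[symmetric])
      then have "qform p A y y \<in> R" unfolding R_def by blast
      then have "m \<le> qform p A y y" unfolding m_def by (rule cInf_lower[OF _ bdd])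
      also have "qform p A y y = 1 / sqrt s * (1 / sqrt s * qform p A x x)"
        unfolding y_def by (simp only: qform_scale_left qform_scale_right)
      also have "\<dots> = 1 / s * qform p A x x" using s0 by simp
      finally show ?thesis using False s0 by (simp add: s_def[symmetric] field_simps)
    qed
  qed
  have "eigenvalue A m"
  proof (rule ccontr)
    assume ne_ev: "\<not> eigenvalue A m"
    define B where "B = A - m \<cdot>\<^sub>m 1\<^sub>m p"
    have B: "B \<in> carrier_mat p p" unfolding B_def by (rule minus_carrier_mat) simp
    have qB: "qform p B x x = qform p A x x - m * (\<Sum>j<p. (x j)\<^sup>2)" for x
    proof -
      have ent: "B $$ (j, k) = A $$ (j, k) - m * 1\<^sub>m p $$ (j, k)" if "j < p" "k < p" for j k
        unfolding B_def using A that by (simp del: index_one_mat(1))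
      have "qform p B x x = qform p A x x - m * qform p (1\<^sub>m p) x x"
        unfolding qform_def
        by (simp add: ent right_diff_distrib sum_subtractf sum_distrib_left mult_ac del: index_one_mat(1))
      then show ?thesis by (simp add: qform_one power2_eq_square)
    qed
    have inj: "v = 0\<^sub>v p" if v: "v \<in> carrier_vec p" "B *\<^sub>v v = 0\<^sub>v p" for v
    proof (rule ccontr)
      assume v0: "v \<noteq> 0\<^sub>v p"
      have "B *\<^sub>v v = A *\<^sub>v v - (m \<cdot>\<^sub>m 1\<^sub>m p) *\<^sub>v v"
        unfolding B_def by (rule minus_mult_distrib_mat_vec[OF A _ v(1)]) simp
      also have "(m \<cdot>\<^sub>m 1\<^sub>m p) *\<^sub>v v = m \<cdot>\<^sub>v v" using v by (intro eq_vecI) (auto simp: scalar_prod_def if_distrib if_distribR cong: if_cong)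
      finally have B0: "B *\<^sub>v v = A *\<^sub>v v - m \<cdot>\<^sub>v v" .
      have "A *\<^sub>v v = m \<cdot>\<^sub>v v"
      proof (rule eq_vecI)
        fix i assume "i < dim_vec (m \<cdot>\<^sub>v v)"
        then have i: "i < p" using v by simp
        have "vec_index (A *\<^sub>v v - m \<cdot>\<^sub>v v) i = 0" unfolding B0[symmetric] v(2) using i by simp
        then show "vec_index (A *\<^sub>v v) i = vec_index (m \<cdot>\<^sub>v v) i"
          using i v(1) by (simp del: index_mult_mat_vec)
      qed (use A v in auto)
      then have "eigenvalue A m" unfolding eigenvalue_def eigenvector_def using A v v0 by auto
      then show False using ne_ev by simp
    qed
    have symB: "B $$ (j, k) = B $$ (k, j)" if "j < p" "k < p" for j k
      using that sym A by (simp add: B_def)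
    have psdB: "0 \<le> qform p B x x" for x using m_le[of x] by (simp add: qB)
    obtain d where d: "d > 0" "\<And>x. d * (\<Sum>j<p. (x j)\<^sup>2) \<le> qform p B x x"
      using psd_invertible_imp_pd[OF B symB psdB inj] by blast
    have "m + d \<le> m"
      unfolding m_def using ne
    proof (rule cInf_greatest)
      fix r assume "r \<in> R"
      then obtain x where "r = qform p A x x" "(\<Sum>j<p. (x j)\<^sup>2) = 1" by (auto simp: R_def)
      then show "Inf R + d \<le> r" using d(2)[of x] qB[of x] by (simp add: m_def)
    qed
    then show False using d by simp
  qed
  then have "a < m" by (rule ev)
  then have "a * (\<Sum>j<p. (x j)\<^sup>2) \<le> m * (\<Sum>j<p. (x j)\<^sup>2)" by (intro mult_right_mono sum_nonneg) auto
  also have "\<dots> \<le> qform p A x x" by (rule m_le)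
  finally show ?thesis .
qed (simp add: qform_def)

lemma rayleigh_upper:
  assumes A: "A \<in> carrier_mat p p"
    and sym: "\<And>j k. j < p \<Longrightarrow> k < p \<Longrightarrow> A $$ (j, k) = A $$ (k, j)"
    and ev: "\<And>e. eigenvalue A e \<Longrightarrow> e < b"
  shows "qform p A x x \<le> b * (\<Sum>j<p. (x j)\<^sup>2)"
proof -
  have "(- b) * (\<Sum>j<p. (x j)\<^sup>2) \<le> qform p (- A) x x"
  proof (rule rayleigh_lower)
    fix e assume "eigenvalue (- A) e"
    then obtain v where v: "v \<in> carrier_vec p" "v \<noteq> 0\<^sub>v p" "(- A) *\<^sub>v v = e \<cdot>\<^sub>v v"
      using A unfolding eigenvalue_def eigenvector_def by auto
    have "A *\<^sub>v v = (- e) \<cdot>\<^sub>v v"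
    proof (rule eq_vecI)
      fix i assume "i < dim_vec ((- e) \<cdot>\<^sub>v v)"
      then have i: "i < p" using v by simp
      have "vec_index ((- A) *\<^sub>v v) i = e * vec_index v i" unfolding v(3) using v(1) i by simp
      moreover have "vec_index ((- A) *\<^sub>v v) i = - vec_index (A *\<^sub>v v) i"
        using mult_mat_vec_index[of "- A" p p v i] mult_mat_vec_index[OF A v(1) i] A v(1) i
        by (simp add: sum_negf del: index_mult_mat_vec)
      ultimately show "vec_index (A *\<^sub>v v) i = vec_index ((- e) \<cdot>\<^sub>v v) i" using i v by simp
    qed (use A v in auto)
    then have "eigenvalue A (- e)" unfolding eigenvalue_def eigenvector_def using A v by auto
    then show "- b < e" using ev by force
  qed (use A sym in auto)
  moreover have "qform p (- A) x x = - qform p A x x"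
    using A by (simp add: qform_def sum_negf)
  ultimately show ?thesis by simp
qed

text \<open>A coefficient family \<open>a\<close> stands for the linear functional \<open>a\<^sub>A\<^sup>T x\<^sub>A + a\<^sub>B\<^sup>T x\<^sub>B\<close> of one pair of observations; this is
  the covariance of two of them.\<close>

definition gcov :: "nat \<Rightarrow> (group_label \<Rightarrow> real Matrix.mat) \<Rightarrow> (group_label \<Rightarrow> nat \<Rightarrow> real) \<Rightarrow>
    (group_label \<Rightarrow> nat \<Rightarrow> real) \<Rightarrow> real" where
  "gcov p C a b = qform p (C GA) (a GA) (b GA) + qform p (C GB) (a GB) (b GB)"

definition wcoef :: "(nat \<Rightarrow> real) \<Rightarrow> group_label \<Rightarrow> nat \<Rightarrow> real" where
  "wcoef c k l = c l"

definition zcoef :: "(nat \<Rightarrow> real) \<Rightarrow> group_label \<Rightarrow> nat \<Rightarrow> real" where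
  "zcoef c k l = (case k of GA \<Rightarrow> c l | GB \<Rightarrow> - c l)"

text \<open>The functional \<open>c\<^sup>T v\<close>, where \<open>v = z - P\<^sup>T w\<close>; \<open>wcoef c\<close> and \<open>zcoef c\<close> are \<open>c\<^sup>T w\<close> and \<open>c\<^sup>T z\<close>.\<close>

definition vcoef :: "nat \<Rightarrow> real Matrix.mat \<Rightarrow> (nat \<Rightarrow> real) \<Rightarrow> group_label \<Rightarrow> nat \<Rightarrow> real" where
  "vcoef p P c k l = zcoef c k l - (\<Sum>j<p. P $$ (l, j) * c j)"

text \<open>The two population covariance matrices with their eigenvalue bounds, in the quadratic form
  version that the matrix algebra uses.\<close>

locale cov_pair =
  fixes p :: nat and C :: "group_label \<Rightarrow> real Matrix.mat" and P :: "real Matrix.mat" and k1 k2 :: real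
  assumes C: "C k \<in> carrier_mat p p"
    and C_sym: "\<And>i j. i < p \<Longrightarrow> j < p \<Longrightarrow> C k $$ (i, j) = C k $$ (j, i)"
    and C_low: "k1 * (\<Sum>j<p. (x j)\<^sup>2) \<le> qform p (C k) x x"
    and C_up: "qform p (C k) x x \<le> k2 * (\<Sum>j<p. (x j)\<^sup>2)"
    and k1: "k1 > 0"
    and P_eq: "P = inv_mat (C GA + C GB) * (C GA - C GB)"
begin

lemma pd_injective:
  assumes A: "A \<in> carrier_mat p p" and low: "\<And>x. c * (\<Sum>j<p. (x j)\<^sup>2) \<le> qform p A x x" "c > 0"
    and v: "v \<in> carrier_vec p" "A *\<^sub>v v = 0\<^sub>v p"
  shows "v = 0\<^sub>v p"
proof -
  have "Matrix.vec p (vec_index v) = v" using v by auto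
  then have "qform p A (vec_index v) (vec_index v) = 0"
    unfolding qform_eq_inner[OF A] using v by simp
  then have "c * (\<Sum>j<p. (vec_index v j)\<^sup>2) \<le> 0" using low(1)[of "vec_index v"] by simp
  then have "(\<Sum>j<p. (vec_index v j)\<^sup>2) = 0"
    using low(2) by (simp add: mult_le_0_iff sum_nonneg order_antisym)
  then show ?thesis using v by (intro eq_vecI) (auto simp: sum_nonneg_eq_0_iff)
qed

lemma qform_S: "qform p (C GA + C GB) x y = qform p (C GA) x y + qform p (C GB) x y"
  using C[of GA] C[of GB] by (simp add: qform_def distrib_left sum.distrib)

lemma C_inverse: "inv_mat (C k) \<in> carrier_mat p p" "C k * inv_mat (C k) = 1\<^sub>m p" "inv_mat (C k) * C k = 1\<^sub>m p"
  using inverse_exists[OF C[of k]] pd_injective[OF C C_low k1] by blast+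

lemma S_inj:
  assumes "v \<in> carrier_vec p" "(C GA + C GB) *\<^sub>v v = 0\<^sub>v p"
  shows "v = 0\<^sub>v p"
proof (rule pd_injective[OF _ _ _ assms, of "2 * k1"])
  show "2 * k1 * (\<Sum>j<p. (x j)\<^sup>2) \<le> qform p (C GA + C GB) x x" for x
    unfolding qform_S using C_low[of x GA] C_low[of x GB] by simp
qed (use C[of GA] C[of GB] k1 in auto)

lemma S_carrier: "C GA + C GB \<in> carrier_mat p p" and D_carrier: "C GA - C GB \<in> carrier_mat p p"
  using C[of GA] C[of GB] by (auto intro: minus_carrier_mat)

lemma S_inverse: "inv_mat (C GA + C GB) \<in> carrier_mat p p"
    "(C GA + C GB) * inv_mat (C GA + C GB) = 1\<^sub>m p"
  using inverse_exists[OF S_carrier] S_inj by blast+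

lemma P_carrier: "P \<in> carrier_mat p p"
  unfolding P_eq using S_inverse(1) D_carrier by (rule mult_carrier_mat)

lemma S_P: "(C GA + C GB) * P = C GA - C GB"
proof -
  have "(C GA + C GB) * P = ((C GA + C GB) * inv_mat (C GA + C GB)) * (C GA - C GB)"
    unfolding P_eq by (rule assoc_mult_mat[symmetric, OF S_carrier S_inverse(1) D_carrier])
  then show ?thesis unfolding S_inverse(2) left_mult_one_mat[OF D_carrier] .
qed

text \<open>This is \<open>(\<Sigma>\<^sub>A + \<Sigma>\<^sub>B) P = \<Sigma>\<^sub>A - \<Sigma>\<^sub>B\<close> applied to \<open>g\<close>, with the terms of each group collected.  It says both
  that \<open>v\<close> and \<open>w\<close> are uncorrelated and, with \<open>q\<close> the common value, that
  \<open>(\<Sigma>\<^sub>A\<^sup>-\<^sup>1 + \<Sigma>\<^sub>B\<^sup>-\<^sup>1) q = 2 g\<close>, which identifies \<open>\<Sigma>\<^sub>V g\<close>.\<close>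

lemma balance:
  assumes g: "g \<in> carrier_vec p"
  shows "C GA *\<^sub>v (g - P *\<^sub>v g) = C GB *\<^sub>v (g + P *\<^sub>v g)"
proof -
  have h: "P *\<^sub>v g \<in> carrier_vec p" using P_carrier g by simp
  have "(C GA + C GB) *\<^sub>v (P *\<^sub>v g) = (C GA - C GB) *\<^sub>v g"
    using assoc_mult_mat_vec[OF S_carrier P_carrier g] S_P by simp
  then have eq: "C GA *\<^sub>v (P *\<^sub>v g) + C GB *\<^sub>v (P *\<^sub>v g) = C GA *\<^sub>v g - C GB *\<^sub>v g"
    using add_mult_distrib_mat_vec[OF C C h] minus_mult_distrib_mat_vec[OF C C g] by simp
  then have e: "vec_index (C GA *\<^sub>v (P *\<^sub>v g)) i + vec_index (C GB *\<^sub>v (P *\<^sub>v g)) i =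
      vec_index (C GA *\<^sub>v g) i - vec_index (C GB *\<^sub>v g) i" if "i < p" for i
  proof -
    have "vec_index (C GA *\<^sub>v (P *\<^sub>v g) + C GB *\<^sub>v (P *\<^sub>v g)) i = vec_index (C GA *\<^sub>v g - C GB *\<^sub>v g) i"
      by (simp only: eq)
    then show ?thesis using that C[of GA] C[of GB] by (simp del: index_mult_mat_vec)
  qed
  have a: "C GA *\<^sub>v (g - P *\<^sub>v g) = C GA *\<^sub>v g - C GA *\<^sub>v (P *\<^sub>v g)"
    by (rule mult_minus_distrib_mat_vec[OF C g h])
  have b: "C GB *\<^sub>v (g + P *\<^sub>v g) = C GB *\<^sub>v g + C GB *\<^sub>v (P *\<^sub>v g)"
    by (rule mult_add_distrib_mat_vec[OF C g h])
  show ?thesis unfolding a b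
  proof (rule eq_vecI)
    fix i assume "i < dim_vec (C GB *\<^sub>v g + C GB *\<^sub>v (P *\<^sub>v g))"
    then have i: "i < p" using C[of GB] by simp
    then show "vec_index (C GA *\<^sub>v g - C GA *\<^sub>v (P *\<^sub>v g)) i = vec_index (C GB *\<^sub>v g + C GB *\<^sub>v (P *\<^sub>v g)) i"
      using e[OF i] C[of GA] C[of GB] by (simp del: index_mult_mat_vec)
  qed (use C[of GA] C[of GB] in simp)
qed

lemma Sigma_V_mult:
  assumes g: "g \<in> carrier_vec p"
  shows "Sigma_V C *\<^sub>v g = 2 \<cdot>\<^sub>v (C GA *\<^sub>v (g - P *\<^sub>v g))"
proof -
  let ?IA = "inv_mat (C GA)" and ?IB = "inv_mat (C GB)"
  let ?I = "?IA + ?IB"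
  note IA = C_inverse[of GA] and IB = C_inverse[of GB]
  have I: "?I \<in> carrier_mat p p" using IA(1) IB(1) by simp
  have cancel: "inv_mat (C k) *\<^sub>v (C k *\<^sub>v v) = v" "C k *\<^sub>v (inv_mat (C k) *\<^sub>v v) = v" if "v \<in> carrier_vec p" for v k
    unfolding assoc_mult_mat_vec[OF C_inverse(1) C that, symmetric] assoc_mult_mat_vec[OF C C_inverse(1) that, symmetric]
      C_inverse(2,3) using that by simp_all
  have inj: "v = 0\<^sub>v p" if v: "v \<in> carrier_vec p" "?I *\<^sub>v v = 0\<^sub>v p" for v
  proof -
    define a where "a = ?IA *\<^sub>v v"
    define b where "b = ?IB *\<^sub>v v"
    have ab: "a \<in> carrier_vec p" "b \<in> carrier_vec p" using IA IB v by (auto simp: a_def b_def)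
    have s: "a + b = 0\<^sub>v p" using v add_mult_distrib_mat_vec[OF IA(1) IB(1) v(1)] by (simp add: a_def b_def)
    have ba: "b = - a"
    proof (rule eq_vecI)
      fix i assume "i < dim_vec (- a)"
      then have i: "i < p" using ab by simp
      have "vec_index (a + b) i = 0" using s i by simp
      then show "vec_index b i = vec_index (- a) i" using i ab by simp
    qed (use ab in auto)
    have va: "v = C GA *\<^sub>v a" and vb: "v = C GB *\<^sub>v b" using cancel v by (auto simp: a_def b_def)
    have "(C GA + C GB) *\<^sub>v a = C GA *\<^sub>v a + C GB *\<^sub>v a" by (rule add_mult_distrib_mat_vec[OF C C ab(1)])
    also have "\<dots> = 0\<^sub>v p"
    proof (rule eq_vecI)
      fix i assume "i < dim_vec (0\<^sub>v p)"
      then have i: "i < p" by simp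
      have "vec_index (C GB *\<^sub>v b) i = - vec_index (C GB *\<^sub>v a) i"
        unfolding mult_mat_vec_index[OF C ab(2) i] mult_mat_vec_index[OF C ab(1) i]
        using ab by (simp add: ba sum_negf)
      then have "vec_index (C GB *\<^sub>v a) i = - vec_index v i" using vb by simp
      then show "vec_index (C GA *\<^sub>v a + C GB *\<^sub>v a) i = vec_index (0\<^sub>v p) i"
        using i C[of GA] C[of GB] va by (simp del: index_mult_mat_vec)
    qed (use C[of GB] in simp)
    finally have "a = 0\<^sub>v p" by (rule S_inj[OF ab(1)])
    then have "v = C GA *\<^sub>v 0\<^sub>v p" using va by simp
    also have "\<dots> = 0\<^sub>v p" using C[of GA] by (intro eq_vecI) auto
    finally show ?thesis .
  qed
  have X: "inv_mat ?I \<in> carrier_mat p p" "inv_mat ?I * ?I = 1\<^sub>m p"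
    using inverse_exists[OF I] inj by blast+
  have h: "P *\<^sub>v g \<in> carrier_vec p" using P_carrier g by simp
  have gh: "g - P *\<^sub>v g \<in> carrier_vec p" "g + P *\<^sub>v g \<in> carrier_vec p" using g h by auto
  define q where "q = C GA *\<^sub>v (g - P *\<^sub>v g)"
  have q: "q \<in> carrier_vec p" unfolding q_def by (rule mult_mat_vec_carrier[OF C gh(1)])
  have qB: "q = C GB *\<^sub>v (g + P *\<^sub>v g)" unfolding q_def by (rule balance[OF g])
  have "?I *\<^sub>v q = ?IA *\<^sub>v q + ?IB *\<^sub>v q" by (rule add_mult_distrib_mat_vec[OF IA(1) IB(1) q])
  also have "?IA *\<^sub>v q = g - P *\<^sub>v g" unfolding q_def by (rule cancel(1)[OF gh(1)])
  also have "?IB *\<^sub>v q = g + P *\<^sub>v g" unfolding qB by (rule cancel(1)[OF gh(2)])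
  also have "(g - P *\<^sub>v g) + (g + P *\<^sub>v g) = 2 \<cdot>\<^sub>v g"
  proof -
    have "(g - y) + (g + y) = 2 \<cdot>\<^sub>v g" if "y \<in> carrier_vec p" for y
      using g that by (intro eq_vecI) auto
    then show ?thesis using h by blast
  qed
  finally have Iq: "?I *\<^sub>v q = 2 \<cdot>\<^sub>v g" .
  have "q = (inv_mat ?I * ?I) *\<^sub>v q" unfolding X(2) using q by simp
  also have "\<dots> = inv_mat ?I *\<^sub>v (?I *\<^sub>v q)" by (rule assoc_mult_mat_vec[OF X(1) I q])
  also have "\<dots> = 2 \<cdot>\<^sub>v (inv_mat ?I *\<^sub>v g)" unfolding Iq by (rule mult_mat_vec[OF X(1) g])
  finally have "2 \<cdot>\<^sub>v q = 4 \<cdot>\<^sub>v (inv_mat ?I *\<^sub>v g)"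
    by (simp add: smult_smult_assoc)
  also have "\<dots> = Sigma_V C *\<^sub>v g"
  proof (rule eq_vecI)
    fix i assume "i < dim_vec (Sigma_V C *\<^sub>v g)"
    then have i: "i < p" using X(1) by (simp add: Sigma_V_def)
    have "4 \<cdot>\<^sub>m inv_mat ?I \<in> carrier_mat p p" using X(1) by simp
    from mult_mat_vec_index[OF this g i] mult_mat_vec_index[OF X(1) g i]
    show "vec_index (4 \<cdot>\<^sub>v (inv_mat ?I *\<^sub>v g)) i = vec_index (Sigma_V C *\<^sub>v g) i"
      using X(1) i unfolding Sigma_V_def
      by (simp add: sum_distrib_left mult.assoc del: index_mult_mat_vec)
  qed (use X(1) in \<open>simp add: Sigma_V_def\<close>)
  finally show ?thesis by (simp add: q_def)
qed

abbreviation Pmul :: "(nat \<Rightarrow> real) \<Rightarrow> nat \<Rightarrow> real" where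
  "Pmul c l \<equiv> (\<Sum>j<p. P $$ (l, j) * c j)"

lemma qform_balance:
  "qform p (C GA) x (vcoef p P c GA) + qform p (C GB) x (vcoef p P c GB) = 0"
  "qform p (C GA) x (vcoef p P c GA) - qform p (C GB) x (vcoef p P c GB)
    = (\<Sum>j<p. x j * vec_index (Sigma_V C *\<^sub>v Matrix.vec p c) j)"
proof -
  define g where "g = Matrix.vec p c"
  have g: "g \<in> carrier_vec p" by (simp add: g_def)
  have Pg: "vec_index (P *\<^sub>v g) l = Pmul c l" if "l < p" for l
    using mult_mat_vec_index[OF P_carrier g that] by (simp add: g_def)
  have h: "P *\<^sub>v g \<in> carrier_vec p" using P_carrier g by simp
  have A: "qform p (C GA) x (vcoef p P c GA) = (\<Sum>j<p. x j * vec_index (C GA *\<^sub>v (g - P *\<^sub>v g)) j)"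
  proof -
    have "Matrix.vec p (vcoef p P c GA) = g - y" if "y \<in> carrier_vec p" "\<And>l. l < p \<Longrightarrow> vec_index y l = Pmul c l" for y
      using that by (intro eq_vecI) (auto simp: vcoef_def zcoef_def g_def)
    note this[OF h Pg]
    then show ?thesis by (simp add: qform_eq_inner[OF C])
  qed
  have B: "qform p (C GB) x (vcoef p P c GB) = - (\<Sum>j<p. x j * vec_index (C GB *\<^sub>v (g + P *\<^sub>v g)) j)"
  proof -
    have "qform p (C GB) x (vcoef p P c GB) = - qform p (C GB) x (\<lambda>l. c l + Pmul c l)"
      using qform_scale_right[of p "C GB" x "-1" "\<lambda>l. c l + Pmul c l"] by (simp add: vcoef_def[abs_def] zcoef_def)
    moreover have "Matrix.vec p (\<lambda>l. c l + Pmul c l) = g + y" if "y \<in> carrier_vec p" "\<And>l. l < p \<Longrightarrow> vec_index y l = Pmul c l" for y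
      using that by (intro eq_vecI) (auto simp: g_def)
    note this[OF h Pg]
    ultimately show ?thesis by (simp add: qform_eq_inner[OF C])
  qed
  show "qform p (C GA) x (vcoef p P c GA) + qform p (C GB) x (vcoef p P c GB) = 0"
    unfolding A B balance[OF g] by simp
  have "(\<Sum>j<p. x j * vec_index (Sigma_V C *\<^sub>v g) j) = 2 * (\<Sum>j<p. x j * vec_index (C GA *\<^sub>v (g - P *\<^sub>v g)) j)"
    unfolding Sigma_V_mult[OF g] sum_distrib_left
    using C[of GA] by (intro sum.cong) (auto simp del: index_mult_mat_vec)
  then show "qform p (C GA) x (vcoef p P c GA) - qform p (C GB) x (vcoef p P c GB)
    = (\<Sum>j<p. x j * vec_index (Sigma_V C *\<^sub>v Matrix.vec p c) j)"
    unfolding A B balance[OF g, symmetric] g_def[symmetric] by simp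
qed

lemma gcov_w_v: "gcov p C (wcoef c) (vcoef p P c') = 0"
  using qform_balance(1)[of c c'] by (simp add: gcov_def wcoef_def[abs_def])

lemma gcov_v_v: "gcov p C (vcoef p P c) (vcoef p P c') = (\<Sum>j<p. c j * vec_index (Sigma_V C *\<^sub>v Matrix.vec p c') j)"
proof -
  define h where "h l = - Pmul c l" for l
  have a: "vcoef p P c GA = (\<lambda>l. c l + h l)" "vcoef p P c GB = (\<lambda>l. (- 1) * c l + h l)"
    by (auto simp: vcoef_def zcoef_def h_def)
  show ?thesis
    unfolding gcov_def a qform_add_left qform_scale_left
    using qform_balance[of h c'] qform_balance[of c c'] by simp
qed

lemma gcov_nonneg: "gcov p C a a \<ge> 0"
proof -
  have "0 \<le> qform p (C k) x x" for k x
    using C_low[of x k] k1 by (meson mult_nonneg_nonneg less_imp_le order_trans sum_nonneg zero_le_power2)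
  then show ?thesis by (simp add: gcov_def)
qed

lemma gcov_w_bounds:
  "2 * k1 * (\<Sum>j<p. (c j)\<^sup>2) \<le> gcov p C (wcoef c) (wcoef c)"
  "gcov p C (wcoef c) (wcoef c) \<le> 2 * k2 * (\<Sum>j<p. (c j)\<^sup>2)"
  using C_low[of c GA] C_low[of c GB] C_up[of GA c] C_up[of GB c]
  by (simp_all add: gcov_def wcoef_def[abs_def])

text \<open>Writing \<open>h = P c\<close>, the lower bound comes from \<open>\<parallel>c - h\<parallel>\<^sup>2 + \<parallel>c + h\<parallel>\<^sup>2 \<ge> 2 \<parallel>c\<parallel>\<^sup>2\<close> and the upper one because \<open>v\<close> is a
  regression residual: the variance of \<open>c\<^sup>T v\<close> is that of \<open>c\<^sup>T z\<close> minus that of \<open>h\<^sup>T w\<close>.\<close>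

lemma gcov_v_bounds:
  "2 * k1 * (\<Sum>j<p. (c j)\<^sup>2) \<le> gcov p C (vcoef p P c) (vcoef p P c)"
  "gcov p C (vcoef p P c) (vcoef p P c) \<le> 2 * k2 * (\<Sum>j<p. (c j)\<^sup>2)"
proof -
  have "k1 * ((\<Sum>j<p. (vcoef p P c GA j)\<^sup>2) + (\<Sum>j<p. (vcoef p P c GB j)\<^sup>2)) \<le> gcov p C (vcoef p P c) (vcoef p P c)"
    using C_low[of "vcoef p P c GA" GA] C_low[of "vcoef p P c GB" GB] by (simp add: gcov_def distrib_left)
  moreover have "2 * (\<Sum>j<p. (c j)\<^sup>2) \<le> (\<Sum>j<p. (vcoef p P c GA j)\<^sup>2) + (\<Sum>j<p. (vcoef p P c GB j)\<^sup>2)"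
  proof -
    have "2 * (c j)\<^sup>2 \<le> (vcoef p P c GA j)\<^sup>2 + (vcoef p P c GB j)\<^sup>2" for j
    proof -
      have "(vcoef p P c GA j)\<^sup>2 + (vcoef p P c GB j)\<^sup>2 = 2 * (c j)\<^sup>2 + 2 * (Pmul c j)\<^sup>2"
        by (simp add: vcoef_def zcoef_def power2_eq_square algebra_simps)
      then show ?thesis by simp
    qed
    then show ?thesis unfolding sum.distrib[symmetric] sum_distrib_left by (intro sum_mono)
  qed
  moreover note mult_left_mono[OF this less_imp_le[OF k1]]
  ultimately show "2 * k1 * (\<Sum>j<p. (c j)\<^sup>2) \<le> gcov p C (vcoef p P c) (vcoef p P c)"
    by (simp add: algebra_simps)
  define h where "h l = Pmul c l" for l
  have a: "vcoef p P c GA = (\<lambda>l. c l + (- 1) * h l)" "vcoef p P c GB = (\<lambda>l. (- 1) * c l + (- 1) * h l)"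
    by (auto simp: vcoef_def zcoef_def h_def)
  define A where "A = qform p (C GA)"
  define B where "B = qform p (C GB)"
  have sym: "A x y = A y x" "B x y = B y x" for x y
    unfolding A_def B_def by (rule qform_sym[OF C_sym], assumption+)+
  have "gcov p C (vcoef p P c) (vcoef p P c) = A c c + B c c - A h h - B h h"
  proof -
    have "gcov p C (vcoef p P c) (vcoef p P c) = A c c + B c c - 2 * A h c + 2 * B h c + A h h + B h h"
      unfolding gcov_def a
      unfolding qform_add_left qform_scale_left qform_add_right qform_scale_right
      using sym[of c h] unfolding A_def B_def by (simp add: algebra_simps)
    moreover have "A h c - B h c = A h h + B h h"
      using qform_balance(1)[of h c] unfolding a qform_add_right qform_scale_right A_def B_def
      by (simp add: algebra_simps)
    ultimately show ?thesis by simp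
  qed
  also have "\<dots> \<le> A c c + B c c"
    using gcov_nonneg[of "wcoef h"] by (simp add: gcov_def A_def B_def wcoef_def[abs_def])
  also have "\<dots> \<le> 2 * k2 * (\<Sum>j<p. (c j)\<^sup>2)"
    using C_up[of GA c] C_up[of GB c] by (simp add: A_def B_def)
  finally show "gcov p C (vcoef p P c) (vcoef p P c) \<le> 2 * k2 * (\<Sum>j<p. (c j)\<^sup>2)" .
qed

end

section \<open>Centered normal laws and their concentration\<close>

text \<open>The law of \<open>\<tau>\<close> times a standard normal variable.  Unlike a density, it covers the
  degenerate case \<open>\<tau> = 0\<close>, which occurs for single groups and for singular plug-in covariances.\<close>

definition gauss :: "real \<Rightarrow> real measure" where
  "gauss \<tau> = distr std_normal_distribution borel (\<lambda>t. \<tau> * t)"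

lemma sets_gauss [measurable_cong, simp]: "sets (gauss \<tau>) = sets borel"
  and space_gauss [simp]: "space (gauss \<tau>) = UNIV"
  by (simp_all add: gauss_def)

lemma real_distribution_gauss: "real_distribution (gauss \<tau>)"
proof -
  interpret real_distribution std_normal_distribution by (rule real_dist_normal_dist)
  have "prob_space (gauss \<tau>)" unfolding gauss_def by (rule prob_space_distr) simp
  then show ?thesis by (simp add: real_distribution_def real_distribution_axioms_def)
qed

lemma char_gauss: "char (gauss \<tau>) t = complex_of_real (exp (- (\<tau>\<^sup>2 * t\<^sup>2) / 2))"
proof -
  have "char (gauss \<tau>) t = char std_normal_distribution (\<tau> * t)"
    unfolding char_def gauss_def by (subst integral_distr) (auto simp: mult_ac)
  then show ?thesis by (simp add: char_std_normal_distribution power_mult_distrib)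
qed

text \<open>Laws of linear combinations are identified by their characteristic functions, which treats
  degenerate summands uniformly.\<close>

lemma gauss_eqI:
  assumes "real_distribution N" "\<And>t. char N t = complex_of_real (exp (- (\<tau>\<^sup>2 * t\<^sup>2) / 2))"
  shows "N = gauss \<tau>"
  by (rule Levy_uniqueness[OF assms(1) real_distribution_gauss]) (auto simp: assms(2) char_gauss)

lemma (in prob_space) indep_sum_gauss:
  assumes "finite I" "indep_vars (\<lambda>_. borel) X I" "\<And>i. i \<in> I \<Longrightarrow> distr M borel (X i) = gauss (\<tau> i)"
  shows "distr M borel (\<lambda>\<omega>. \<Sum>i\<in>I. X i \<omega>) = gauss (sqrt (\<Sum>i\<in>I. (\<tau> i)\<^sup>2))"
proof (rule gauss_eqI)
  have X [measurable]: "random_variable borel (X i)" if "i \<in> I" for i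
    using assms(2) that by (auto simp: indep_vars_def)
  show "real_distribution (distr M borel (\<lambda>\<omega>. \<Sum>i\<in>I. X i \<omega>))"
    by (rule real_distribution_distr) simp
  fix t
  have "char (distr M borel (\<lambda>\<omega>. \<Sum>i\<in>I. X i \<omega>)) t = (\<Prod>i\<in>I. complex_of_real (exp (- ((\<tau> i)\<^sup>2 * t\<^sup>2) / 2)))"
    unfolding char_distr_sum[OF assms(2)] by (intro prod.cong) (auto simp: assms(3) char_gauss)
  also have "\<dots> = complex_of_real (exp (\<Sum>i\<in>I. - ((\<tau> i)\<^sup>2 * t\<^sup>2) / 2))"
    by (simp only: of_real_prod[symmetric] exp_sum[OF assms(1)])
  also have "(\<Sum>i\<in>I. - ((\<tau> i)\<^sup>2 * t\<^sup>2) / 2) = - ((sqrt (\<Sum>i\<in>I. (\<tau> i)\<^sup>2))\<^sup>2 * t\<^sup>2) / 2"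
    by (simp add: sum_nonneg sum_negf sum_distrib_right sum_divide_distrib)
  finally show "char (distr M borel (\<lambda>\<omega>. \<Sum>i\<in>I. X i \<omega>)) t =
     complex_of_real (exp (- ((sqrt (\<Sum>i\<in>I. (\<tau> i)\<^sup>2))\<^sup>2 * t\<^sup>2) / 2))" .
qed

lemma distr_scale_gauss: "distr (gauss \<tau>) borel (\<lambda>x. c * x) = gauss (c * \<tau>)"
  unfolding gauss_def by (subst distr_distr) (auto simp: comp_def mult.assoc[symmetric])

lemma prob_space_std_normal: "prob_space std_normal_distribution"
  using prob_space_normal_density by simp

lemma centered_normal_basics:
  assumes "is_centered_normal p A \<mu>"
  shows "prob_space \<mu>" "sets \<mu> = sets (\<Pi>\<^sub>M j\<in>{..<p}. borel)"
proof -
  from assms obtain m L where mu: "\<mu> = distr (\<Pi>\<^sub>M k\<in>{..<m}. std_normal_distribution) (\<Pi>\<^sub>M j\<in>{..<p}. borel)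
                  (\<lambda>g. \<lambda>j\<in>{..<p}. \<Sum>k<m. L $$ (j, k) * g k)"
    unfolding is_centered_normal_def by auto
  interpret P: product_prob_space "\<lambda>_. std_normal_distribution" "{..<m}"
    by (intro product_prob_spaceI prob_space_std_normal)
  show "prob_space \<mu>" unfolding mu
    by (rule P.prob_space_distr) (rule measurable_restrict, measurable)
  show "sets \<mu> = sets (\<Pi>\<^sub>M j\<in>{..<p}. borel)" by (simp add: mu)
qed

lemma centered_normal_linear:
  assumes "is_centered_normal p A \<mu>"
  shows "distr \<mu> borel (\<lambda>\<xi>. \<Sum>j<p. a j * \<xi> j) = gauss (sqrt (\<Sum>j<p. a j * (\<Sum>k<p. a k * A $$ (j, k))))"
    and "(\<Sum>j<p. a j * (\<Sum>k<p. a k * A $$ (j, k))) \<ge> 0"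
proof -
  from assms obtain m L where L: "L \<in> carrier_mat p m" "L * transpose_mat L = A"
    and mu: "\<mu> = distr (\<Pi>\<^sub>M k\<in>{..<m}. std_normal_distribution) (\<Pi>\<^sub>M j\<in>{..<p}. borel)
                  (\<lambda>g. \<lambda>j\<in>{..<p}. \<Sum>k<m. L $$ (j, k) * g k)"
    unfolding is_centered_normal_def by auto
  interpret P: product_prob_space "\<lambda>_. std_normal_distribution" "{..<m}"
    by (intro product_prob_spaceI prob_space_std_normal)
  define Q where "Q = (\<Pi>\<^sub>M k\<in>{..<m}. std_normal_distribution)"
  define c where "c k = (\<Sum>j<p. a j * L $$ (j, k))" for k
  have A: "A $$ (j, k) = (\<Sum>l<m. L $$ (j, l) * L $$ (k, l))" if "j < p" "k < p" for j k
    using L that unfolding L(2)[symmetric]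
    by (auto simp: scalar_prod_def lessThan_atLeast0 intro!: sum.cong)
  have c2: "(\<Sum>k<m. (c k)\<^sup>2) = (\<Sum>j<p. a j * (\<Sum>k<p. a k * A $$ (j, k)))"
  proof -
    have "(\<Sum>k<m. (c k)\<^sup>2) = (\<Sum>j<p. a j * (\<Sum>k<p. a k * (\<Sum>l<m. L $$ (j, l) * L $$ (k, l))))"
      unfolding c_def sum_square_expand[symmetric] by (simp add: mult_ac)
    also have "\<dots> = (\<Sum>j<p. a j * (\<Sum>k<p. a k * A $$ (j, k)))"
      by (simp add: A)
    finally show ?thesis .
  qed
  show "(\<Sum>j<p. a j * (\<Sum>k<p. a k * A $$ (j, k))) \<ge> 0"
    unfolding c2[symmetric] by (intro sum_nonneg) auto
  have ind: "P.indep_vars (\<lambda>_. borel) (\<lambda>k g. c k * g k) {..<m}"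
  proof -
    have "P.indep_vars (\<lambda>_. std_normal_distribution) (\<lambda>k g. g k) {..<m}"
    proof (cases "m = 0")
      case False
      have "distr (\<Pi>\<^sub>M k\<in>{..<m}. std_normal_distribution) (\<Pi>\<^sub>M k\<in>{..<m}. std_normal_distribution) (\<lambda>g. \<lambda>k\<in>{..<m}. g k)
          = distr (\<Pi>\<^sub>M k\<in>{..<m}. std_normal_distribution) (\<Pi>\<^sub>M k\<in>{..<m}. std_normal_distribution) (\<lambda>g. g)"
        by (intro distr_cong) (auto simp: space_PiM)
      also have "\<dots> = (\<Pi>\<^sub>M k\<in>{..<m}. distr (\<Pi>\<^sub>M k\<in>{..<m}. std_normal_distribution) std_normal_distribution (\<lambda>g. g k))"
        by (subst distr_id, rule PiM_cong) (auto simp: P.PiM_component)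
      finally show ?thesis
        by (subst P.indep_vars_iff_distr_eq_PiM') (use False in auto)
    next
      case True
      then show ?thesis unfolding P.indep_vars_def P.indep_sets_def by auto
    qed
    then show ?thesis by (rule P.indep_vars_compose2) simp
  qed
  have comp: "distr Q borel (\<lambda>g. c k * g k) = gauss (c k)" if "k < m" for k
  proof -
    have "distr Q borel (\<lambda>g. c k * g k) = distr (distr Q std_normal_distribution (\<lambda>g. g k)) borel (\<lambda>x. c k * x)"
      unfolding Q_def using that by (subst distr_distr) (auto simp: comp_def)
    also have "distr Q std_normal_distribution (\<lambda>g. g k) = std_normal_distribution"
      unfolding Q_def using that by (subst P.PiM_component) auto
    finally show ?thesis by (simp add: gauss_def)
  qed
  have "distr \<mu> borel (\<lambda>\<xi>. \<Sum>j<p. a j * \<xi> j) = distr Q borel (\<lambda>g. \<Sum>j<p. a j * (\<Sum>k<m. L $$ (j, k) * g k))"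
    unfolding mu Q_def
    by (subst distr_distr) (auto simp: comp_def intro!: measurable_restrict)
  also have "(\<lambda>g. \<Sum>j<p. a j * (\<Sum>k<m. L $$ (j, k) * g k)) = (\<lambda>g. \<Sum>k<m. c k * g k)"
    unfolding c_def sum_distrib_left sum_distrib_right by (subst sum.swap) (simp add: mult_ac)
  also have "distr Q borel (\<lambda>g. \<Sum>k<m. c k * g k) = gauss (sqrt (\<Sum>k<m. (c k)\<^sup>2))"
    unfolding Q_def by (rule P.indep_sum_gauss[OF _ ind]) (use comp in \<open>auto simp: Q_def\<close>)
  finally show "distr \<mu> borel (\<lambda>\<xi>. \<Sum>j<p. a j * \<xi> j) = gauss (sqrt (\<Sum>j<p. a j * (\<Sum>k<p. a k * A $$ (j, k))))"
    by (simp only: c2)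
qed

lemma gauss_exp: "(\<integral>\<^sup>+x. ennreal (exp (l * x)) \<partial>gauss \<tau>) = ennreal (exp (l\<^sup>2 * \<tau>\<^sup>2 / 2))"
proof -
  have "(\<integral>\<^sup>+x. ennreal (exp (l * x)) \<partial>gauss \<tau>)
      = (\<integral>\<^sup>+x. ennreal (std_normal_density x) * ennreal (exp (l * \<tau> * x)) \<partial>lborel)"
    unfolding gauss_def by (simp add: nn_integral_distr nn_integral_density mult_ac)
  also have "\<dots> = (\<integral>\<^sup>+x. ennreal (exp ((l * \<tau>)\<^sup>2 / 2)) * ennreal (normal_density (l * \<tau>) 1 x) \<partial>lborel)"
    by (intro nn_integral_cong)
       (simp add: ennreal_mult[symmetric] normal_density_def exp_add[symmetric] mult_exp_exp power2_eq_square field_simps)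
  also have "\<dots> = ennreal (exp ((l * \<tau>)\<^sup>2 / 2)) * (\<integral>\<^sup>+x. ennreal (normal_density (l * \<tau>) 1 x) \<partial>lborel)"
    by (intro nn_integral_cmult) simp
  also have "(\<integral>\<^sup>+x. ennreal (normal_density (l * \<tau>) 1 x) \<partial>lborel) = 1"
    using prob_space.emeasure_space_1[OF prob_space_normal_density[of 1 "l * \<tau>"]]
    by (simp add: emeasure_density)
  finally show ?thesis by (simp add: power_mult_distrib)
qed

text \<open>\<open>exp (l x\<^sup>2)\<close> times the standard normal density is \<open>\<sigma>\<close> times the \<open>N(0, \<sigma>\<^sup>2)\<close> density with
  \<open>\<sigma> = (1 - 2 l)\<^sup>-\<^sup>1\<^sup>/\<^sup>2\<close>.\<close>

lemma gauss_exp_square: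
  assumes "l < 1/2"
  shows "(\<integral>\<^sup>+x. ennreal (exp (l * x\<^sup>2)) \<partial>gauss 1) = ennreal (1 / sqrt (1 - 2 * l))"
proof -
  define s where "s = 1 / sqrt (1 - 2 * l)"
  have s: "s > 0" "s\<^sup>2 = 1 / (1 - 2 * l)" using assms by (auto simp: s_def power_divide)
  have "(\<integral>\<^sup>+x. ennreal (exp (l * x\<^sup>2)) \<partial>gauss 1)
      = (\<integral>\<^sup>+x. ennreal (std_normal_density x) * ennreal (exp (l * x\<^sup>2)) \<partial>lborel)"
    unfolding gauss_def by (simp add: nn_integral_distr nn_integral_density mult_ac)
  also have "\<dots> = (\<integral>\<^sup>+x. ennreal s * ennreal (normal_density 0 s x) \<partial>lborel)"
  proof (intro nn_integral_cong)
    fix x :: real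
    have "std_normal_density x * exp (l * x\<^sup>2) = s * normal_density 0 s x"
    proof -
      have "- x\<^sup>2 / 2 + l * x\<^sup>2 = - x\<^sup>2 / (2 * s\<^sup>2)" using assms by (simp add: s field_simps)
      then show ?thesis using s(1)
        by (simp add: normal_density_def mult_exp_exp real_sqrt_mult)
    qed
    then show "ennreal (std_normal_density x) * ennreal (exp (l * x\<^sup>2)) = ennreal s * ennreal (normal_density 0 s x)"
      using s(1) by (simp add: ennreal_mult[symmetric])
  qed
  also have "\<dots> = ennreal s * (\<integral>\<^sup>+x. ennreal (normal_density 0 s x) \<partial>lborel)"
    by (intro nn_integral_cmult) simp
  also have "(\<integral>\<^sup>+x. ennreal (normal_density 0 s x) \<partial>lborel) = 1"
    using prob_space.emeasure_space_1[OF prob_space_normal_density[OF s(1), of 0]]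
    by (simp add: emeasure_density)
  finally show ?thesis by (simp add: s_def)
qed

lemma prob_gauss_ge:
  assumes "t \<ge> 0" "\<tau> > 0"
  shows "measure (gauss \<tau>) {x. t \<le> x} \<le> exp (- t\<^sup>2 / (2 * \<tau>\<^sup>2))"
proof -
  interpret real_distribution "gauss \<tau>" by (rule real_distribution_gauss)
  define l where "l = t / \<tau>\<^sup>2"
  have "ennreal (prob {x. t \<le> x}) = emeasure (gauss \<tau>) {x. t \<le> x}" by (simp add: emeasure_eq_measure)
  also have "\<dots> = (\<integral>\<^sup>+x. indicator {x. t \<le> x} x \<partial>gauss \<tau>)" by simp
  also have "\<dots> \<le> (\<integral>\<^sup>+x. ennreal (exp (- l * t)) * ennreal (exp (l * x)) \<partial>gauss \<tau>)"
    using assms by (intro nn_integral_mono)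
      (auto simp: indicator_def ennreal_mult[symmetric] mult_exp_exp l_def ennreal_1[symmetric]
        divide_right_mono mult_left_mono simp del: ennreal_1)
  also have "\<dots> = ennreal (exp (- l * t)) * ennreal (exp (l\<^sup>2 * \<tau>\<^sup>2 / 2))"
    by (subst nn_integral_cmult) (auto simp: gauss_exp)
  also have "\<dots> = ennreal (exp (- t\<^sup>2 / (2 * \<tau>\<^sup>2)))"
    using assms by (simp add: ennreal_mult[symmetric] mult_exp_exp l_def power2_eq_square field_simps)
  finally show ?thesis by simp
qed

lemma prob_gauss_abs_gt:
  assumes "t \<ge> 0"
  shows "measure (gauss \<tau>) {x. t * \<bar>\<tau>\<bar> < \<bar>x\<bar>} \<le> 2 * exp (- t\<^sup>2 / 2)"
proof -
  interpret real_distribution "gauss \<tau>" by (rule real_distribution_gauss)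
  have sym: "gauss (- a) = gauss a" for a
    by (rule gauss_eqI[OF real_distribution_gauss]) (simp add: char_gauss)
  then have abs: "gauss \<tau> = gauss \<bar>\<tau>\<bar>" by (cases "\<tau> \<ge> 0") (auto simp: abs_if)
  show ?thesis
  proof (cases "\<tau> = 0")
    case True
    have "measure (gauss 0) {x. 0 < \<bar>x\<bar>} = measure std_normal_distribution {}"
      unfolding gauss_def by (subst measure_distr) auto
    then show ?thesis using True by simp
  next
    case False
    interpret P: real_distribution "gauss \<bar>\<tau>\<bar>" by (rule real_distribution_gauss)
    have "P.prob {x. t * \<bar>\<tau>\<bar> < \<bar>x\<bar>} \<le> P.prob ({x. t * \<bar>\<tau>\<bar> \<le> x} \<union> {x. t * \<bar>\<tau>\<bar> \<le> - x})"
      by (intro P.finite_measure_mono) auto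
    also have "\<dots> \<le> P.prob {x. t * \<bar>\<tau>\<bar> \<le> x} + P.prob {x. t * \<bar>\<tau>\<bar> \<le> - x}"
      by (intro measure_Un_le) auto
    also have "P.prob {x. t * \<bar>\<tau>\<bar> \<le> - x} = measure (distr (gauss \<bar>\<tau>\<bar>) borel (\<lambda>x. - 1 * x)) {x. t * \<bar>\<tau>\<bar> \<le> x}"
      by (subst measure_distr) auto
    also have "distr (gauss \<bar>\<tau>\<bar>) borel (\<lambda>x. - 1 * x) = gauss \<bar>\<tau>\<bar>"
      by (subst distr_scale_gauss) (simp add: sym)
    also have "P.prob {x. t * \<bar>\<tau>\<bar> \<le> x} + P.prob {x. t * \<bar>\<tau>\<bar> \<le> x} \<le> 2 * exp (- (t * \<bar>\<tau>\<bar>)\<^sup>2 / (2 * \<bar>\<tau>\<bar>\<^sup>2))"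
      using prob_gauss_ge[of "t * \<bar>\<tau>\<bar>" "\<bar>\<tau>\<bar>"] assms False by simp
    also have "- (t * \<bar>\<tau>\<bar>)\<^sup>2 / (2 * \<bar>\<tau>\<bar>\<^sup>2) = - t\<^sup>2 / 2"
      using False by (simp add: power_mult_distrib)
    finally show ?thesis using abs by simp
  qed
qed

lemma minus_ln_bound:
  assumes "\<bar>x\<bar> \<le> 1/2"
  shows "- ln (1 - x) \<le> x + 2 * (x::real)\<^sup>2"
  using abs_ln_one_plus_x_minus_x_bound[of "- x"] assms by auto

lemma gauss_exp_square_le:
  assumes "\<bar>l\<bar> \<le> 1/4"
  shows "(\<integral>\<^sup>+x. ennreal (exp (l * x\<^sup>2)) \<partial>gauss 1) \<le> ennreal (exp (l + 4 * l\<^sup>2))"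
proof -
  have "1 / sqrt (1 - 2 * l) = exp (- ln (1 - 2 * l) / 2)"
    using assms by (simp add: ln_sqrt[symmetric] exp_minus inverse_eq_divide)
  also have "\<dots> \<le> exp ((2 * l + 2 * (2 * l)\<^sup>2) / 2)"
    using minus_ln_bound[of "2 * l"] assms by simp
  also have "\<dots> = exp (l + 4 * l\<^sup>2)" by (simp add: power_mult_distrib)
  finally show ?thesis using gauss_exp_square[of l] assms by (simp add: ennreal_leI)
qed

lemma (in prob_space) chernoff_bound:
  assumes [measurable]: "random_variable borel S"
    and b: "(\<integral>\<^sup>+\<omega>. ennreal (exp (l * S \<omega>)) \<partial>M) \<le> ennreal B" "B \<ge> 0"
  shows "prob {\<omega> \<in> space M. c \<le> l * S \<omega>} \<le> exp (- c) * B"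
proof -
  have "ennreal (prob {\<omega> \<in> space M. c \<le> l * S \<omega>}) = emeasure M {\<omega> \<in> space M. c \<le> l * S \<omega>}"
    by (simp add: emeasure_eq_measure)
  also have "\<dots> = (\<integral>\<^sup>+\<omega>. indicator {\<omega> \<in> space M. c \<le> l * S \<omega>} \<omega> \<partial>M)" by simp
  also have "\<dots> \<le> (\<integral>\<^sup>+\<omega>. ennreal (exp (- c)) * ennreal (exp (l * S \<omega>)) \<partial>M)"
    by (intro nn_integral_mono)
      (auto simp: indicator_def ennreal_mult[symmetric] mult_exp_exp ennreal_1[symmetric] simp del: ennreal_1)
  also have "\<dots> \<le> ennreal (exp (- c)) * ennreal B"
    by (subst nn_integral_cmult) (auto intro!: mult_left_mono b)
  also have "\<dots> = ennreal (exp (- c) * B)" using b by (simp add: ennreal_mult)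
  finally show ?thesis using b by (simp add: ennreal_le_iff)
qed

text \<open>Chernoff's bound with \<open>l = \<plusminus> t / 8\<close>, which minimizes \<open>- l t + 4 l\<^sup>2\<close>.\<close>

lemma (in prob_space) chi_square_std:
  assumes ind: "indep_vars (\<lambda>_. borel) X {..<n}" and X: "\<And>i. i < n \<Longrightarrow> distr M borel (X i) = gauss 1"
    and t: "0 \<le> t" "t \<le> 1" and n: "n > (0::nat)"
  shows "prob {\<omega> \<in> space M. t < \<bar>(\<Sum>i<n. (X i \<omega>)\<^sup>2) / n - 1\<bar>} \<le> 2 * exp (- real n * t\<^sup>2 / 16)"
proof -
  define S where "S \<omega> = (\<Sum>i<n. (X i \<omega>)\<^sup>2)" for \<omega>
  have X_meas [measurable]: "random_variable borel (X i)" if "i < n" for i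
    using ind that by (auto simp: indep_vars_def)
  have [measurable]: "random_variable borel S" unfolding S_def by measurable
  have E: "(\<integral>\<^sup>+\<omega>. ennreal (exp (l * S \<omega>)) \<partial>M) \<le> ennreal (exp (n * (l + 4 * l\<^sup>2)))"
    if l: "\<bar>l\<bar> \<le> 1/4" for l :: real
  proof -
    have "(\<integral>\<^sup>+\<omega>. ennreal (exp (l * S \<omega>)) \<partial>M) = (\<integral>\<^sup>+\<omega>. (\<Prod>i<n. ennreal (exp (l * (X i \<omega>)\<^sup>2))) \<partial>M)"
      by (simp add: S_def sum_distrib_left exp_sum prod_ennreal)
    also have "\<dots> = (\<Prod>i<n. \<integral>\<^sup>+\<omega>. ennreal (exp (l * (X i \<omega>)\<^sup>2)) \<partial>M)"
      by (intro indep_vars_nn_integral indep_vars_compose2[OF ind]) auto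
    also have "\<dots> \<le> (\<Prod>i<n. ennreal (exp (l + 4 * l\<^sup>2)))"
    proof (intro prod_mono_ennreal)
      fix i assume i: "i \<in> {..<n}"
      have "(\<integral>\<^sup>+\<omega>. ennreal (exp (l * (X i \<omega>)\<^sup>2)) \<partial>M) = (\<integral>\<^sup>+x. ennreal (exp (l * x\<^sup>2)) \<partial>distr M borel (X i))"
        using i by (subst nn_integral_distr) auto
      also have "\<dots> \<le> ennreal (exp (l + 4 * l\<^sup>2))" using i l by (simp add: X gauss_exp_square_le)
      finally show "(\<integral>\<^sup>+\<omega>. ennreal (exp (l * (X i \<omega>)\<^sup>2)) \<partial>M) \<le> ennreal (exp (l + 4 * l\<^sup>2))" .
    qed
    also have "\<dots> = ennreal (exp (n * (l + 4 * l\<^sup>2)))"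
      by (simp add: ennreal_power exp_of_nat_mult)
    finally show ?thesis .
  qed
  define l where "l = t / 8"
  have l: "\<bar>l\<bar> \<le> 1/4" "\<bar>- l\<bar> \<le> 1/4" using t by (auto simp: l_def)
  have "prob {\<omega> \<in> space M. t < \<bar>S \<omega> / n - 1\<bar>}
      \<le> prob ({\<omega> \<in> space M. l * (n * (1 + t)) \<le> l * S \<omega>} \<union> {\<omega> \<in> space M. - l * (n * (1 - t)) \<le> - l * S \<omega>})"
  proof (intro finite_measure_mono subsetI)
    fix \<omega> assume w: "\<omega> \<in> {\<omega> \<in> space M. t < \<bar>S \<omega> / n - 1\<bar>}"
    have "n * (1 + t) \<le> S \<omega> \<or> S \<omega> \<le> n * (1 - t)"
      using w n by (auto simp: abs_if field_simps split: if_splits)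
    then show "\<omega> \<in> {\<omega> \<in> space M. l * (n * (1 + t)) \<le> l * S \<omega>} \<union> {\<omega> \<in> space M. - l * (n * (1 - t)) \<le> - l * S \<omega>}"
      using w t by (auto simp: l_def intro: mult_left_mono)
  qed measurable
  also have "\<dots> \<le> prob {\<omega> \<in> space M. l * (n * (1 + t)) \<le> l * S \<omega>} + prob {\<omega> \<in> space M. - l * (n * (1 - t)) \<le> - l * S \<omega>}"
    by (intro measure_Un_le) measurable
  also have "\<dots> \<le> exp (- (l * (n * (1 + t)))) * exp (n * (l + 4 * l\<^sup>2)) +
      exp (- (- l * (n * (1 - t)))) * exp (n * (- l + 4 * (- l)\<^sup>2))"
    by (intro add_mono chernoff_bound E l) auto
  also have "exp (- (l * (n * (1 + t)))) * exp (n * (l + 4 * l\<^sup>2)) = exp (- real n * t\<^sup>2 / 16)"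
    by (simp add: mult_exp_exp l_def power2_eq_square field_simps)
  also have "exp (- (- l * (n * (1 - t)))) * exp (n * (- l + 4 * (- l)\<^sup>2)) = exp (- real n * t\<^sup>2 / 16)"
    by (simp add: mult_exp_exp l_def power2_eq_square field_simps)
  finally show ?thesis by (simp add: S_def)
qed

lemma (in prob_space) chi_square_concentration:
  assumes ind: "indep_vars (\<lambda>_. borel) X {..<n}" and X: "\<And>i. i < n \<Longrightarrow> distr M borel (X i) = gauss \<tau>"
    and t: "0 \<le> t" "t \<le> 1" and n: "n > (0::nat)"
  shows "prob {\<omega> \<in> space M. t * \<tau>\<^sup>2 < \<bar>(\<Sum>i<n. (X i \<omega>)\<^sup>2) / n - \<tau>\<^sup>2\<bar>} \<le> 2 * exp (- real n * t\<^sup>2 / 16)"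
proof (cases "\<tau> = 0")
  case True
  have X_meas [measurable]: "random_variable borel (X i)" if "i < n" for i
    using ind that by (auto simp: indep_vars_def)
  have "AE \<omega> in M. X i \<omega> = 0" if i: "i < n" for i
  proof -
    have "AE x in gauss 0. x = 0" unfolding gauss_def by (subst AE_distr_iff) auto
    then have "AE x in distr M borel (X i). x = 0" unfolding X[OF i] True .
    then show ?thesis using i by (subst (asm) AE_distr_iff) auto
  qed
  then have "AE \<omega> in M. \<forall>i\<in>{..<n}. X i \<omega> = 0" by (intro AE_finite_allI) auto
  then have "AE \<omega> in M. \<not> (t * \<tau>\<^sup>2 < \<bar>(\<Sum>i<n. (X i \<omega>)\<^sup>2) / n - \<tau>\<^sup>2\<bar>)"
    by eventually_elim (auto simp: True)
  then have "prob {\<omega> \<in> space M. t * \<tau>\<^sup>2 < \<bar>(\<Sum>i<n. (X i \<omega>)\<^sup>2) / n - \<tau>\<^sup>2\<bar>} = 0"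
    by (subst prob_eq_0) auto
  then show ?thesis by simp
next
  case False
  have X_meas [measurable]: "random_variable borel (X i)" if "i < n" for i
    using ind that by (auto simp: indep_vars_def)
  define X' where "X' i \<omega> = (1 / \<tau>) * X i \<omega>" for i \<omega>
  have "distr M borel (X' i) = gauss 1" if i: "i < n" for i
  proof -
    have "distr M borel (X' i) = distr (distr M borel (X i)) borel (\<lambda>x. (1 / \<tau>) * x)"
      using i unfolding X'_def by (subst distr_distr) (auto simp: comp_def)
    also have "\<dots> = gauss ((1 / \<tau>) * \<tau>)" unfolding X[OF i] by (rule distr_scale_gauss)
    also have "(1 / \<tau>) * \<tau> = 1" using False by simp
    finally show ?thesis .
  qed
  moreover have "indep_vars (\<lambda>_. borel) X' {..<n}"
    unfolding X'_def by (rule indep_vars_compose2[OF ind]) simp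
  ultimately have "prob {\<omega> \<in> space M. t < \<bar>(\<Sum>i<n. (X' i \<omega>)\<^sup>2) / n - 1\<bar>} \<le> 2 * exp (- real n * t\<^sup>2 / 16)"
    using t n by (intro chi_square_std) auto
  moreover have "(t * \<tau>\<^sup>2 < \<bar>(\<Sum>i<n. (X i \<omega>)\<^sup>2) / n - \<tau>\<^sup>2\<bar>) \<longleftrightarrow> (t < \<bar>(\<Sum>i<n. (X' i \<omega>)\<^sup>2) / n - 1\<bar>)" for \<omega>
  proof -
    have eq: "(\<Sum>i<n. (X i \<omega>)\<^sup>2) / n - \<tau>\<^sup>2 = \<tau>\<^sup>2 * ((\<Sum>i<n. (X' i \<omega>)\<^sup>2) / n - 1)"
      using False by (simp add: X'_def power_mult_distrib power_divide sum_distrib_left sum_divide_distrib right_diff_distrib)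
    have "0 < \<tau>\<^sup>2" using False by simp
    then show ?thesis unfolding eq abs_mult by (simp add: mult.commute[of t])
  qed
  ultimately show ?thesis by simp
qed

text \<open>After scaling \<open>X\<close> and \<open>Y\<close> by \<open>b\<close> and \<open>b'\<close>, polarization writes \<open>X Y\<close> as a difference of the squares of
  \<open>X + Y\<close> and \<open>X - Y\<close>, whose variances add up to at most 4.\<close>

lemma (in prob_space) product_concentration:
  assumes ind: "\<And>c d. indep_vars (\<lambda>_. borel) (\<lambda>i \<omega>. c * X i \<omega> + d * Y i \<omega>) {..<n}"
    and law: "\<And>c d i. i < n \<Longrightarrow>
      distr M borel (\<lambda>\<omega>. c * X i \<omega> + d * Y i \<omega>) = gauss (sqrt (c\<^sup>2 * vx + 2 * c * d * vxy + d\<^sup>2 * vy))"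
    and nn: "\<And>c d. 0 \<le> c\<^sup>2 * vx + 2 * c * d * vxy + d\<^sup>2 * vy"
    and b: "vx \<le> b\<^sup>2" "vy \<le> b'\<^sup>2" "0 < b" "0 < b'" and t: "0 \<le> t" "t \<le> 1" and n: "n > (0::nat)"
  shows "prob {\<omega> \<in> space M. t * (b * b') < \<bar>(\<Sum>i<n. X i \<omega> * Y i \<omega>) / n - vxy\<bar>} \<le> 4 * exp (- real n * t\<^sup>2 / 16)"
proof -
  define P where "P d i \<omega> = (1 / b) * X i \<omega> + d * Y i \<omega>" for d i \<omega>
  define v where "v d = (1 / b)\<^sup>2 * vx + 2 * (1 / b) * d * vxy + d\<^sup>2 * vy" for d
  define E where "E d = {\<omega> \<in> space M. t * v d < \<bar>(\<Sum>i<n. (P d i \<omega>)\<^sup>2) / n - v d\<bar>}" for d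
  have P_meas [measurable]: "random_variable borel (P d i)" if "i < n" for d i
    using ind[of "1/b" d] that unfolding P_def by (auto simp: indep_vars_def)
  have E [measurable]: "E d \<in> sets M" for d
    unfolding E_def by measurable
  have PE: "prob (E d) \<le> 2 * exp (- real n * t\<^sup>2 / 16)" for d
    using chi_square_concentration[of "P d" n "sqrt (v d)" t] ind[of "1/b" d] law[of _ "1/b" d] nn[of "1/b" d] t n
    unfolding P_def v_def E_def by simp
  have "prob {\<omega> \<in> space M. t * (b * b') < \<bar>(\<Sum>i<n. X i \<omega> * Y i \<omega>) / n - vxy\<bar>} \<le> prob (E (1/b') \<union> E (- (1/b')))"
  proof (intro finite_measure_mono subsetI)
    fix \<omega> assume w: "\<omega> \<in> {\<omega> \<in> space M. t * (b * b') < \<bar>(\<Sum>i<n. X i \<omega> * Y i \<omega>) / n - vxy\<bar>}"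
    show "\<omega> \<in> E (1/b') \<union> E (- (1/b'))"
    proof (rule ccontr)
      assume neg: "\<not> ?thesis"
      define p where "p = (\<Sum>i<n. (P (1/b') i \<omega>)\<^sup>2) / n"
      define m where "m = (\<Sum>i<n. (P (- (1/b')) i \<omega>)\<^sup>2) / n"
      have pm: "\<bar>p - v (1/b')\<bar> \<le> t * v (1/b')" "\<bar>m - v (- (1/b'))\<bar> \<le> t * v (- (1/b'))"
        using neg w unfolding E_def p_def m_def by auto
      have "(P (1/b') i \<omega>)\<^sup>2 - (P (- (1/b')) i \<omega>)\<^sup>2 = 4 / (b * b') * (X i \<omega> * Y i \<omega>)" for i
        using b unfolding P_def by (simp add: power2_eq_square field_simps)
      then have d1: "p - m = 4 / (b * b') * ((\<Sum>i<n. X i \<omega> * Y i \<omega>) / n)"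
        unfolding p_def m_def diff_divide_distrib[symmetric] sum_subtractf[symmetric]
        by (simp add: sum_distrib_left sum_divide_distrib)
      have d2: "v (1/b') - v (- (1/b')) = 4 / (b * b') * vxy"
        using b unfolding v_def by (simp add: power2_eq_square field_simps)
      have "v (1/b') + v (- (1/b')) = 2 * (vx / b\<^sup>2 + vy / b'\<^sup>2)"
        using b unfolding v_def by (simp add: power2_eq_square field_simps)
      also have "\<dots> \<le> 2 * (1 + 1)" using b by (intro mult_left_mono add_mono) auto
      finally have "t * (v (1/b') + v (- (1/b'))) \<le> t * 4" using t by (intro mult_left_mono) auto
      then have "\<bar>(p - m) - (v (1/b') - v (- (1/b')))\<bar> \<le> t * 4"
        using pm by (simp add: distrib_left abs_le_iff)
      then have "\<bar>4 / (b * b') * ((\<Sum>i<n. X i \<omega> * Y i \<omega>) / n - vxy)\<bar> \<le> t * 4"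
        unfolding d1 d2 by (simp add: right_diff_distrib)
      then have "\<bar>(\<Sum>i<n. X i \<omega> * Y i \<omega>) / n - vxy\<bar> \<le> t * (b * b')"
        using b by (simp add: abs_mult field_simps)
      then show False using w by simp
    qed
  qed measurable
  also have "\<dots> \<le> prob (E (1/b')) + prob (E (- (1/b')))" by (intro measure_Un_le E)
  also have "\<dots> \<le> 4 * exp (- real n * t\<^sup>2 / 16)" using PE[of "1/b'"] PE[of "-(1/b')"] by simp
  finally show ?thesis .
qed

text \<open>Given \<open>U = c\<close>, the sum \<open>\<Sum> G\<^sub>i c\<^sub>i\<close> is centered normal with standard deviation \<open>\<tau> \<parallel>c\<parallel>\<^sub>2\<close>, so the tail bound
  relative to \<open>\<parallel>c\<parallel>\<^sub>2\<close> is the same for every \<open>c\<close> and survives integration over the law of \<open>U\<close>.\<close>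

lemma (in prob_space) noise_bound:
  fixes n :: nat
  assumes GU: "indep_var (\<Pi>\<^sub>M i\<in>{..<n}. borel) (\<lambda>\<omega>. \<lambda>i\<in>{..<n}. G i \<omega>) (\<Pi>\<^sub>M i\<in>{..<n}. borel) (\<lambda>\<omega>. \<lambda>i\<in>{..<n}. U i \<omega>)"
    and ind: "indep_vars (\<lambda>_. borel) G {..<n}" and G: "\<And>i. i < n \<Longrightarrow> distr M borel (G i) = gauss \<tau>"
    and b: "0 \<le> \<tau>" "\<tau> \<le> b" and t: "0 \<le> t"
  shows "prob {\<omega> \<in> space M. t * b * sqrt (\<Sum>i<n. (U i \<omega>)\<^sup>2) < \<bar>\<Sum>i<n. G i \<omega> * U i \<omega>\<bar>} \<le> 2 * exp (- t\<^sup>2 / 2)"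
proof -
  let ?B = "(\<Pi>\<^sub>M i\<in>{..<n}. borel) :: (nat \<Rightarrow> real) measure"
  define GG where "GG \<omega> = (\<lambda>i\<in>{..<n}. G i \<omega>)" for \<omega>
  define UU where "UU \<omega> = (\<lambda>i\<in>{..<n}. U i \<omega>)" for \<omega>
  have GU': "indep_var ?B GG ?B UU" using GU unfolding GG_def UU_def .
  have mG [measurable]: "random_variable ?B GG" and mU [measurable]: "random_variable ?B UU"
    using GU' indep_var_rv1 indep_var_rv2 by blast+
  have G_meas [measurable]: "random_variable borel (G i)" if "i < n" for i
    using ind that by (auto simp: indep_vars_def)
  define A where "A = {z \<in> space (?B \<Otimes>\<^sub>M ?B). t * b * sqrt (\<Sum>i<n. (snd z i)\<^sup>2) < \<bar>\<Sum>i<n. fst z i * snd z i\<bar>}"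
  have A [measurable]: "A \<in> sets (?B \<Otimes>\<^sub>M ?B)" unfolding A_def by measurable
  interpret DG: prob_space "distr M ?B GG" by (rule prob_space_distr) simp
  interpret DU: prob_space "distr M ?B UU" by (rule prob_space_distr) simp
  interpret P: pair_prob_space "distr M ?B GG" "distr M ?B UU" ..
  have fixed: "prob {\<omega> \<in> space M. t * b * sqrt (\<Sum>i<n. (c i)\<^sup>2) < \<bar>\<Sum>i<n. G i \<omega> * c i\<bar>} \<le> 2 * exp (- t\<^sup>2 / 2)" for c
  proof -
    have "distr M borel (\<lambda>\<omega>. \<Sum>i<n. c i * G i \<omega>) = gauss (sqrt (\<Sum>i<n. (c i * \<tau>)\<^sup>2))"
    proof (rule indep_sum_gauss)
      show "indep_vars (\<lambda>_. borel) (\<lambda>i \<omega>. c i * G i \<omega>) {..<n}" by (rule indep_vars_compose2[OF ind]) simp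
      fix i assume i: "i \<in> {..<n}"
      have "distr M borel (\<lambda>\<omega>. c i * G i \<omega>) = distr (distr M borel (G i)) borel (\<lambda>x. c i * x)"
        using i by (subst distr_distr) (auto simp: comp_def)
      then show "distr M borel (\<lambda>\<omega>. c i * G i \<omega>) = gauss (c i * \<tau>)"
        using i by (simp add: G distr_scale_gauss)
    qed simp
    also have "sqrt (\<Sum>i<n. (c i * \<tau>)\<^sup>2) = sqrt (\<Sum>i<n. (c i)\<^sup>2) * \<tau>"
      using b by (simp add: power_mult_distrib sum_distrib_right[symmetric] real_sqrt_mult)
    finally have D: "distr M borel (\<lambda>\<omega>. \<Sum>i<n. c i * G i \<omega>) = gauss (sqrt (\<Sum>i<n. (c i)\<^sup>2) * \<tau>)" .
    have "prob {\<omega> \<in> space M. t * b * sqrt (\<Sum>i<n. (c i)\<^sup>2) < \<bar>\<Sum>i<n. G i \<omega> * c i\<bar>}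
        = measure (distr M borel (\<lambda>\<omega>. \<Sum>i<n. c i * G i \<omega>)) {x. t * b * sqrt (\<Sum>i<n. (c i)\<^sup>2) < \<bar>x\<bar>}"
      by (subst measure_distr) (auto simp: mult.commute intro!: arg_cong[where f=prob])
    also have "\<dots> \<le> measure (gauss (sqrt (\<Sum>i<n. (c i)\<^sup>2) * \<tau>)) {x. t * \<bar>sqrt (\<Sum>i<n. (c i)\<^sup>2) * \<tau>\<bar> < \<bar>x\<bar>}"
    proof -
      interpret g: real_distribution "gauss (sqrt (\<Sum>i<n. (c i)\<^sup>2) * \<tau>)" by (rule real_distribution_gauss)
      have "t * \<bar>sqrt (\<Sum>i<n. (c i)\<^sup>2) * \<tau>\<bar> = t * \<tau> * sqrt (\<Sum>i<n. (c i)\<^sup>2)"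
        using b by (simp add: abs_mult sum_nonneg)
      also have "\<dots> \<le> t * b * sqrt (\<Sum>i<n. (c i)\<^sup>2)"
        using b t by (intro mult_right_mono mult_left_mono) (auto simp: sum_nonneg)
      finally show ?thesis unfolding D by (intro g.finite_measure_mono) auto
    qed
    also have "\<dots> \<le> 2 * exp (- t\<^sup>2 / 2)" by (rule prob_gauss_abs_gt[OF t])
    finally show ?thesis .
  qed
  have "ennreal (prob {\<omega> \<in> space M. t * b * sqrt (\<Sum>i<n. (U i \<omega>)\<^sup>2) < \<bar>\<Sum>i<n. G i \<omega> * U i \<omega>\<bar>})
      = emeasure M ((\<lambda>\<omega>. (GG \<omega>, UU \<omega>)) -` A \<inter> space M)"
    unfolding emeasure_eq_measure
    by (intro arg_cong[where f=ennreal] arg_cong[where f=prob])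
       (auto simp: A_def GG_def UU_def space_pair_measure space_PiM)
  also have "\<dots> = emeasure (distr M (?B \<Otimes>\<^sub>M ?B) (\<lambda>\<omega>. (GG \<omega>, UU \<omega>))) A"
    by (subst emeasure_distr) auto
  also have "\<dots> = emeasure (distr M ?B GG \<Otimes>\<^sub>M distr M ?B UU) A"
    using GU' by (simp add: indep_var_distribution_eq)
  also have "\<dots> = (\<integral>\<^sup>+u. emeasure (distr M ?B GG) ((\<lambda>g. (g, u)) -` A) \<partial>distr M ?B UU)"
    by (rule P.emeasure_pair_measure_alt2) measurable
  also have "\<dots> \<le> (\<integral>\<^sup>+u. ennreal (2 * exp (- t\<^sup>2 / 2)) \<partial>distr M ?B UU)"
  proof (rule nn_integral_mono)
    fix u assume u: "u \<in> space (distr M ?B UU)"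
    then have [measurable]: "(\<lambda>g. (g, u)) -` A \<in> sets ?B"
      using sets_Pair2[OF A, of u] by simp
    have "emeasure (distr M ?B GG) ((\<lambda>g. (g, u)) -` A) = emeasure M (GG -` ((\<lambda>g. (g, u)) -` A) \<inter> space M)"
      by (subst emeasure_distr) auto
    also have "GG -` ((\<lambda>g. (g, u)) -` A) \<inter> space M = {\<omega> \<in> space M. t * b * sqrt (\<Sum>i<n. (u i)\<^sup>2) < \<bar>\<Sum>i<n. G i \<omega> * u i\<bar>}"
      using u by (auto simp: A_def GG_def space_pair_measure space_PiM)
    also have "emeasure M \<dots> \<le> ennreal (2 * exp (- t\<^sup>2 / 2))"
      using fixed[of u] by (simp add: emeasure_eq_measure)
    finally show "emeasure (distr M ?B GG) ((\<lambda>g. (g, u)) -` A) \<le> ennreal (2 * exp (- t\<^sup>2 / 2))" .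
  qed
  also have "\<dots> = ennreal (2 * exp (- t\<^sup>2 / 2))"
    using DU.emeasure_space_1 by simp
  finally show ?thesis by simp
qed

text \<open>A weak law of large numbers that is uniform over laws with bounded moments of order \<open>2 + \<delta>\<close>.  Squares
  above \<open>L\<close> are small in mean by Markov's inequality, and the remaining ones are bounded, so that
  Hoeffding's inequality applies; \<open>L\<close> is later a small power of \<open>n\<close>.\<close>

lemma (in prob_space) mean_square_bound:
  fixes N :: "nat \<Rightarrow> 'a \<Rightarrow> real"
  assumes ind: "indep_vars (\<lambda>_. borel) N {..<n}" and n: "n > 0" and d: "\<delta> > 0" and k: "\<kappa> \<ge> 0" and L: "L > 0"
    and mom: "\<And>i. i < n \<Longrightarrow> (\<integral>\<^sup>+\<omega>. ennreal (\<bar>N i \<omega>\<bar> powr (2 + \<delta>)) \<partial>M) \<le> ennreal \<kappa>"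
  shows "prob {\<omega> \<in> space M. \<kappa> + 3 < (\<Sum>i<n. (N i \<omega>)\<^sup>2) / n} \<le> \<kappa> * L powr (- \<delta> / 2) + exp (- 2 * real n / L\<^sup>2)"
proof -
  have N_meas [measurable]: "random_variable borel (N i)" if "i < n" for i
    using ind that by (auto simp: indep_vars_def)
  define T where "T i \<omega> = (if (N i \<omega>)\<^sup>2 \<le> L then (N i \<omega>)\<^sup>2 else 0)" for i \<omega>
  define R where "R i \<omega> = (if (N i \<omega>)\<^sup>2 \<le> L then 0 else (N i \<omega>)\<^sup>2)" for i \<omega>
  have T_meas [measurable]: "random_variable borel (T i)" if "i < n" for i unfolding T_def using that by measurable
  have R_meas [measurable]: "random_variable borel (R i)" if "i < n" for i unfolding R_def using that by measurable
  \<comment> \<open>\<open>T\<close> and \<open>R\<close> are the parts of the squares below and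
     above the truncation level.\<close>
  have pw: "\<bar>x\<bar> powr (2 + \<delta>) = x\<^sup>2 * \<bar>x\<bar> powr \<delta>" for x :: real
    by (cases "x = 0") (auto simp: powr_add powr_numeral)
  have T_int: "integrable M (T i)" if "i < n" for i
    using that L by (intro integrable_const_bound[where B=L]) (auto simp: T_def)
  have T_exp: "expectation (T i) \<le> 1 + \<kappa>" if i: "i < n" for i
  proof -
    have "ennreal (expectation (T i)) = (\<integral>\<^sup>+\<omega>. ennreal (T i \<omega>) \<partial>M)"
      using T_int[OF i] by (intro nn_integral_eq_integral[symmetric]) (auto simp: T_def)
    also have "\<dots> \<le> (\<integral>\<^sup>+\<omega>. 1 + ennreal (\<bar>N i \<omega>\<bar> powr (2 + \<delta>)) \<partial>M)"
    proof (rule nn_integral_mono)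
      fix \<omega>
      have "(N i \<omega>)\<^sup>2 \<le> 1 + \<bar>N i \<omega>\<bar> powr (2 + \<delta>)"
      proof (cases "\<bar>N i \<omega>\<bar> \<le> 1")
        case True
        then have "(N i \<omega>)\<^sup>2 \<le> 1" by (simp add: abs_square_le_1)
        then show ?thesis by (simp add: add_increasing2)
      next
        case False
        then have "1 \<le> \<bar>N i \<omega>\<bar> powr \<delta>" using d by (intro ge_one_powr_ge_zero) auto
        then have "(N i \<omega>)\<^sup>2 * 1 \<le> (N i \<omega>)\<^sup>2 * \<bar>N i \<omega>\<bar> powr \<delta>" by (intro mult_left_mono) auto
        then show ?thesis unfolding pw by simp
      qed
      then have "T i \<omega> \<le> 1 + \<bar>N i \<omega>\<bar> powr (2 + \<delta>)" by (auto simp: T_def)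
      then show "ennreal (T i \<omega>) \<le> 1 + ennreal (\<bar>N i \<omega>\<bar> powr (2 + \<delta>))"
        by (simp add: ennreal_1[symmetric] ennreal_plus[symmetric] ennreal_leI del: ennreal_1 ennreal_plus)
    qed
    also have "\<dots> = 1 + (\<integral>\<^sup>+\<omega>. ennreal (\<bar>N i \<omega>\<bar> powr (2 + \<delta>)) \<partial>M)"
      using i by (subst nn_integral_add) (auto simp: emeasure_space_1)
    also have "\<dots> \<le> 1 + ennreal \<kappa>" by (intro add_left_mono mom i)
    also have "\<dots> = ennreal (1 + \<kappa>)" using k by (simp add: ennreal_plus)
    finally show ?thesis using k by (subst (asm) ennreal_le_iff) auto
  qed
  interpret H: Hoeffding_ineq M "{..<n}" T "\<lambda>_. 0" "\<lambda>_. L" "\<Sum>i<n. expectation (T i)"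
  proof unfold_locales
    show "indep_vars (\<lambda>_. borel) T {..<n}"
      unfolding T_def by (rule indep_vars_compose2[OF ind]) measurable
  qed (use L in \<open>auto simp: T_def\<close>)
  have "prob {\<omega> \<in> space M. (\<Sum>i<n. T i \<omega>) \<ge> (\<Sum>i<n. expectation (T i)) + n} \<le> exp (- 2 * (real n)\<^sup>2 / (\<Sum>i<n. (L - 0)\<^sup>2))"
    using n L by (intro H.Hoeffding_ineq_ge) auto
  also have "- 2 * (real n)\<^sup>2 / (\<Sum>i<n. (L - 0)\<^sup>2) = - 2 * real n / L\<^sup>2"
    using n by (simp add: power2_eq_square)
  finally have PT: "prob {\<omega> \<in> space M. (\<Sum>i<n. T i \<omega>) \<ge> (\<Sum>i<n. expectation (T i)) + n} \<le> exp (- 2 * real n / L\<^sup>2)" .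
  have PR: "prob {\<omega> \<in> space M. 1 \<le> (\<Sum>i<n. R i \<omega>) / n} \<le> \<kappa> * L powr (- \<delta> / 2)"
  proof -
    have "ennreal (prob {\<omega> \<in> space M. 1 \<le> (\<Sum>i<n. R i \<omega>) / n}) = (\<integral>\<^sup>+\<omega>. indicator {\<omega> \<in> space M. 1 \<le> (\<Sum>i<n. R i \<omega>) / n} \<omega> \<partial>M)"
      by (subst nn_integral_indicator) (auto simp: emeasure_eq_measure)
    also have "\<dots> \<le> (\<integral>\<^sup>+\<omega>. ennreal (L powr (- \<delta> / 2) / n) * (\<Sum>i<n. ennreal (\<bar>N i \<omega>\<bar> powr (2 + \<delta>))) \<partial>M)"
    proof (rule nn_integral_mono)
      fix \<omega>
      have Rle: "R i \<omega> \<le> L powr (- \<delta> / 2) * \<bar>N i \<omega>\<bar> powr (2 + \<delta>)" for i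
      proof (cases "(N i \<omega>)\<^sup>2 \<le> L")
        case False
        have "L powr (\<delta> / 2) \<le> ((N i \<omega>)\<^sup>2) powr (\<delta> / 2)" using False L d by (intro powr_mono2) auto
        also have "\<dots> = \<bar>N i \<omega>\<bar> powr \<delta>"
        proof -
          have "N i \<omega> \<noteq> 0" using False L by auto
          then have "(N i \<omega>)\<^sup>2 = \<bar>N i \<omega>\<bar> powr 2" by (simp add: powr_numeral)
          then have "((N i \<omega>)\<^sup>2) powr (\<delta> / 2) = (\<bar>N i \<omega>\<bar> powr 2) powr (\<delta> / 2)" by (simp only:)
          also have "\<dots> = \<bar>N i \<omega>\<bar> powr \<delta>" by (subst powr_powr) simp
          finally show ?thesis .
        qed
        finally have "1 \<le> L powr (- \<delta> / 2) * \<bar>N i \<omega>\<bar> powr \<delta>"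
          using L by (simp add: powr_minus field_simps)
        then have "(N i \<omega>)\<^sup>2 * 1 \<le> (N i \<omega>)\<^sup>2 * (L powr (- \<delta> / 2) * \<bar>N i \<omega>\<bar> powr \<delta>)" by (intro mult_left_mono) auto
        then show ?thesis unfolding pw using False by (simp add: R_def mult_ac)
      qed (auto simp: R_def)
      have "(\<Sum>i<n. R i \<omega>) / n \<le> L powr (- \<delta> / 2) / n * (\<Sum>i<n. \<bar>N i \<omega>\<bar> powr (2 + \<delta>))"
        using divide_right_mono[OF sum_mono[of "{..<n}" "\<lambda>i. R i \<omega>", OF Rle], of "real n"] n
        by (simp add: sum_distrib_left[symmetric])
      then have "indicator {\<omega> \<in> space M. 1 \<le> (\<Sum>i<n. R i \<omega>) / n} \<omega> \<le> ennreal (L powr (- \<delta> / 2) / n * (\<Sum>i<n. \<bar>N i \<omega>\<bar> powr (2 + \<delta>)))"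
        by (auto simp: indicator_def ennreal_1[symmetric] simp del: ennreal_1 intro!: ennreal_leI)
      then show "indicator {\<omega> \<in> space M. 1 \<le> (\<Sum>i<n. R i \<omega>) / n} \<omega> \<le> ennreal (L powr (- \<delta> / 2) / n) * (\<Sum>i<n. ennreal (\<bar>N i \<omega>\<bar> powr (2 + \<delta>)))"
        by (subst (asm) ennreal_mult) (auto simp: sum_nonneg)
    qed
    also have "\<dots> = ennreal (L powr (- \<delta> / 2) / n) * (\<integral>\<^sup>+\<omega>. (\<Sum>i<n. ennreal (\<bar>N i \<omega>\<bar> powr (2 + \<delta>))) \<partial>M)"
      by (rule nn_integral_cmult) measurable
    also have "(\<integral>\<^sup>+\<omega>. (\<Sum>i<n. ennreal (\<bar>N i \<omega>\<bar> powr (2 + \<delta>))) \<partial>M) = (\<Sum>i<n. \<integral>\<^sup>+\<omega>. ennreal (\<bar>N i \<omega>\<bar> powr (2 + \<delta>)) \<partial>M)"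
      by (rule nn_integral_sum) measurable
    also have "ennreal (L powr (- \<delta> / 2) / n) * (\<Sum>i<n. \<integral>\<^sup>+\<omega>. ennreal (\<bar>N i \<omega>\<bar> powr (2 + \<delta>)) \<partial>M)
      \<le> ennreal (L powr (- \<delta> / 2) / n) * (\<Sum>i<n. ennreal \<kappa>)"
      by (intro mult_left_mono sum_mono mom) auto
    also have "\<dots> = ennreal (\<kappa> * L powr (- \<delta> / 2))"
      using n k by (simp add: sum_ennreal[symmetric] ennreal_mult[symmetric] ennreal_of_nat_eq_real_of_nat mult_ac)
    finally show ?thesis using k by simp
  qed
  have "prob {\<omega> \<in> space M. \<kappa> + 3 < (\<Sum>i<n. (N i \<omega>)\<^sup>2) / n}
      \<le> prob ({\<omega> \<in> space M. 1 \<le> (\<Sum>i<n. R i \<omega>) / n} \<union> {\<omega> \<in> space M. (\<Sum>i<n. T i \<omega>) \<ge> (\<Sum>i<n. expectation (T i)) + n})"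
  proof (intro finite_measure_mono subsetI)
    fix \<omega> assume w: "\<omega> \<in> {\<omega> \<in> space M. \<kappa> + 3 < (\<Sum>i<n. (N i \<omega>)\<^sup>2) / n}"
    have "(\<Sum>i<n. (N i \<omega>)\<^sup>2) = (\<Sum>i<n. T i \<omega>) + (\<Sum>i<n. R i \<omega>)"
      unfolding sum.distrib[symmetric] by (intro sum.cong) (auto simp: T_def R_def)
    then have "(\<kappa> + 3) * n < (\<Sum>i<n. T i \<omega>) + (\<Sum>i<n. R i \<omega>)" using w n by (simp add: field_simps)
    moreover have "(\<Sum>i<n. expectation (T i)) \<le> (1 + \<kappa>) * n"
      using sum_bounded_above[of "{..<n}" "\<lambda>i. expectation (T i)" "1 + \<kappa>"] T_exp by (simp add: mult.commute)
    ultimately have "n \<le> (\<Sum>i<n. R i \<omega>) \<or> (\<Sum>i<n. T i \<omega>) \<ge> (\<Sum>i<n. expectation (T i)) + n"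
      by (simp add: algebra_simps) linarith
    then show "\<omega> \<in> {\<omega> \<in> space M. 1 \<le> (\<Sum>i<n. R i \<omega>) / n} \<union> {\<omega> \<in> space M. (\<Sum>i<n. T i \<omega>) \<ge> (\<Sum>i<n. expectation (T i)) + n}"
      using w n by (auto simp: field_simps)
  qed measurable
  also have "\<dots> \<le> prob {\<omega> \<in> space M. 1 \<le> (\<Sum>i<n. R i \<omega>) / n} + prob {\<omega> \<in> space M. (\<Sum>i<n. T i \<omega>) \<ge> (\<Sum>i<n. expectation (T i)) + n}"
    by (intro measure_Un_le) measurable
  also have "\<dots> \<le> \<kappa> * L powr (- \<delta> / 2) + exp (- 2 * real n / L\<^sup>2)" by (intro add_mono PT PR)
  finally show ?thesis .
qed

section \<open>The quantile of the maximum of a normal vector\<close>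

lemma gauss_null_singleton:
  assumes "\<tau> \<noteq> 0 \<or> c \<noteq> 0"
  shows "measure (gauss \<tau>) {c} = 0"
proof (cases "\<tau> = 0")
  case True
  have "measure (gauss 0) {c} = measure std_normal_distribution {}"
    unfolding gauss_def using assms True by (subst measure_distr) (auto simp: vimage_def)
  then show ?thesis using True by simp
next
  case False
  have "emeasure std_normal_distribution {c / \<tau>} = (\<integral>\<^sup>+x. ennreal (std_normal_density x) * indicator {c / \<tau>} x \<partial>lborel)"
    by (subst emeasure_density) auto
  also have "\<dots> = 0"
  proof (subst nn_integral_0_iff_AE)
    show "AE x in lborel. ennreal (std_normal_density x) * indicator {c / \<tau>} x = 0"
      using AE_lborel_singleton[of "c / \<tau>"] by eventually_elim auto
  qed auto
  finally have "emeasure std_normal_distribution {c / \<tau>} = 0" .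
  moreover have "(\<lambda>t. \<tau> * t) -` {c} \<inter> space std_normal_distribution = {c / \<tau>}"
    using False by (auto simp: field_simps)
  ultimately show ?thesis
    unfolding gauss_def by (subst measure_distr) (auto simp: measure_def)
qed

lemma centered_normal_exists:
  assumes "L \<in> carrier_mat p m" "L * transpose_mat L = Q"
  shows "is_centered_normal p Q (centered_normal p Q)"
  unfolding centered_normal_def by (rule someI_ex) (use assms in \<open>auto simp: is_centered_normal_def\<close>)

text \<open>The distribution function of the maximum is continuous on \<open>[0, \<infinity>)\<close> and vanishes at 0, because
  each coordinate is either nondegenerate or constantly 0 and one is nondegenerate.  Hence the
  level \<open>1 - \<alpha>\<close> is attained, so the quantile is a genuine preimage, and the union bound places it below
  \<open>y\<close>.  Only the marginal variances enter, whatever square root represents the law.\<close>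

lemma gauss_max_quantile_le:
  assumes L: "L \<in> carrier_mat p m" "L * transpose_mat L = Q"
    and j0: "j0 < p" "Q $$ (j0, j0) > 0"
    and B: "\<And>j. j < p \<Longrightarrow> Q $$ (j, j) \<le> B" "B > 0"
    and \<alpha>: "0 < \<alpha>" "\<alpha> < 1" and y: "y \<ge> 0" and tail: "2 * real p * exp (- y\<^sup>2 / (2 * B)) < \<alpha>"
  shows "gauss_max_quantile (1 - \<alpha>) Q \<le> y"
proof -
  define \<mu> where "\<mu> = centered_normal p Q"
  have N: "is_centered_normal p Q \<mu>" unfolding \<mu>_def by (rule centered_normal_exists[OF L])
  interpret mu: prob_space \<mu> by (rule centered_normal_basics(1)[OF N])
  have [measurable_cong]: "sets \<mu> = sets (\<Pi>\<^sub>M j\<in>{..<p}. borel)" by (rule centered_normal_basics(2)[OF N])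
  have Qdim: "dim_row Q = p" using L by auto
  define \<xi>m where "\<xi>m = (\<lambda>\<xi>. linf_norm (Matrix.vec p \<xi>))"
  have comp [measurable]: "(\<lambda>\<xi>. \<xi> j) \<in> borel_measurable \<mu>" if "j < p" for j
    using measurable_component_singleton[of j "{..<p}" "\<lambda>_. borel :: real measure"] that by simp
  have le_iff: "\<xi>m \<xi> \<le> c \<longleftrightarrow> (\<forall>j<p. \<bar>\<xi> j\<bar> \<le> c)" if "c \<ge> 0" for c \<xi>
    unfolding \<xi>m_def linf_norm_le_iff[OF that] by simp
  have nonneg: "\<xi>m \<xi> \<ge> 0" for \<xi> unfolding \<xi>m_def by (rule linf_norm_nonneg)
  have [measurable]: "\<xi>m \<in> borel_measurable \<mu>"
  proof (subst borel_measurable_iff_le, rule allI)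
    fix c
    have "{\<xi> \<in> space \<mu>. \<xi>m \<xi> \<le> c} = (if c < 0 then {} else {\<xi> \<in> space \<mu>. \<forall>j\<in>{..<p}. \<bar>\<xi> j\<bar> \<le> c})"
      using le_iff[of c] nonneg by (auto simp: not_less) (meson order_trans not_less less_le_trans)
    also have "\<dots> \<in> sets \<mu>"
    proof -
      have "{\<xi> \<in> space \<mu>. \<bar>\<xi> j\<bar> \<le> c} \<in> sets \<mu>" if "j < p" for j
        using borel_measurable_le[OF borel_measurable_abs[OF comp[OF that]] borel_measurable_const[of c]] .
      then have "{\<xi> \<in> space \<mu>. \<forall>j\<in>{..<p}. \<bar>\<xi> j\<bar> \<le> c} \<in> sets \<mu>"
        by (intro sets.sets_Collect_finite_All) auto
      then show ?thesis by simp
    qed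
    finally show "{\<xi> \<in> space \<mu>. \<xi>m \<xi> \<le> c} \<in> sets \<mu>" .
  qed
  have marg: "distr \<mu> borel (\<lambda>\<xi>. \<xi> j) = gauss (sqrt (Q $$ (j, j)))" "Q $$ (j, j) \<ge> 0" if j: "j < p" for j
  proof -
    have "(\<Sum>i<p. of_bool (i = j) * f i) = f j" for f :: "nat \<Rightarrow> real"
      using j by (simp add: of_bool_def if_distrib[of "\<lambda>x. x * _"] cong: if_cong)
    then show "distr \<mu> borel (\<lambda>\<xi>. \<xi> j) = gauss (sqrt (Q $$ (j, j)))" "Q $$ (j, j) \<ge> 0"
      using centered_normal_linear[OF N, of "\<lambda>i. of_bool (i = j)"] by simp_all
  qed
  define F where "F c = gauss_max_cdf c Q" for c
  define \<rho> where "\<rho> = distr \<mu> borel \<xi>m"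
  interpret rho: real_distribution \<rho> unfolding \<rho>_def by (rule mu.real_distribution_distr) simp
  have F_eq: "F c = mu.prob {\<xi> \<in> space \<mu>. \<xi>m \<xi> \<le> c}" for c
    unfolding F_def gauss_max_cdf_def Qdim Let_def \<mu>_def \<xi>m_def ..
  have F_cdf: "F = cdf \<rho>"
    unfolding fun_eq_iff F_eq cdf_def2 \<rho>_def
    by (subst measure_distr) (auto intro!: arg_cong[where f=mu.prob])
  have F_mono: "F a \<le> F b" if "a \<le> b" for a b unfolding F_cdf using that by (rule rho.cdf_nondecreasing)
  \<comment> \<open>If the maximum equals \<open>c > 0\<close>, some coordinate equals
     \<open>c\<close> or \<open>- c\<close>; if it is 0, the nondegenerate coordinate
     vanishes.\<close>
  have atom: "rho.prob {c} = 0" if c: "c \<ge> 0" for c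
  proof -
    have "rho.prob {c} = mu.prob {\<xi> \<in> space \<mu>. \<xi>m \<xi> = c}"
      unfolding \<rho>_def by (subst measure_distr) (auto intro!: arg_cong[where f=mu.prob])
    also have "\<dots> \<le> mu.prob (\<Union>j\<in>{j. j < p \<and> (c \<noteq> 0 \<or> Q $$ (j, j) \<noteq> 0)}. {\<xi> \<in> space \<mu>. \<xi> j = c} \<union> {\<xi> \<in> space \<mu>. \<xi> j = - c})"
    proof (rule mu.finite_measure_mono)
      show "{\<xi> \<in> space \<mu>. \<xi>m \<xi> = c} \<subseteq> (\<Union>j\<in>{j. j < p \<and> (c \<noteq> 0 \<or> Q $$ (j, j) \<noteq> 0)}. {\<xi> \<in> space \<mu>. \<xi> j = c} \<union> {\<xi> \<in> space \<mu>. \<xi> j = - c})"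
      proof
        fix \<xi> assume w: "\<xi> \<in> {\<xi> \<in> space \<mu>. \<xi>m \<xi> = c}"
        show "\<xi> \<in> (\<Union>j\<in>{j. j < p \<and> (c \<noteq> 0 \<or> Q $$ (j, j) \<noteq> 0)}. {\<xi> \<in> space \<mu>. \<xi> j = c} \<union> {\<xi> \<in> space \<mu>. \<xi> j = - c})"
        proof (cases "c = 0")
          case True
          then have "\<bar>\<xi> j0\<bar> \<le> 0" using w le_iff[of 0 \<xi>] j0 by auto
          then show ?thesis using w j0 True by auto
        next
          case False
          then obtain j where "j < p" "\<bar>\<xi> j\<bar> = c"
            using w linf_norm_attained[of "Matrix.vec p \<xi>"] by (auto simp: \<xi>m_def)
          then have "\<xi> j = c \<or> \<xi> j = - c" by auto
          then show ?thesis using w False \<open>j < p\<close> by auto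
        qed
      qed
    qed (intro sets.finite_UN, auto)
    also have "\<dots> \<le> (\<Sum>j\<in>{j. j < p \<and> (c \<noteq> 0 \<or> Q $$ (j, j) \<noteq> 0)}. mu.prob ({\<xi> \<in> space \<mu>. \<xi> j = c} \<union> {\<xi> \<in> space \<mu>. \<xi> j = - c}))"
      by (rule mu.finite_measure_subadditive_finite) auto
    also have "\<dots> = 0"
    proof (rule sum.neutral, rule ballI)
      fix j assume "j \<in> {j. j < p \<and> (c \<noteq> 0 \<or> Q $$ (j, j) \<noteq> 0)}"
      then have j: "j < p" and cj: "c \<noteq> 0 \<or> Q $$ (j, j) \<noteq> 0" by auto
      have z: "mu.prob {\<xi> \<in> space \<mu>. \<xi> j = d} = 0" if "d \<noteq> 0 \<or> Q $$ (j, j) \<noteq> 0" for d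
      proof -
        have "mu.prob {\<xi> \<in> space \<mu>. \<xi> j = d} = measure (distr \<mu> borel (\<lambda>\<xi>. \<xi> j)) {d}"
          using j by (subst measure_distr) (auto intro!: arg_cong[where f=mu.prob])
        also have "\<dots> = 0"
          unfolding marg(1)[OF j] using that by (intro gauss_null_singleton) auto
        finally show ?thesis .
      qed
      have "mu.prob ({\<xi> \<in> space \<mu>. \<xi> j = c} \<union> {\<xi> \<in> space \<mu>. \<xi> j = - c})
          \<le> mu.prob {\<xi> \<in> space \<mu>. \<xi> j = c} + mu.prob {\<xi> \<in> space \<mu>. \<xi> j = - c}"
        using j by (intro measure_Un_le) auto
      also have "\<dots> = 0" using z[of c] z[of "- c"] cj by simp
      finally show "mu.prob ({\<xi> \<in> space \<mu>. \<xi> j = c} \<union> {\<xi> \<in> space \<mu>. \<xi> j = - c}) = 0"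
        by (rule order_antisym[OF _ measure_nonneg])
    qed
    finally show ?thesis using measure_nonneg[of \<rho> "{c}"] by simp
  qed
  have F0: "F 0 = 0"
  proof -
    have "F 0 = rho.prob {0}"
      unfolding F_eq \<rho>_def using nonneg
      by (subst measure_distr) (auto intro!: arg_cong[where f=mu.prob] simp: order_antisym)
    then show ?thesis using atom[of 0] by simp
  qed
  have Fy: "1 - \<alpha> < F y"
  proof -
    have "1 - F y = mu.prob {\<xi> \<in> space \<mu>. \<not> \<xi>m \<xi> \<le> y}"
      unfolding F_eq by (subst mu.prob_neg) auto
    also have "\<dots> \<le> mu.prob (\<Union>j\<in>{..<p}. {\<xi> \<in> space \<mu>. y < \<bar>\<xi> j\<bar>})"
      using le_iff[OF y] by (intro mu.finite_measure_mono sets.finite_UN) (auto simp: not_le)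
    also have "\<dots> \<le> (\<Sum>j<p. mu.prob {\<xi> \<in> space \<mu>. y < \<bar>\<xi> j\<bar>})"
      by (rule mu.finite_measure_subadditive_finite) auto
    also have "\<dots> \<le> (\<Sum>j<p. 2 * exp (- y\<^sup>2 / (2 * B)))"
    proof (rule sum_mono)
      fix j assume "j \<in> {..<p}"
      then have j: "j < p" by simp
      let ?\<tau> = "sqrt (Q $$ (j, j))"
      interpret g: real_distribution "gauss ?\<tau>" by (rule real_distribution_gauss)
      have "mu.prob {\<xi> \<in> space \<mu>. y < \<bar>\<xi> j\<bar>} = measure (distr \<mu> borel (\<lambda>\<xi>. \<xi> j)) {d. y < \<bar>d\<bar>}"
        using j by (subst measure_distr) (auto intro!: arg_cong[where f=mu.prob])
      also have "\<dots> \<le> g.prob {d. (y / sqrt B) * \<bar>?\<tau>\<bar> < \<bar>d\<bar>}"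
      proof -
        have "?\<tau> \<le> sqrt B" using B(1)[OF j] by simp
        then have "(y / sqrt B) * \<bar>?\<tau>\<bar> \<le> (y / sqrt B) * sqrt B"
          using y B marg(2)[OF j] by (intro mult_left_mono) auto
        also have "\<dots> = y" using B by simp
        finally show ?thesis unfolding marg(1)[OF j] by (intro g.finite_measure_mono) auto
      qed
      also have "\<dots> \<le> 2 * exp (- (y / sqrt B)\<^sup>2 / 2)" using y B by (intro prob_gauss_abs_gt) auto
      also have "- (y / sqrt B)\<^sup>2 / 2 = - y\<^sup>2 / (2 * B)" using B by (simp add: power_divide)
      finally show "mu.prob {\<xi> \<in> space \<mu>. y < \<bar>\<xi> j\<bar>} \<le> 2 * exp (- y\<^sup>2 / (2 * B))" .
    qed
    also have "\<dots> < \<alpha>" using tail by simp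
    finally show ?thesis by simp
  qed
  have "\<exists>q. 0 \<le> q \<and> q \<le> y \<and> F q = 1 - \<alpha>"
  proof (rule IVT)
    show "\<forall>q. 0 \<le> q \<and> q \<le> y \<longrightarrow> isCont F q"
      unfolding F_cdf rho.isCont_cdf using atom by auto
  qed (use F0 Fy \<alpha> y in auto)
  then have img: "1 - \<alpha> \<in> F ` {0..}" by (metis atLeast_iff image_eqI)
  define q where "q = gauss_max_quantile (1 - \<alpha>) Q"
  have Fq: "F q = 1 - \<alpha>"
    using f_inv_into_f[OF img] unfolding q_def gauss_max_quantile_def F_def by simp
  show ?thesis
  proof (rule ccontr)
    assume "\<not> ?thesis"
    then have "F y \<le> F q" by (intro F_mono) (simp add: q_def)
    then show False using Fq Fy by simp
  qed
qed

section \<open>From the score to rejection\<close>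

text \<open>The plug-in covariance is \<open>L L\<^sup>T\<close> for \<open>L = (Z - W \<Pi>)\<^sup>T / sqrt n\<close>, with \<open>\<Pi>\<close> the estimate, and its diagonal entries
  are the mean squares of the column residuals; this gives access to the quantile bound.\<close>

lemma tiers_rejects_if:
  fixes W Z Pt :: "real Matrix.mat" and Y t :: "real Matrix.vec" and n p :: nat
  defines "Ry \<equiv> residual W Y t" and "Rv \<equiv> (\<lambda>j. residual W (col Z j) (col Pt j))"
  assumes W: "W \<in> carrier_mat n p" and Z: "Z \<in> carrier_mat n p" and Y: "Y \<in> carrier_vec n"
    and t: "t \<in> carrier_vec p" and Pt: "Pt \<in> carrier_mat p p" and n: "n > 0"
    and pos: "\<And>j. j < p \<Longrightarrow> 0 < rms n (Rv j)" and le: "\<And>j. j < p \<Longrightarrow> (rms n (Rv j))\<^sup>2 \<le> B"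
    and Ry: "0 < rms n Ry" and j: "j < p"
    and large: "\<tau> * rms n Ry < sqrt n * (\<bar>\<Sum>i<n. Rv j i * Ry i\<bar> / n)"
    and \<tau>: "0 \<le> \<tau>" and \<alpha>: "0 < \<alpha>" "\<alpha> < 1" and tail: "2 * real p * exp (- \<tau>\<^sup>2 / (2 * B)) < \<alpha>"
  shows "tiers_rejects \<alpha> W Z Y t Pt"
proof -
  define V where "V = Z - W * Pt"
  have V: "V \<in> carrier_mat n p" using W Z Pt unfolding V_def by (intro minus_carrier_mat) auto
  have Vij: "V $$ (i, l) = Rv l i" if "i < n" "l < p" for i l
    using W Z Pt that unfolding V_def Rv_def residual_def
    by (auto simp: scalar_prod_def lessThan_atLeast0)
  have res: "vec_index (Y - W *\<^sub>v t) i = Ry i" if "i < n" for i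
    using W Y t that mult_mat_vec_index[OF W t that] unfolding Ry_def residual_def
    by (simp del: index_mult_mat_vec)
  have resc: "Y - W *\<^sub>v t \<in> carrier_vec n" by (intro minus_carrier_vec Y mult_mat_vec_carrier[OF W t])
  have sig: "sigma_hat_u W Y t = rms n Ry"
    using W resc unfolding sigma_hat_u_def l2_norm_def rms_def L2_set_def by (simp add: res del: index_mult_mat_vec index_minus_vec(1))
  have score: "vec_index (transpose_mat V *\<^sub>v (Y - W *\<^sub>v t)) l = (\<Sum>i<n. Rv l i * Ry i)" if "l < p" for l
  proof -
    have "vec_index (transpose_mat V *\<^sub>v (Y - W *\<^sub>v t)) l = (\<Sum>i<n. transpose_mat V $$ (l, i) * vec_index (Y - W *\<^sub>v t) i)"
      using V resc that by (intro mult_mat_vec_index) auto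
    also have "\<dots> = (\<Sum>i<n. Rv l i * Ry i)"
      using V that by (intro sum.cong) (auto simp: Vij res)
    finally show ?thesis .
  qed
  have "\<bar>\<Sum>i<n. Rv j i * Ry i\<bar> \<le> linf_norm (transpose_mat V *\<^sub>v (Y - W *\<^sub>v t))"
    using linf_norm_ge[of j "transpose_mat V *\<^sub>v (Y - W *\<^sub>v t)"] score[OF j] V j by simp
  moreover have "\<tau> * (sqrt n * rms n Ry) < \<bar>\<Sum>i<n. Rv j i * Ry i\<bar>"
  proof -
    have "sqrt n * (\<tau> * rms n Ry) < sqrt n * (sqrt n * (\<bar>\<Sum>i<n. Rv j i * Ry i\<bar> / n))"
      using large n by (intro mult_strict_left_mono) auto
    also have "\<dots> = \<bar>\<Sum>i<n. Rv j i * Ry i\<bar>" using n by (simp add: field_simps)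
    finally show ?thesis by (simp add: mult_ac)
  qed
  ultimately have T: "\<tau> < tiers_stat W Z Y t Pt"
    unfolding tiers_stat_def sig V_def[symmetric] using W Ry n by (simp add: pos_less_divide_eq)
  define L where "L = Matrix.mat p n (\<lambda>(l, i). Rv l i / sqrt n)"
  have L: "L \<in> carrier_mat p n" by (simp add: L_def)
  have Qd: "Q_hat W Z Pt $$ (a, b) = (\<Sum>i<n. Rv a i * Rv b i) / n" if "a < p" "b < p" for a b
    using V W that unfolding Q_hat_def Let_def V_def[symmetric] by (simp add: Vij)
  have Qc: "Q_hat W Z Pt \<in> carrier_mat p p"
    using V unfolding Q_hat_def Let_def V_def[symmetric] by simp
  have LL: "L * transpose_mat L = Q_hat W Z Pt"
  proof (rule eq_matI)
    fix a b assume "a < dim_row (Q_hat W Z Pt)" "b < dim_col (Q_hat W Z Pt)"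
    then have ab: "a < p" "b < p" using Qc by auto
    show "(L * transpose_mat L) $$ (a, b) = Q_hat W Z Pt $$ (a, b)"
      unfolding Qd[OF ab] using L ab n
      by (simp add: L_def scalar_prod_def lessThan_atLeast0 sum_divide_distrib)
  qed (use L Qc in auto)
  have diag: "Q_hat W Z Pt $$ (l, l) = (rms n (Rv l))\<^sup>2" if "l < p" for l
    unfolding Qd[OF that that] rms_square by (simp add: power2_eq_square)
  have B: "B > 0" using pos[OF j] le[OF j] by (meson less_le_trans zero_less_power)
  have "gauss_max_quantile (1 - \<alpha>) (Q_hat W Z Pt) \<le> \<tau>"
    by (rule gauss_max_quantile_le[OF L LL j _ _ B \<alpha> \<tau> tail]) (use diag pos[OF j] le j in auto)
  then show ?thesis unfolding tiers_rejects_def using T by simp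
qed

section \<open>Laws and independence in the two-sample model\<close>

lemma UNIV_group_label: "UNIV = {GA, GB}"
  by (auto intro: group_label.exhaust)

lemma finite_group_label [simp]: "finite (UNIV :: group_label set)"
  by (simp add: UNIV_group_label)

context two_sample_model
begin

definition group_lin :: "(group_label \<Rightarrow> nat \<Rightarrow> real) \<Rightarrow> group_label \<Rightarrow> nat \<Rightarrow> 'w \<Rightarrow> real" where
  "group_lin a k i \<omega> = (\<Sum>j<p. a k j * xs k i j \<omega>)"

definition noise :: "group_label \<Rightarrow> nat \<Rightarrow> 'w \<Rightarrow> real" where
  "noise k i \<omega> = ys k i \<omega> - (\<Sum>j<p. vec_index (beta k) j * xs k i j \<omega>)"

definition lin :: "(group_label \<Rightarrow> nat \<Rightarrow> real) \<Rightarrow> nat \<Rightarrow> 'w \<Rightarrow> real" where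
  "lin a i \<omega> = group_lin a GA i \<omega> + group_lin a GB i \<omega>"

text \<open>The noise of the pooled regression of \<open>Y_vec\<close>.\<close>

definition U :: "nat \<Rightarrow> 'w \<Rightarrow> real" where
  "U i \<omega> = noise GA i \<omega> + noise GB i \<omega>"

abbreviation covariate_space :: "(nat \<Rightarrow> real) measure" where
  "covariate_space \<equiv> (\<Pi>\<^sub>M j\<in>{..<p}. borel)"

lemma covariate_measurable [measurable]: "random_variable covariate_space (covariate_vec p (x k))"
proof (rule measurableI)
  fix A assume A: "A \<in> sets covariate_space"
  then have "covariate_vec p (x k) -` A \<inter> space M \<in> sets (vimage_algebra (space M) (covariate_vec p (x k)) covariate_space)"
    by (rule in_vimage_algebra)
  then show "covariate_vec p (x k) -` A \<inter> space M \<in> events" using indep_setD_ev1[OF u_indep_x] by blast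
qed (auto simp: covariate_vec_def space_PiM)

lemma x_measurable: "j < p \<Longrightarrow> random_variable borel (x k j)"
proof -
  assume j: "j < p"
  then have "(\<lambda>\<xi>. \<xi> j) \<in> borel_measurable covariate_space" by (intro measurable_component_singleton) auto
  from measurable_compose[OF covariate_measurable this]
  have "random_variable borel (\<lambda>\<omega>. covariate_vec p (x k) \<omega> j)" .
  then show ?thesis using j by (simp add: covariate_vec_def)
qed

lemma u_measurable [measurable]: "random_variable borel (u k)"
  using u_mean_zero(1) by (rule borel_measurable_integrable)

lemma obs_measurable:
  "i < n \<Longrightarrow> random_variable (obs_space p) (obs p (xs k i) (ys k i))"
  using sample_indep unfolding indep_vars_def by force

lemma pop_obs_measurable:
  "random_variable (obs_space p) (obs p (x k) (\<lambda>\<omega>. (\<Sum>j<p. vec_index (beta k) j * x k j \<omega>) + u k \<omega>))"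
proof -
  have "random_variable (obs_space p) (\<lambda>\<omega>. (covariate_vec p (x k) \<omega>, (\<Sum>j<p. vec_index (beta k) j * x k j \<omega>) + u k \<omega>))"
    unfolding obs_space_def using x_measurable by measurable
  then show ?thesis by (simp add: obs_def[abs_def])
qed

text \<open>The signal and the noise of one observation as a function of that observation, so that equality of
  laws transfers both from the population to the data jointly.\<close>

definition obs_stat :: "(group_label \<Rightarrow> nat \<Rightarrow> real) \<Rightarrow> group_label \<Rightarrow> (nat \<Rightarrow> real) \<times> real \<Rightarrow> real \<times> real" where
  "obs_stat a k z = ((\<Sum>j<p. a k j * fst z j), snd z - (\<Sum>j<p. vec_index (beta k) j * fst z j))"

lemma obs_stat_measurable [measurable]: "obs_stat a k \<in> measurable (obs_space p) (borel \<Otimes>\<^sub>M borel)"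
  unfolding obs_stat_def[abs_def] obs_space_def by measurable

lemma obs_stat_obs: "obs_stat a k (obs p (xs k i) (ys k i) \<omega>) = (group_lin a k i \<omega>, noise k i \<omega>)"
  by (simp add: obs_stat_def obs_def covariate_vec_def group_lin_def noise_def)

lemma obs_stat_pop: "obs_stat a k (obs p (x k) (\<lambda>\<omega>. (\<Sum>j<p. vec_index (beta k) j * x k j \<omega>) + u k \<omega>) \<omega>)
    = ((\<Sum>j<p. a k j * x k j \<omega>), u k \<omega>)"
  by (simp add: obs_stat_def obs_def covariate_vec_def)

lemma group_lin_noise_law:
  assumes i: "i < n"
  shows "distr M (borel \<Otimes>\<^sub>M borel) (\<lambda>\<omega>. (group_lin a k i \<omega>, noise k i \<omega>)) =
    distr M (borel \<Otimes>\<^sub>M borel) (\<lambda>\<omega>. ((\<Sum>j<p. a k j * x k j \<omega>), u k \<omega>))"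
proof -
  have "distr M (borel \<Otimes>\<^sub>M borel) (\<lambda>\<omega>. (group_lin a k i \<omega>, noise k i \<omega>)) =
      distr (distr M (obs_space p) (obs p (xs k i) (ys k i))) (borel \<Otimes>\<^sub>M borel) (obs_stat a k)"
    using obs_measurable[OF i] by (subst distr_distr) (auto simp: comp_def obs_stat_obs)
  also have "\<dots> = distr M (borel \<Otimes>\<^sub>M borel) (\<lambda>\<omega>. ((\<Sum>j<p. a k j * x k j \<omega>), u k \<omega>))"
    unfolding sample_law[OF i] using pop_obs_measurable
    by (subst distr_distr) (auto simp: comp_def obs_stat_pop)
  finally show ?thesis .
qed

lemma group_lin_noise_measurable:
  assumes i: "i < n"
  shows "random_variable borel (group_lin a k i)" "random_variable borel (noise k i)"
proof -
  have m: "random_variable (borel \<Otimes>\<^sub>M borel) (\<lambda>\<omega>. (group_lin a k i \<omega>, noise k i \<omega>))"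
    using measurable_compose[OF obs_measurable[OF i, of k] obs_stat_measurable[of a k]] by (simp add: obs_stat_obs)
  from measurable_compose[OF m measurable_fst] measurable_compose[OF m measurable_snd]
  show "random_variable borel (group_lin a k i)" "random_variable borel (noise k i)" by simp_all
qed

lemma pop_linear_law: "distr M borel (\<lambda>\<omega>. \<Sum>j<p. a j * x k j \<omega>) = gauss (sqrt (qform p (Cov k) a a))"
proof -
  have "distr M borel (\<lambda>\<omega>. \<Sum>j<p. a j * x k j \<omega>) =
      distr (distr M covariate_space (covariate_vec p (x k))) borel (\<lambda>\<xi>. \<Sum>j<p. a j * \<xi> j)"
    by (subst distr_distr) (auto simp: comp_def covariate_vec_def)
  also have "\<dots> = gauss (sqrt (qform p (Cov k) a a))"
    using centered_normal_linear(1)[OF x_normal] by (simp add: qform_def)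
  finally show ?thesis .
qed

lemma Cov_psd: "qform p (Cov k) a a \<ge> 0"
  using centered_normal_linear(2)[OF x_normal] by (simp add: qform_def)

lemma Cov_sym: "i < p \<Longrightarrow> j < p \<Longrightarrow> Cov k $$ (i, j) = Cov k $$ (j, i)"
proof -
  assume ij: "i < p" "j < p"
  obtain m L where L: "L \<in> carrier_mat p m" "L * transpose_mat L = Cov k"
    using x_normal[of k] unfolding is_centered_normal_def by blast
  show ?thesis using ij L(1) unfolding L(2)[symmetric] by (simp add: comm_scalar_prod[of _ m])
qed

lemma group_lin_law:
  assumes i: "i < n"
  shows "distr M borel (group_lin a k i) = gauss (sqrt (qform p (Cov k) (a k) (a k)))"
proof -
  have m: "random_variable (borel \<Otimes>\<^sub>M borel) (\<lambda>\<omega>. (group_lin a k i \<omega>, noise k i \<omega>))"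
    using group_lin_noise_measurable[OF i] by measurable
  have "distr M borel (group_lin a k i) = distr (distr M (borel \<Otimes>\<^sub>M borel) (\<lambda>\<omega>. (group_lin a k i \<omega>, noise k i \<omega>))) borel fst"
    using m by (subst distr_distr) (auto simp: comp_def)
  also have "\<dots> = distr M borel (\<lambda>\<omega>. \<Sum>j<p. a k j * x k j \<omega>)"
    unfolding group_lin_noise_law[OF i] using x_measurable by (subst distr_distr) (auto simp: comp_def)
  finally show ?thesis by (simp add: pop_linear_law)
qed

lemma noise_law:
  assumes i: "i < n"
  shows "distr M borel (noise k i) = distr M borel (u k)"
proof -
  have m: "random_variable (borel \<Otimes>\<^sub>M borel) (\<lambda>\<omega>. (group_lin a k i \<omega>, noise k i \<omega>))" for a
    using group_lin_noise_measurable[OF i] by measurable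
  have "distr M borel (noise k i) = distr (distr M (borel \<Otimes>\<^sub>M borel) (\<lambda>\<omega>. (group_lin (\<lambda>_ _. 0) k i \<omega>, noise k i \<omega>))) borel snd"
    using m by (subst distr_distr) (auto simp: comp_def)
  also have "\<dots> = distr M borel (u k)"
    unfolding group_lin_noise_law[OF i] using x_measurable by (subst distr_distr) (auto simp: comp_def)
  finally show ?thesis .
qed

lemma group_lin_noise_prob:
  assumes i: "i < n" and A: "A \<in> sets borel" and B: "B \<in> sets borel"
  shows "prob ((group_lin a k i -` A \<inter> space M) \<inter> (noise k i -` B \<inter> space M)) =
    prob (group_lin a k i -` A \<inter> space M) * prob (noise k i -` B \<inter> space M)"
proof -
  define X where "X \<omega> = (\<Sum>j<p. a k j * x k j \<omega>)" for \<omega>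
  have X [measurable]: "random_variable borel X" unfolding X_def using x_measurable by measurable
  have AB [measurable]: "A \<in> sets borel" "B \<in> sets borel" by (fact A B)+
  have gm [measurable]: "random_variable borel (group_lin a k i)" "random_variable borel (noise k i)"
    using group_lin_noise_measurable[OF i] .
  have d: "prob ((group_lin a k i -` A' \<inter> space M) \<inter> (noise k i -` B' \<inter> space M)) = prob ((X -` A' \<inter> space M) \<inter> (u k -` B' \<inter> space M))"
    if [measurable]: "A' \<in> sets borel" "B' \<in> sets borel" for A' B'
  proof -
    have "prob ((group_lin a k i -` A' \<inter> space M) \<inter> (noise k i -` B' \<inter> space M)) =
        measure (distr M (borel \<Otimes>\<^sub>M borel) (\<lambda>\<omega>. (group_lin a k i \<omega>, noise k i \<omega>))) (A' \<times> B')"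
      by (subst measure_distr) (auto intro!: arg_cong[where f=prob])
    also have "\<dots> = measure (distr M (borel \<Otimes>\<^sub>M borel) (\<lambda>\<omega>. (X \<omega>, u k \<omega>))) (A' \<times> B')"
      unfolding group_lin_noise_law[OF i] X_def ..
    also have "\<dots> = prob ((X -` A' \<inter> space M) \<inter> (u k -` B' \<inter> space M))"
      by (subst measure_distr) (auto intro!: arg_cong[where f=prob])
    finally show ?thesis .
  qed
  have "prob ((X -` A \<inter> space M) \<inter> (u k -` B \<inter> space M)) = prob (X -` A \<inter> space M) * prob (u k -` B \<inter> space M)"
  proof (rule indep_setD[OF u_indep_x])
    define h where "h \<xi> = (\<Sum>j<p. a k j * \<xi> j)" for \<xi> :: "nat \<Rightarrow> real"
    have [measurable]: "h \<in> borel_measurable covariate_space" unfolding h_def by measurable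
    have "X -` A \<inter> space M = covariate_vec p (x k) -` (h -` A \<inter> space covariate_space) \<inter> space M"
      by (auto simp: X_def h_def covariate_vec_def space_PiM)
    also have "\<dots> \<in> sets (vimage_algebra (space M) (covariate_vec p (x k)) covariate_space)"
      by (intro in_vimage_algebra) measurable
    finally show "X -` A \<inter> space M \<in> sets (vimage_algebra (space M) (covariate_vec p (x k)) covariate_space)" .
    show "u k -` B \<inter> space M \<in> sets (vimage_algebra (space M) (u k) borel)"
      by (intro in_vimage_algebra) measurable
  qed
  then show ?thesis
    using d[OF AB] d[of A UNIV] d[of UNIV B] by simp
qed

definition sample_family :: "(group_label \<Rightarrow> nat \<Rightarrow> real) \<Rightarrow> group_label \<times> nat \<times> bool \<Rightarrow> 'w \<Rightarrow> real" where
  "sample_family a = (\<lambda>(k, i, c). if c then group_lin a k i else noise k i)"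

text \<open>The observations are independent of each other, and within one observation the linear functional is
  independent of the noise because the population variables are.  Splitting every observation into these
  two parts gives one independent family, from which all later independence statements are obtained
  by grouping.\<close>

lemma sample_family_indep:
  assumes n: "n > 0"
  shows "indep_vars (\<lambda>_. borel) (sample_family a) (UNIV \<times> {..<n} \<times> UNIV)"
proof (subst indep_vars_finite[where E = "\<lambda>_. sets borel"])
  show "UNIV \<times> {..<n} \<times> UNIV \<noteq> ({} :: (group_label \<times> nat \<times> bool) set)" using n by auto
  show "finite (UNIV \<times> {..<n} \<times> UNIV :: (group_label \<times> nat \<times> bool) set)" by simp
  show "sets borel = sigma_sets (space borel) (sets (borel :: real measure))" by (metis sets.sigma_sets_eq)
  show "\<And>z. z \<in> UNIV \<times> {..<n} \<times> UNIV \<Longrightarrow> random_variable borel (sample_family a z)"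
    using group_lin_noise_measurable by (auto simp: sample_family_def)
  show "Int_stable (sets (borel :: real measure))" by (rule sets.Int_stable)
  show "space borel \<in> sets (borel :: real measure)" by simp
  show "sets borel \<subseteq> Pow (space (borel :: real measure))" by (rule sets.space_closed)
  let ?J = "UNIV \<times> {..<n} :: (group_label \<times> nat) set"
  show "\<forall>A\<in>UNIV \<times> {..<n} \<times> UNIV \<rightarrow> sets borel.
     prob (\<Inter>j\<in>UNIV \<times> {..<n} \<times> UNIV. sample_family a j -` A j \<inter> space M) =
     (\<Prod>j\<in>UNIV \<times> {..<n} \<times> UNIV. prob (sample_family a j -` A j \<inter> space M))"
  proof
    fix A :: "group_label \<times> nat \<times> bool \<Rightarrow> real set"
    assume "A \<in> UNIV \<times> {..<n} \<times> UNIV \<rightarrow> sets borel"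
    then have A [measurable]: "A (k, i, c) \<in> sets borel" if "i < n" for k i c using that by auto
    define Bx where "Bx z = obs_stat a (fst z) -` (A (fst z, snd z, True) \<times> A (fst z, snd z, False)) \<inter> space (obs_space p)" for z
    have Bx: "Bx z \<in> sets (obs_space p)" if "z \<in> ?J" for z
    proof -
      have "A (fst z, snd z, True) \<times> A (fst z, snd z, False) \<in> sets (borel \<Otimes>\<^sub>M borel)"
        using that by (intro pair_measureI A) auto
      then show ?thesis unfolding Bx_def by (rule measurable_sets[OF obs_stat_measurable])
    qed
    have obs_eq: "(\<lambda>(k, i). obs p (xs k i) (ys k i)) z -` Bx z \<inter> space M =
        (sample_family a (fst z, snd z, True) -` A (fst z, snd z, True) \<inter> space M) \<inter>
        (sample_family a (fst z, snd z, False) -` A (fst z, snd z, False) \<inter> space M)" if zJ: "z \<in> ?J" for z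
    proof -
      obtain k i where z: "z = (k, i)" "i < n" using zJ by (cases z) auto
      have sp: "obs p (xs k i) (ys k i) \<omega> \<in> space (obs_space p)" if "\<omega> \<in> space M" for \<omega>
        using measurable_space[OF obs_measurable[OF z(2)] that] .
      show ?thesis
      proof (rule Set.set_eqI)
        fix \<omega>
        show "\<omega> \<in> (\<lambda>(k, i). obs p (xs k i) (ys k i)) z -` Bx z \<inter> space M \<longleftrightarrow>
          \<omega> \<in> (sample_family a (fst z, snd z, True) -` A (fst z, snd z, True) \<inter> space M) \<inter>
            (sample_family a (fst z, snd z, False) -` A (fst z, snd z, False) \<inter> space M)"
          unfolding z Bx_def sample_family_def using sp[of \<omega>] by (simp add: obs_stat_obs) blast
      qed
    qed
    have "(\<Inter>j\<in>UNIV \<times> {..<n} \<times> UNIV. sample_family a j -` A j \<inter> space M) =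
        (\<Inter>z\<in>?J. (\<lambda>(k, i). obs p (xs k i) (ys k i)) z -` Bx z \<inter> space M)"
    proof -
      have "(\<Inter>j\<in>UNIV \<times> {..<n} \<times> UNIV. sample_family a j -` A j \<inter> space M) =
        (\<Inter>z\<in>?J. (sample_family a (fst z, snd z, True) -` A (fst z, snd z, True) \<inter> space M) \<inter>
        (sample_family a (fst z, snd z, False) -` A (fst z, snd z, False) \<inter> space M))"
        (is "?L = ?R")
      proof (intro equalityI subsetI)
        fix \<omega> assume w: "\<omega> \<in> ?R"
        show "\<omega> \<in> ?L"
        proof (rule INT_I)
          fix j :: "group_label \<times> nat \<times> bool" assume "j \<in> UNIV \<times> {..<n} \<times> UNIV"
          then obtain k i c where j: "j = (k, i, c)" "i < n" by auto
          then show "\<omega> \<in> sample_family a j -` A j \<inter> space M" using INT_D[OF w, of "(k, i)"] by (cases c) auto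
        qed
      next
        fix \<omega> assume w: "\<omega> \<in> ?L"
        show "\<omega> \<in> ?R"
        proof (rule INT_I)
          fix z :: "group_label \<times> nat" assume "z \<in> ?J"
          then obtain k i where z: "z = (k, i)" "i < n" by (cases z) auto
          then show "\<omega> \<in> (sample_family a (fst z, snd z, True) -` A (fst z, snd z, True) \<inter> space M) \<inter>
              (sample_family a (fst z, snd z, False) -` A (fst z, snd z, False) \<inter> space M)"
            using INT_D[OF w, of "(k, i, True)"] INT_D[OF w, of "(k, i, False)"] by simp
        qed
      qed
      also have "\<dots> = (\<Inter>z\<in>?J. (\<lambda>(k, i). obs p (xs k i) (ys k i)) z -` Bx z \<inter> space M)"
        using obs_eq by (intro INF_cong refl) auto
      finally show ?thesis .
    qed
    also have "prob \<dots> = (\<Prod>z\<in>?J. prob ((\<lambda>(k, i). obs p (xs k i) (ys k i)) z -` Bx z \<inter> space M))"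
      by (rule indep_varsD_finite[OF sample_indep]) (use n Bx in auto)
    also have "\<dots> = (\<Prod>z\<in>?J. \<Prod>c\<in>UNIV. prob (sample_family a (fst z, snd z, c) -` A (fst z, snd z, c) \<inter> space M))"
    proof (rule prod.cong[OF refl])
      fix z assume z: "z \<in> ?J"
      then obtain k i where zz: "z = (k, i)" "i < n" by (cases z) auto
      show "prob ((\<lambda>(k, i). obs p (xs k i) (ys k i)) z -` Bx z \<inter> space M) =
          (\<Prod>c\<in>UNIV. prob (sample_family a (fst z, snd z, c) -` A (fst z, snd z, c) \<inter> space M))"
        unfolding obs_eq[OF z] using group_lin_noise_prob[OF zz(2) A[OF zz(2)] A[OF zz(2)], of a k k True k False]
        by (simp add: zz(1) sample_family_def UNIV_bool)
    qed
    also have "\<dots> = (\<Prod>j\<in>UNIV \<times> {..<n} \<times> UNIV. prob (sample_family a j -` A j \<inter> space M))"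
      by (simp add: prod.cartesian_product split_def)
         (intro prod.reindex_bij_witness[where i="\<lambda>(k, i, c). ((k, i), c)" and j="\<lambda>((k, i), c). (k, i, c)"], auto)
    finally show "prob (\<Inter>j\<in>UNIV \<times> {..<n} \<times> UNIV. sample_family a j -` A j \<inter> space M) =
     (\<Prod>j\<in>UNIV \<times> {..<n} \<times> UNIV. prob (sample_family a j -` A j \<inter> space M))" .
  qed
qed

lemma lin_measurable: "i < n \<Longrightarrow> random_variable borel (lin a i)"
  and U_measurable: "i < n \<Longrightarrow> random_variable borel (U i)"
  unfolding lin_def[abs_def] U_def[abs_def] using group_lin_noise_measurable by auto

lemma noise_indep: "n > 0 \<Longrightarrow> indep_vars (\<lambda>_. borel) (noise k) {..<n}"
proof -
  assume n: "n > 0"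
  have "indep_vars (\<lambda>i. PiM {(k, i, False)} (\<lambda>_. borel)) (\<lambda>i \<omega>. restrict (\<lambda>z. sample_family (\<lambda>_ _. 0) z \<omega>) {(k, i, False)}) {..<n}"
    by (rule indep_vars_restrict[OF sample_family_indep[OF n]]) (auto simp: disjoint_family_on_def)
  then have "indep_vars (\<lambda>_. borel) (\<lambda>i \<omega>. (restrict (\<lambda>z. sample_family (\<lambda>_ _. 0) z \<omega>) {(k, i, False)}) (k, i, False)) {..<n}"
    by (rule indep_vars_compose2) (intro measurable_component_singleton, auto)
  then show ?thesis by (simp add: sample_family_def)
qed

lemma lin_indep:
  assumes n: "n > 0"
  shows "indep_vars (\<lambda>_. borel) (lin a) {..<n}"
proof -
  have "indep_vars (\<lambda>i. PiM (UNIV \<times> {i} \<times> {True}) (\<lambda>_. borel)) (\<lambda>i \<omega>. restrict (\<lambda>z. sample_family a z \<omega>) (UNIV \<times> {i} \<times> {True})) {..<n}"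
    by (rule indep_vars_restrict[OF sample_family_indep[OF n]]) (auto simp: disjoint_family_on_def)
  then have "indep_vars (\<lambda>_. borel) (\<lambda>i \<omega>. (restrict (\<lambda>z. sample_family a z \<omega>) (UNIV \<times> {i} \<times> {True})) (GA, i, True)
      + (restrict (\<lambda>z. sample_family a z \<omega>) (UNIV \<times> {i} \<times> {True})) (GB, i, True)) {..<n}"
    by (rule indep_vars_compose2) (intro borel_measurable_add measurable_component_singleton, auto)
  then show ?thesis by (simp add: sample_family_def lin_def[abs_def])
qed

lemma lin_law:
  assumes i: "i < n"
  shows "distr M borel (lin a i) = gauss (sqrt (gcov p Cov a a))"
proof -
  have n: "n > 0" using i by simp
  have "indep_vars (\<lambda>k. PiM {(k, i, True)} (\<lambda>_. borel)) (\<lambda>k \<omega>. restrict (\<lambda>z. sample_family a z \<omega>) {(k, i, True)}) UNIV"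
    by (rule indep_vars_restrict[OF sample_family_indep[OF n]]) (use i in \<open>auto simp: disjoint_family_on_def\<close>)
  then have "indep_vars (\<lambda>_. borel) (\<lambda>k \<omega>. (restrict (\<lambda>z. sample_family a z \<omega>) {(k, i, True)}) (k, i, True)) UNIV"
    by (rule indep_vars_compose2) (intro measurable_component_singleton, auto)
  then have ind: "indep_vars (\<lambda>_. borel) (\<lambda>k. group_lin a k i) UNIV" by (simp add: sample_family_def)
  have "distr M borel (\<lambda>\<omega>. \<Sum>k\<in>UNIV. group_lin a k i \<omega>) = gauss (sqrt (\<Sum>k\<in>UNIV. (sqrt (qform p (Cov k) (a k) (a k)))\<^sup>2))"
    by (rule indep_sum_gauss[OF _ ind]) (auto simp: group_lin_law[OF i])
  then show ?thesis
    by (simp add: UNIV_group_label lin_def[abs_def] gcov_def Cov_psd)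
qed

lemma lin_U_indep:
  assumes n: "n > 0"
  shows "indep_var (\<Pi>\<^sub>M i\<in>{..<n}. borel) (\<lambda>\<omega>. \<lambda>i\<in>{..<n}. lin a i \<omega>) (\<Pi>\<^sub>M i\<in>{..<n}. borel) (\<lambda>\<omega>. \<lambda>i\<in>{..<n}. U i \<omega>)"
proof -
  let ?K = "\<lambda>c. UNIV \<times> {..<n} \<times> {c} :: (group_label \<times> nat \<times> bool) set"
  define s where "s c f = (\<lambda>i\<in>{..<n}. f (GA, i, c) + f (GB, i, c))" for c and f :: "group_label \<times> nat \<times> bool \<Rightarrow> real"
  have s: "s c \<in> measurable (PiM (?K c) (\<lambda>_. borel)) (\<Pi>\<^sub>M i\<in>{..<n}. borel)" for c
    unfolding s_def by (intro measurable_restrict borel_measurable_add measurable_component_singleton) auto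
  have "indep_var (PiM (?K True) (\<lambda>_. borel)) (\<lambda>\<omega>. restrict (\<lambda>z. sample_family a z \<omega>) (?K True))
     (PiM (?K False) (\<lambda>_. borel)) (\<lambda>\<omega>. restrict (\<lambda>z. sample_family a z \<omega>) (?K False))"
    by (rule indep_var_restrict[OF sample_family_indep[OF n]]) auto
  from indep_var_compose[OF this s[of True] s[of False]]
  show ?thesis
    by (simp add: comp_def s_def sample_family_def lin_def[abs_def] U_def[abs_def] cong: restrict_cong)
qed

lemma lin_combine: "c * lin a i \<omega> + d * lin b i \<omega> = lin (\<lambda>k j. c * a k j + d * b k j) i \<omega>"
  by (simp add: lin_def group_lin_def sum.distrib distrib_right sum_distrib_left algebra_simps)

lemma gcov_combine:
  "gcov p Cov (\<lambda>k j. c * a k j + d * b k j) (\<lambda>k j. c * a k j + d * b k j) =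
    c\<^sup>2 * gcov p Cov a a + 2 * c * d * gcov p Cov a b + d\<^sup>2 * gcov p Cov b b"
proof -
  have "qform p (Cov k) b a = qform p (Cov k) a b" for k a b by (rule qform_sym[OF Cov_sym])
  from this[of GA "b GA" "a GA"] this[of GB "b GB" "a GB"] show ?thesis
    by (simp add: gcov_def qform_add_left qform_add_right qform_scale_left qform_scale_right
      power2_eq_square algebra_simps)
qed

lemma gcov_psd: "gcov p Cov a a \<ge> 0"
  using Cov_psd by (simp add: gcov_def)

lemma lin_product_concentration:
  assumes n: "n > 0" and b: "gcov p Cov a a \<le> b\<^sup>2" "gcov p Cov a' a' \<le> b'\<^sup>2" "0 < b" "0 < b'"
    and t: "0 \<le> t" "t \<le> 1"
  shows "prob {\<omega> \<in> space M. t * (b * b') < \<bar>(\<Sum>i<n. lin a i \<omega> * lin a' i \<omega>) / n - gcov p Cov a a'\<bar>}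
    \<le> 4 * exp (- real n * t\<^sup>2 / 16)"
proof (rule product_concentration[OF _ _ _ b t n])
  fix c d
  show "indep_vars (\<lambda>_. borel) (\<lambda>i \<omega>. c * lin a i \<omega> + d * lin a' i \<omega>) {..<n}"
    unfolding lin_combine using lin_indep[OF n] by simp
  show "0 \<le> c\<^sup>2 * gcov p Cov a a + 2 * c * d * gcov p Cov a a' + d\<^sup>2 * gcov p Cov a' a'"
    unfolding gcov_combine[symmetric] by (rule gcov_psd)
  fix i assume "i < n"
  then show "distr M borel (\<lambda>\<omega>. c * lin a i \<omega> + d * lin a' i \<omega>) =
      gauss (sqrt (c\<^sup>2 * gcov p Cov a a + 2 * c * d * gcov p Cov a a' + d\<^sup>2 * gcov p Cov a' a'))"
    unfolding lin_combine gcov_combine[symmetric] using lin_law by simp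
qed

lemma lin_noise_bound:
  assumes n: "n > 0" and b: "gcov p Cov a a \<le> b\<^sup>2" "0 \<le> b" and t: "0 \<le> t"
  shows "prob {\<omega> \<in> space M. t * b * sqrt (\<Sum>i<n. (U i \<omega>)\<^sup>2) < \<bar>\<Sum>i<n. lin a i \<omega> * U i \<omega>\<bar>} \<le> 2 * exp (- t\<^sup>2 / 2)"
proof (rule noise_bound[OF lin_U_indep[OF n] lin_indep[OF n] lin_law _ _ t])
  show "sqrt (gcov p Cov a a) \<le> b" using b by (intro real_le_lsqrt) auto
qed (auto simp: gcov_psd)

lemma U_bound:
  assumes n: "n > 0" and d: "\<delta> > 0" and k: "\<kappa> \<ge> 0" and L: "L > 0"
    and mom: "\<And>k. (\<integral>\<^sup>+\<omega>. ennreal (\<bar>u k \<omega>\<bar> powr (2 + \<delta>)) \<partial>M) \<le> ennreal \<kappa>"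
  shows "prob {\<omega> \<in> space M. 4 * (\<kappa> + 3) < (\<Sum>i<n. (U i \<omega>)\<^sup>2) / n} \<le> 2 * (\<kappa> * L powr (- \<delta> / 2) + exp (- 2 * real n / L\<^sup>2))"
proof -
  have [measurable]: "random_variable borel (noise k i)" if "i < n" for k i using group_lin_noise_measurable that by auto
  define E where "E k = {\<omega> \<in> space M. \<kappa> + 3 < (\<Sum>i<n. (noise k i \<omega>)\<^sup>2) / n}" for k
  have E: "E k \<in> events" for k unfolding E_def by measurable
  have PE: "prob (E k) \<le> \<kappa> * L powr (- \<delta> / 2) + exp (- 2 * real n / L\<^sup>2)" for k
    unfolding E_def
  proof (rule mean_square_bound[OF noise_indep[OF n] n d k L])
    fix i assume i: "i < n"
    have "(\<integral>\<^sup>+\<omega>. ennreal (\<bar>noise k i \<omega>\<bar> powr (2 + \<delta>)) \<partial>M) = (\<integral>\<^sup>+x. ennreal (\<bar>x\<bar> powr (2 + \<delta>)) \<partial>distr M borel (noise k i))"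
      using i by (subst nn_integral_distr) auto
    also have "\<dots> = (\<integral>\<^sup>+\<omega>. ennreal (\<bar>u k \<omega>\<bar> powr (2 + \<delta>)) \<partial>M)"
      unfolding noise_law[OF i] by (subst nn_integral_distr) auto
    finally show "(\<integral>\<^sup>+\<omega>. ennreal (\<bar>noise k i \<omega>\<bar> powr (2 + \<delta>)) \<partial>M) \<le> ennreal \<kappa>" using mom by simp
  qed
  have "prob {\<omega> \<in> space M. 4 * (\<kappa> + 3) < (\<Sum>i<n. (U i \<omega>)\<^sup>2) / n} \<le> prob (E GA \<union> E GB)"
  proof (intro finite_measure_mono subsetI)
    fix \<omega> assume w: "\<omega> \<in> {\<omega> \<in> space M. 4 * (\<kappa> + 3) < (\<Sum>i<n. (U i \<omega>)\<^sup>2) / n}"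
    have "(U i \<omega>)\<^sup>2 \<le> 2 * (noise GA i \<omega>)\<^sup>2 + 2 * (noise GB i \<omega>)\<^sup>2" for i
      using zero_le_power2[of "noise GA i \<omega> - noise GB i \<omega>"]
      by (simp add: U_def power2_eq_square algebra_simps)
    then have "(\<Sum>i<n. (U i \<omega>)\<^sup>2) \<le> (\<Sum>i<n. 2 * (noise GA i \<omega>)\<^sup>2 + 2 * (noise GB i \<omega>)\<^sup>2)"
      by (intro sum_mono)
    then have "(\<Sum>i<n. (U i \<omega>)\<^sup>2) / n \<le> 2 * ((\<Sum>i<n. (noise GA i \<omega>)\<^sup>2) / n) + 2 * ((\<Sum>i<n. (noise GB i \<omega>)\<^sup>2) / n)"
      using n by (simp add: sum.distrib sum_distrib_left[symmetric] field_simps)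
    then show "\<omega> \<in> E GA \<union> E GB" using w unfolding E_def by auto
  qed (use E in auto)
  also have "\<dots> \<le> prob (E GA) + prob (E GB)" by (intro measure_Un_le E)
  finally show ?thesis using PE[of GA] PE[of GB] by simp
qed

end

context two_sample_model
begin

definition pop_lin :: "(group_label \<Rightarrow> nat \<Rightarrow> real) \<Rightarrow> 'w \<Rightarrow> real" where
  "pop_lin a \<omega> = (\<Sum>j<p. a GA j * x GA j \<omega>) + (\<Sum>j<p. a GB j * x GB j \<omega>)"

lemma pop_measurable [measurable]: "random_variable borel (pop_lin a)"
  unfolding pop_lin_def[abs_def] using x_measurable by measurable

lemma pop_law: "distr M borel (pop_lin a) = gauss (sqrt (gcov p Cov a a))"
proof (rule gauss_eqI)
  have m: "(\<lambda>z. \<Sum>j<p. a k j * fst z j) \<in> borel_measurable (obs_space p)" for k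
    unfolding obs_space_def by measurable
  have "indep_var borel (\<lambda>\<omega>. \<Sum>j<p. a GA j * x GA j \<omega>) borel (\<lambda>\<omega>. \<Sum>j<p. a GB j * x GB j \<omega>)"
    using indep_var_compose[OF groups_indep m[of GA] m[of GB]] by (simp add: comp_def obs_def covariate_vec_def)
  note char_distr_add[OF this]
  then show "char (distr M borel (pop_lin a)) t = complex_of_real (exp (- ((sqrt (gcov p Cov a a))\<^sup>2 * t\<^sup>2) / 2))" for t
    by (simp add: pop_lin_def[abs_def] pop_linear_law char_gauss Cov_psd gcov_psd of_real_mult[symmetric] mult_exp_exp
          del: of_real_mult of_real_exp) (simp add: gcov_def field_simps)
qed (rule real_distribution_distr, measurable)

lemma gauss_second_moment:
  "integrable (gauss \<tau>) (\<lambda>x. x\<^sup>2)" "(\<integral>x. x\<^sup>2 \<partial>gauss \<tau>) = \<tau>\<^sup>2"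
  using std_normal_distribution_even_moments[of 1]
  unfolding gauss_def by (simp_all add: integrable_distr_eq integral_distr power_mult_distrib)

lemma pop_second_moment: "integrable M (\<lambda>\<omega>. (pop_lin a \<omega>)\<^sup>2)" "(\<integral>\<omega>. (pop_lin a \<omega>)\<^sup>2 \<partial>M) = gcov p Cov a a"
proof -
  have "integrable (distr M borel (pop_lin a)) (\<lambda>x. x\<^sup>2)" "(\<integral>x. x\<^sup>2 \<partial>distr M borel (pop_lin a)) = gcov p Cov a a"
    unfolding pop_law using gauss_second_moment[of "sqrt (gcov p Cov a a)"] by (auto simp: gcov_psd)
  then show "integrable M (\<lambda>\<omega>. (pop_lin a \<omega>)\<^sup>2)" "(\<integral>\<omega>. (pop_lin a \<omega>)\<^sup>2 \<partial>M) = gcov p Cov a a"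
    by (simp_all add: integrable_distr_eq integral_distr)
qed

text \<open>Polarization of the second moments.\<close>

lemma pop_covariance: "(\<integral>\<omega>. pop_lin a \<omega> * pop_lin b \<omega> \<partial>M) = gcov p Cov a b"
proof -
  let ?c = "\<lambda>d. (\<lambda>k j. 1 * a k j + d * b k j)"
  have comb: "pop_lin (?c d) \<omega> = pop_lin a \<omega> + d * pop_lin b \<omega>" for d \<omega>
    by (simp add: pop_lin_def distrib_right sum.distrib sum_distrib_left algebra_simps)
  have "pop_lin a \<omega> * pop_lin b \<omega> = ((pop_lin (?c 1) \<omega>)\<^sup>2 - (pop_lin (?c (-1)) \<omega>)\<^sup>2) / 4" for \<omega>
    unfolding comb by (simp add: power2_eq_square algebra_simps)
  then have "(\<integral>\<omega>. pop_lin a \<omega> * pop_lin b \<omega> \<partial>M) = (\<integral>\<omega>. ((pop_lin (?c 1) \<omega>)\<^sup>2 - (pop_lin (?c (-1)) \<omega>)\<^sup>2) / 4 \<partial>M)"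
    by (intro Bochner_Integration.integral_cong refl)
  also have "\<dots> = ((\<integral>\<omega>. (pop_lin (?c 1) \<omega>)\<^sup>2 \<partial>M) - (\<integral>\<omega>. (pop_lin (?c (-1)) \<omega>)\<^sup>2 \<partial>M)) / 4"
    unfolding integral_divide_zero
    by (subst Bochner_Integration.integral_diff[OF pop_second_moment(1) pop_second_moment(1)]) (rule refl)
  also have "\<dots> = gcov p Cov a b"
    unfolding pop_second_moment(2) gcov_combine by simp
  finally show ?thesis .
qed

lemma qform_unit: "i < p \<Longrightarrow> j < p \<Longrightarrow> qform p A (\<lambda>l. of_bool (l = i)) (\<lambda>l. of_bool (l = j)) = A $$ (i, j)"
  by (simp add: qform_def of_bool_def if_distrib[of "\<lambda>x. x * _"] cong: if_cong)

lemma pop_unit: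
  assumes "j < p"
  shows "pop_lin (wcoef (\<lambda>l. of_bool (l = j))) \<omega> = x GA j \<omega> + x GB j \<omega>"
    "pop_lin (zcoef (\<lambda>l. of_bool (l = j))) \<omega> = x GA j \<omega> - x GB j \<omega>"
  using assms by (simp_all add: pop_lin_def wcoef_def zcoef_def of_bool_def if_distrib[of "\<lambda>x. x * _"] if_distrib[of uminus] cong: if_cong)

lemma Pi_star_eq: "Pi_star M p x = inv_mat (Cov GA + Cov GB) * (Cov GA - Cov GB)"
proof -
  let ?e = "\<lambda>j l. of_bool (l = (j::nat)) :: real"
  have ww: "(\<integral>\<omega>. (x GA i \<omega> + x GB i \<omega>) * (x GA j \<omega> + x GB j \<omega>) \<partial>M) = Cov GA $$ (i, j) + Cov GB $$ (i, j)"
    if "i < p" "j < p" for i j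
    using pop_covariance[of "wcoef (?e i)" "wcoef (?e j)"] qform_unit[OF that]
    unfolding pop_unit[OF that(1)] pop_unit[OF that(2)] by (simp add: gcov_def wcoef_def[abs_def])
  have wz: "(\<integral>\<omega>. (x GA i \<omega> + x GB i \<omega>) * (x GA j \<omega> - x GB j \<omega>) \<partial>M) = Cov GA $$ (i, j) - Cov GB $$ (i, j)"
    if "i < p" "j < p" for i j
  proof -
    have "qform p (Cov GB) (?e i) (\<lambda>l. - ?e j l) = - Cov GB $$ (i, j)"
      using qform_scale_right[of p "Cov GB" "?e i" "-1" "?e j"] qform_unit[OF that, of "Cov GB"] by simp
    then show ?thesis
      using pop_covariance[of "wcoef (?e i)" "zcoef (?e j)"] qform_unit[OF that, of "Cov GA"]
      unfolding pop_unit[OF that(1)] pop_unit[OF that(2)] by (simp add: gcov_def wcoef_def[abs_def] zcoef_def[abs_def])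
  qed
  have "Matrix.mat p p (\<lambda>(i, j). \<integral>\<omega>. (x GA i \<omega> + x GB i \<omega>) * (x GA j \<omega> + x GB j \<omega>) \<partial>M) = Cov GA + Cov GB"
    using Cov_carrier[of GA] Cov_carrier[of GB] by (intro eq_matI) (auto simp: ww)
  moreover have "Matrix.mat p p (\<lambda>(i, j). \<integral>\<omega>. (x GA i \<omega> + x GB i \<omega>) * (x GA j \<omega> - x GB j \<omega>) \<partial>M) = Cov GA - Cov GB"
    using Cov_carrier[of GA] Cov_carrier[of GB] by (intro eq_matI) (auto simp: wz)
  ultimately show ?thesis unfolding Pi_star_def Let_def by simp
qed

end

context two_sample_model
begin

definition unit_coef :: "nat \<Rightarrow> nat \<Rightarrow> real" where
  "unit_coef j l = of_bool (l = j)"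

text \<open>A union bound over the pairs of functionals in \<open>A\<close>, the functionals in \<open>A\<close> and the size of the noise.\<close>

lemma good_event:
  fixes A :: "(group_label \<Rightarrow> nat \<Rightarrow> real) set" and b t t' \<kappa> \<delta> L :: real
  assumes n: "n > 0" and A: "finite A" and b: "b > 0" "\<And>a. a \<in> A \<Longrightarrow> gcov p Cov a a \<le> b\<^sup>2"
    and t: "0 \<le> t" "t \<le> 1" "0 \<le> t'"
    and U: "\<delta> > 0" "\<kappa> \<ge> 0" "L > 0" "\<And>k. (\<integral>\<^sup>+\<omega>. ennreal (\<bar>u k \<omega>\<bar> powr (2 + \<delta>)) \<partial>M) \<le> ennreal \<kappa>"
  obtains E where "E \<in> events"
    "prob E \<ge> 1 - (4 * (real (card A))\<^sup>2 * exp (- real n * t\<^sup>2 / 16) + 2 * real (card A) * exp (- t'\<^sup>2 / 2)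
      + 2 * (\<kappa> * L powr (- \<delta> / 2) + exp (- 2 * real n / L\<^sup>2)))"
    "\<And>\<omega> a a'. \<omega> \<in> E \<Longrightarrow> a \<in> A \<Longrightarrow> a' \<in> A \<Longrightarrow> \<bar>(\<Sum>i<n. lin a i \<omega> * lin a' i \<omega>) / n - gcov p Cov a a'\<bar> \<le> t * (b * b)"
    "\<And>\<omega> a. \<omega> \<in> E \<Longrightarrow> a \<in> A \<Longrightarrow> \<bar>\<Sum>i<n. lin a i \<omega> * U i \<omega>\<bar> \<le> t' * b * sqrt (\<Sum>i<n. (U i \<omega>)\<^sup>2)"
    "\<And>\<omega>. \<omega> \<in> E \<Longrightarrow> (\<Sum>i<n. (U i \<omega>)\<^sup>2) / n \<le> 4 * (\<kappa> + 3)"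
    "E \<subseteq> space M"
proof -
  have [measurable]: "random_variable borel (lin a i)" "random_variable borel (U i)" if "i < n" for a i
    using lin_measurable U_measurable that by auto
  define B1 where "B1 z = {\<omega> \<in> space M. t * (b * b) < \<bar>(\<Sum>i<n. lin (fst z) i \<omega> * lin (snd z) i \<omega>) / n - gcov p Cov (fst z) (snd z)\<bar>}" for z
  define B2 where "B2 a = {\<omega> \<in> space M. t' * b * sqrt (\<Sum>i<n. (U i \<omega>)\<^sup>2) < \<bar>\<Sum>i<n. lin a i \<omega> * U i \<omega>\<bar>}" for a
  define B3 where "B3 = {\<omega> \<in> space M. 4 * (\<kappa> + 3) < (\<Sum>i<n. (U i \<omega>)\<^sup>2) / n}"
  have m: "B1 z \<in> events" "B2 a \<in> events" "B3 \<in> events" for z a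
    unfolding B1_def B2_def B3_def by measurable
  define B where "B = (\<Union>z\<in>A \<times> A. B1 z) \<union> (\<Union>a\<in>A. B2 a) \<union> B3"
  have mU: "(\<Union>z\<in>A \<times> A. B1 z) \<in> events" "(\<Union>a\<in>A. B2 a) \<in> events"
    using A m by (auto intro!: sets.finite_UN)
  have mB: "B \<in> events" unfolding B_def using mU m by auto
  have p1: "prob (\<Union>z\<in>A \<times> A. B1 z) \<le> 4 * (real (card A))\<^sup>2 * exp (- real n * t\<^sup>2 / 16)"
  proof -
    have "prob (\<Union>z\<in>A \<times> A. B1 z) \<le> (\<Sum>z\<in>A \<times> A. prob (B1 z))"
      using A m by (intro finite_measure_subadditive_finite) auto
    also have "\<dots> \<le> (\<Sum>z\<in>A \<times> A. 4 * exp (- real n * t\<^sup>2 / 16))"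
      unfolding B1_def using b t n by (intro sum_mono lin_product_concentration) auto
    finally show ?thesis by (simp add: card_cartesian_product power2_eq_square mult_ac)
  qed
  have p2: "prob (\<Union>a\<in>A. B2 a) \<le> 2 * real (card A) * exp (- t'\<^sup>2 / 2)"
  proof -
    have "prob (\<Union>a\<in>A. B2 a) \<le> (\<Sum>a\<in>A. prob (B2 a))"
      using A m by (intro finite_measure_subadditive_finite) auto
    also have "\<dots> \<le> (\<Sum>a\<in>A. 2 * exp (- t'\<^sup>2 / 2))"
      unfolding B2_def using b t n by (intro sum_mono lin_noise_bound) auto
    finally show ?thesis by (simp add: mult_ac)
  qed
  have p3: "prob B3 \<le> 2 * (\<kappa> * L powr (- \<delta> / 2) + exp (- 2 * real n / L\<^sup>2))"
    unfolding B3_def by (rule U_bound[OF n U])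
  have "prob B \<le> prob (\<Union>z\<in>A \<times> A. B1 z) + prob (\<Union>a\<in>A. B2 a) + prob B3"
    unfolding B_def using measure_Un_le[of "(\<Union>z\<in>A \<times> A. B1 z) \<union> (\<Union>a\<in>A. B2 a)" M B3]
      measure_Un_le[OF mU] mU m by fastforce
  then have "prob (space M - B) \<ge> 1 - (4 * (real (card A))\<^sup>2 * exp (- real n * t\<^sup>2 / 16) + 2 * real (card A) * exp (- t'\<^sup>2 / 2)
      + 2 * (\<kappa> * L powr (- \<delta> / 2) + exp (- 2 * real n / L\<^sup>2)))"
    using p1 p2 p3 prob_compl[OF mB] by linarith
  moreover have "space M - B \<in> events" using mB by auto
  moreover have "\<bar>(\<Sum>i<n. lin a i \<omega> * lin a' i \<omega>) / n - gcov p Cov a a'\<bar> \<le> t * (b * b)"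
    if "\<omega> \<in> space M - B" "a \<in> A" "a' \<in> A" for \<omega> a a'
  proof -
    have "\<omega> \<notin> B1 (a, a')" using that unfolding B_def by blast
    then show ?thesis using that unfolding B1_def by auto
  qed
  moreover have "\<bar>\<Sum>i<n. lin a i \<omega> * U i \<omega>\<bar> \<le> t' * b * sqrt (\<Sum>i<n. (U i \<omega>)\<^sup>2)"
    if "\<omega> \<in> space M - B" "a \<in> A" for \<omega> a
  proof -
    have "\<omega> \<notin> B2 a" using that unfolding B_def by blast
    then show ?thesis using that unfolding B2_def by auto
  qed
  moreover have "(\<Sum>i<n. (U i \<omega>)\<^sup>2) / n \<le> 4 * (\<kappa> + 3)" if "\<omega> \<in> space M - B" for \<omega>
  proof -
    have "\<omega> \<notin> B3" using that unfolding B_def by blast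
    then show ?thesis using that unfolding B3_def by auto
  qed
  ultimately show thesis by (intro that[of "space M - B"]) auto
qed

lemma lin_sum: "lin (\<lambda>k l. \<Sum>j\<in>J. c j * a j k l) i \<omega> = (\<Sum>j\<in>J. c j * lin (a j) i \<omega>)"
proof -
  have "group_lin (\<lambda>k l. \<Sum>j\<in>J. c j * a j k l) k i \<omega> = (\<Sum>j\<in>J. c j * group_lin (a j) k i \<omega>)" for k
    unfolding group_lin_def sum_distrib_left sum_distrib_right by (subst sum.swap) (simp add: mult_ac)
  then show ?thesis by (simp add: lin_def distrib_left sum.distrib)
qed

lemma unit_expand: "l < p \<Longrightarrow> (\<Sum>j<p. c j * unit_coef j l) = c l"
  by (simp add: unit_coef_def of_bool_def if_distrib[of "\<lambda>x. _ * x"] cong: if_cong)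

lemma lin_cong: "(\<And>k l. l < p \<Longrightarrow> a k l = b k l) \<Longrightarrow> lin a i \<omega> = lin b i \<omega>"
  by (simp add: lin_def group_lin_def)

lemma W_entry: "i < n \<Longrightarrow> j < p \<Longrightarrow> W_mat n p xs \<omega> $$ (i, j) = lin (wcoef (unit_coef j)) i \<omega>"
  by (simp add: W_mat_def X_mat_def lin_def group_lin_def wcoef_def unit_coef_def of_bool_def if_distrib[of "\<lambda>x. x * _"] cong: if_cong)

lemma Z_entry: "i < n \<Longrightarrow> j < p \<Longrightarrow> Z_mat n p xs \<omega> $$ (i, j) = lin (zcoef (unit_coef j)) i \<omega>"
  by (simp add: Z_mat_def X_mat_def lin_def group_lin_def zcoef_def unit_coef_def of_bool_def if_distrib[of "\<lambda>x. x * _"] if_distrib[of uminus] cong: if_cong)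

lemma wcoef_expand: "lin (wcoef c) i \<omega> = (\<Sum>j<p. c j * lin (wcoef (unit_coef j)) i \<omega>)"
  unfolding lin_sum[symmetric] by (rule lin_cong) (simp add: wcoef_def unit_expand)

lemma vcoef_split: "lin (vcoef p P c) i \<omega> = lin (zcoef c) i \<omega> - lin (wcoef (\<lambda>l. \<Sum>j<p. P $$ (l, j) * c j)) i \<omega>"
  using lin_combine[of 1 "zcoef c" i \<omega> "-1" "wcoef (\<lambda>l. \<Sum>j<p. P $$ (l, j) * c j)"]
  by (simp add: vcoef_def[abs_def] wcoef_def[abs_def])

lemma vcoef_expand: "lin (vcoef p P c) i \<omega> = (\<Sum>j<p. lin (vcoef p P (unit_coef j)) i \<omega> * c j)"
proof -
  have "lin (vcoef p P c) i \<omega> = lin (\<lambda>k l. \<Sum>j<p. c j * vcoef p P (unit_coef j) k l) i \<omega>"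
  proof (rule lin_cong)
    fix k l assume l: "l < p"
    have "(\<Sum>j<p. c j * vcoef p P (unit_coef j) k l) =
        (\<Sum>j<p. c j * zcoef (unit_coef j) k l) - (\<Sum>j<p. c j * P $$ (l, j))"
    proof -
      have "(\<Sum>j'<p. P $$ (l, j') * unit_coef j j') = P $$ (l, j)" if "j < p" for j
        using that by (simp add: unit_coef_def of_bool_def if_distrib[of "\<lambda>x. _ * x"] cong: if_cong)
      then show ?thesis by (simp add: vcoef_def right_diff_distrib sum_subtractf)
    qed
    also have "(\<Sum>j<p. c j * zcoef (unit_coef j) k l) = zcoef c k l"
      using l by (cases k) (simp_all add: zcoef_def unit_expand sum_negf)
    finally show "vcoef p P c k l = (\<Sum>j<p. c j * vcoef p P (unit_coef j) k l)"
      by (simp add: vcoef_def mult.commute)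
  qed
  then show ?thesis by (simp add: lin_sum mult.commute)
qed

lemma vcoef_scale: "lin (vcoef p P (\<lambda>l. d * c l)) i \<omega> = d * lin (vcoef p P c) i \<omega>"
  unfolding vcoef_expand[of P "\<lambda>l. d * c l"] vcoef_expand[of P c] by (simp add: sum_distrib_left mult_ac)

end

section \<open>A finite-sample bound for the power\<close>

text \<open>The concentration rate is \<open>conc_const k2 * r\<close>: the first argument of the maximum comes from
  \<open>product_concentration\<close> at \<open>t = sqrt 48 r\<close>, the second from \<open>noise_bound\<close> at \<open>t = 2 sqrt (ln p)\<close>, for functionals
  of variance at most \<open>2 k2\<close>.\<close>

definition conc_const :: "real \<Rightarrow> real" where
  "conc_const k2 = max (sqrt 48 * (2 * k2)) (2 * sqrt (2 * k2))"

text \<open>With this signal-to-noise ratio the statistic exceeds \<open>4 sqrt B sqrt (ln p)\<close>, where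
  \<open>B = 4 (2 k2 + 1)\<close> bounds the diagonal of the plug-in covariance; half of that value already has
  union bound tail \<open>2 / p\<close>.\<close>

definition snr_const :: "real \<Rightarrow> real" where
  "snr_const k2 = 16 * sqrt (2 * k2 + 2) * sqrt (4 * (2 * k2 + 1))"

lemma vcoef_scale_eq: "vcoef p P (\<lambda>l. d * c l) k = (\<lambda>l. d * vcoef p P c k l)"
  by (cases k) (simp_all add: vcoef_def zcoef_def fun_eq_iff right_diff_distrib sum_distrib_left mult_ac)

lemma gcov_scale_right: "gcov p C a (vcoef p P (\<lambda>l. d * c l)) = d * gcov p C a (vcoef p P c)"
  by (simp add: gcov_def vcoef_scale_eq qform_scale_right distrib_left)

lemma gcov_scale_left: "gcov p C (vcoef p P (\<lambda>l. d * c l)) a = d * gcov p C (vcoef p P c) a"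
  by (simp add: gcov_def vcoef_scale_eq qform_scale_left distrib_left)

context two_sample_model
begin

text \<open>The functionals \<open>w\<^sub>j\<close>, \<open>v\<^sub>j\<close> and \<open>c\<^sup>T v\<close>; \<open>c\<close> will be the normalized direction of \<open>\<gamma>\<close>, which enters the
  effective noise.\<close>

definition test_coefs :: "(nat \<Rightarrow> real) \<Rightarrow> (group_label \<Rightarrow> nat \<Rightarrow> real) set" where
  "test_coefs c = (\<lambda>j. wcoef (unit_coef j)) ` {..<p} \<union>
     (\<lambda>j. vcoef p (Pi_star M p x) (unit_coef j)) ` {..<p} \<union> {vcoef p (Pi_star M p x) c}"

lemma card_test_coefs: "finite (test_coefs c)" "p > 0 \<Longrightarrow> card (test_coefs c) \<le> 3 * p"
proof -
  show "finite (test_coefs c)" by (simp add: test_coefs_def)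
  assume p: "p > 0"
  have "card (test_coefs c) \<le> card ((\<lambda>j. wcoef (unit_coef j)) ` {..<p}) + card ((\<lambda>j. vcoef p (Pi_star M p x) (unit_coef j)) ` {..<p}) + card {vcoef p (Pi_star M p x) c}"
    unfolding test_coefs_def by (intro order_trans[OF card_Un_le] add_mono) auto
  also have "\<dots> \<le> p + p + 1"
    using card_image_le[of "{..<p}"] by (intro add_mono) (auto intro: order_trans[OF card_image_le])
  finally show "card (test_coefs c) \<le> 3 * p" using p by simp
qed

lemma cov_pair_axioms:
  assumes "k1 > 0" "\<And>k ev. eigenvalue (Cov k) ev \<Longrightarrow> k1 < ev \<and> ev < k2"
  shows "cov_pair p Cov (Pi_star M p x) k1 k2"
proof
  show "Cov k \<in> carrier_mat p p" for k by (rule Cov_carrier)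
  show "Cov k $$ (i, j) = Cov k $$ (j, i)" if "i < p" "j < p" for k i j by (rule Cov_sym[OF that])
  show "k1 * (\<Sum>j<p. (y j)\<^sup>2) \<le> qform p (Cov k) y y" for k y
    by (rule rayleigh_lower[OF Cov_carrier Cov_sym]) (use assms in auto)
  show "qform p (Cov k) y y \<le> k2 * (\<Sum>j<p. (y j)\<^sup>2)" for k y
    by (rule rayleigh_upper[OF Cov_carrier Cov_sym]) (use assms in auto)
  show "k1 > 0" by (rule assms)
  show "Pi_star M p x = inv_mat (Cov GA + Cov GB) * (Cov GA - Cov GB)" by (rule Pi_star_eq)
qed

lemma sum_unit_coef: "j < p \<Longrightarrow> (\<Sum>l<p. (unit_coef j l)\<^sup>2) = 1"
  by (simp add: unit_coef_def of_bool_def if_distrib[of "\<lambda>x. x\<^sup>2"] cong: if_cong)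

lemma test_coefs_var:
  assumes "k1 > 0" "\<And>k ev. eigenvalue (Cov k) ev \<Longrightarrow> k1 < ev \<and> ev < k2" "k2 > 0"
    and c: "(\<Sum>l<p. (c l)\<^sup>2) = 1" and a: "a \<in> test_coefs c"
  shows "gcov p Cov a a \<le> (sqrt (2 * k2))\<^sup>2"
proof -
  interpret cp: cov_pair p Cov "Pi_star M p x" k1 k2 by (rule cov_pair_axioms[OF assms(1,2)])
  consider j where "j < p" "a = wcoef (unit_coef j)" | j where "j < p" "a = vcoef p (Pi_star M p x) (unit_coef j)"
    | "a = vcoef p (Pi_star M p x) c"
    using a unfolding test_coefs_def by auto
  then have "gcov p Cov a a \<le> 2 * k2"
  proof cases
    case (1 j)
    then show ?thesis using cp.gcov_w_bounds(2)[of "unit_coef j"] by (simp add: sum_unit_coef)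
  next
    case (2 j)
    then show ?thesis using cp.gcov_v_bounds(2)[of "unit_coef j"] by (simp add: sum_unit_coef)
  next
    case 3
    then show ?thesis using cp.gcov_v_bounds(2)[of c] c by simp
  qed
  then show ?thesis using assms(3) by simp
qed

text \<open>The substitution \<open>Z = W P + V\<close> in \<open>Y = W (\<beta>\<^sub>A + \<beta>\<^sub>B) / 2 + Z \<gamma> + U\<close>.\<close>

lemma Y_entry:
  assumes i: "i < n"
  shows "vec_index (Y_vec n ys \<omega>) i = (\<Sum>j<p. W_mat n p xs \<omega> $$ (i, j) *
      (vec_index (beta GA + beta GB) j / 2 + (\<Sum>l<p. P $$ (j, l) * (vec_index (beta GA - beta GB) l / 2))))
     + (lin (vcoef p P (\<lambda>l. vec_index (beta GA - beta GB) l / 2)) i \<omega> + U i \<omega>)"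
proof -
  define \<gamma> where "\<gamma> l = vec_index (beta GA - beta GB) l / 2" for l
  define s where "s l = vec_index (beta GA + beta GB) l / 2" for l
  have b: "vec_index (beta GA) l = s l + \<gamma> l" "vec_index (beta GB) l = s l - \<gamma> l" if "l < p" for l
    using that beta_carrier[of GA] beta_carrier[of GB] by (simp_all add: s_def \<gamma>_def field_simps)
  have W: "(\<Sum>j<p. W_mat n p xs \<omega> $$ (i, j) * d j) = lin (wcoef d) i \<omega>" for d
    unfolding wcoef_expand[of d] by (intro sum.cong) (auto simp: W_entry[OF i] mult.commute)
  have "vec_index (Y_vec n ys \<omega>) i = U i \<omega> + ((\<Sum>j<p. vec_index (beta GA) j * xs GA i j \<omega>) + (\<Sum>j<p. vec_index (beta GB) j * xs GB i j \<omega>))"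
    using i by (simp add: Y_vec_def U_def noise_def)
  also have "(\<Sum>j<p. vec_index (beta GA) j * xs GA i j \<omega>) + (\<Sum>j<p. vec_index (beta GB) j * xs GB i j \<omega>)
      = lin (wcoef s) i \<omega> + lin (zcoef \<gamma>) i \<omega>"
    by (simp add: b lin_def group_lin_def wcoef_def zcoef_def distrib_right left_diff_distrib sum.distrib sum_subtractf sum_negf)
  also have "lin (zcoef \<gamma>) i \<omega> = lin (vcoef p P \<gamma>) i \<omega> + lin (wcoef (\<lambda>l. \<Sum>j<p. P $$ (l, j) * \<gamma> j)) i \<omega>"
    using vcoef_split[of P \<gamma> i \<omega>] by simp
  finally show ?thesis
    unfolding distrib_left sum.distrib W s_def[symmetric] \<gamma>_def[symmetric] by (simp add: s_def[abs_def] \<gamma>_def[abs_def])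
qed

text \<open>The signal condition turns the bound of \<open>score_lower_bound\<close>, for a coordinate where
  \<open>\<Sigma>\<^sub>V \<gamma>\<close> is maximal, into a score of at least \<open>r K e / (2 b)\<close>, where \<open>e\<close> is the root mean square
  of the effective noise and \<open>e \<le> b (\<parallel>\<gamma>\<parallel>\<^sub>2 + rms U)\<close>.  Multiplied by \<open>sqrt n\<close> and divided by a residual
  scale of at most \<open>2 e\<close>, this exceeds \<open>\<tau> = 2 sqrt B sqrt (ln p)\<close>, which in turn bounds the critical value.\<close>

lemma rejects_on_good_event:
  fixes k1 k2 cU eta \<alpha> :: real and s :: nat
  defines "\<gamma> \<equiv> (1/2) \<cdot>\<^sub>v (beta GA - beta GB)"
  defines "g \<equiv> l2_norm \<gamma>" and "r \<equiv> sqrt (ln (real p) / real n)" and "P \<equiv> Pi_star M p x"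
    and "c \<equiv> conc_const k2" and "K \<equiv> snr_const k2"
  assumes k: "k1 > 0" "k2 > 0" and ev: "\<And>k ev. eigenvalue (Cov k) ev \<Longrightarrow> k1 < ev \<and> ev < k2"
    and n: "n > 0" and p: "p \<ge> 2" and g0: "\<gamma> \<noteq> 0\<^sub>v p"
    and E1: "\<And>a a'. a \<in> test_coefs (\<lambda>l. 1 / g * vec_index \<gamma> l) \<Longrightarrow> a' \<in> test_coefs (\<lambda>l. 1 / g * vec_index \<gamma> l) \<Longrightarrow>
      \<bar>(\<Sum>i<n. lin a i \<omega> * lin a' i \<omega>) / n - gcov p Cov a a'\<bar> \<le> sqrt 48 * r * (sqrt (2 * k2) * sqrt (2 * k2))"
    and E2: "\<And>a. a \<in> test_coefs (\<lambda>l. 1 / g * vec_index \<gamma> l) \<Longrightarrow>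
      \<bar>\<Sum>i<n. lin a i \<omega> * U i \<omega>\<bar> \<le> 2 * sqrt (ln (real p)) * sqrt (2 * k2) * sqrt (\<Sum>i<n. (U i \<omega>)\<^sup>2)"
    and E3: "(\<Sum>i<n. (U i \<omega>)\<^sup>2) / n \<le> cU\<^sup>2" and cU: "cU > 0"
    and s: "max_col_sparsity P \<le> s" "max_col_sparsity P * l0_norm (beta GA - beta GB) + l0_norm (beta GA + beta GB) \<le> s"
    and eta: "eta \<ge> c / sqrt (min k1 (1/2) / 2) * r"
    and small: "c * r \<le> k1 / 2" "c * r \<le> 1 / 4" "8 * real s * (c * r) \<le> 2 * k1" "32 * real s * eta\<^sup>2 / (2 * k1) \<le> 1 / 16"
      "96 * real s * eta\<^sup>2 * sqrt (2 * k2 + 1) / k1 \<le> r * K / (2 * sqrt (2 * k2 + 2))"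
    and adds: "is_adds eta (W_mat n p xs \<omega>) (Y_vec n ys \<omega>) t" "Pt \<in> carrier_mat p p"
      "\<And>j. j < p \<Longrightarrow> is_adds eta (W_mat n p xs \<omega>) (col (Z_mat n p xs \<omega>) j) (col Pt j)"
    and signal: "linf_norm (Sigma_V Cov *\<^sub>v \<gamma>) \<ge> r * ((K + c) * g + (K + c) * cU)"
    and \<alpha>: "0 < \<alpha>" "\<alpha> < 1" "2 / real p < \<alpha>"
  shows "tiers_rejects \<alpha> (W_mat n p xs \<omega>) (Z_mat n p xs \<omega>) (Y_vec n ys \<omega>) t Pt"
proof -
  interpret cp: cov_pair p Cov P k1 k2 unfolding P_def by (rule cov_pair_axioms[OF k(1) ev])
  define A where "A = test_coefs (\<lambda>l. 1 / g * vec_index \<gamma> l)"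
  define wc where "wc j = wcoef (unit_coef j)" for j
  define vc where "vc j = vcoef p P (unit_coef j)" for j
  define uc where "uc = vcoef p P (\<lambda>l. 1 / g * vec_index \<gamma> l)"
  have inA: "wc j \<in> A" "vc j \<in> A" "uc \<in> A" if "j < p" for j
    using that by (auto simp: A_def test_coefs_def wc_def vc_def uc_def P_def)
  have ucA: "uc \<in> A" using p inA[of 0] by simp
  have \<gamma>c: "\<gamma> \<in> carrier_vec p" unfolding \<gamma>_def using beta_carrier[of GA] beta_carrier[of GB] by simp
  have g2: "g\<^sup>2 = (\<Sum>l<p. (vec_index \<gamma> l)\<^sup>2)"
    unfolding g_def l2_norm_def using \<gamma>c by (simp add: sum_nonneg)
  have g: "g > 0"
  proof -
    have "(\<Sum>l<p. (vec_index \<gamma> l)\<^sup>2) \<noteq> 0"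
    proof
      assume "(\<Sum>l<p. (vec_index \<gamma> l)\<^sup>2) = 0"
      then have "\<forall>l<p. vec_index \<gamma> l = 0" by (simp add: sum_nonneg_eq_0_iff)
      then have "\<gamma> = 0\<^sub>v p" using \<gamma>c by (intro eq_vecI) auto
      then show False using g0 by simp
    qed
    moreover have "g \<ge> 0" unfolding g_def l2_norm_def by (simp add: sum_nonneg)
    ultimately show ?thesis unfolding g2[symmetric] by simp
  qed
  have lnp: "ln (real p) > 0" using p by simp
  have r: "r > 0" unfolding r_def using lnp n by simp
  have nr: "sqrt n * r = sqrt (ln (real p))" unfolding r_def using n by (simp add: real_sqrt_divide)
  have c: "c > 0" using k by (auto simp: c_def conc_const_def less_max_iff_disj)
  have K: "K > 0" using k by (simp add: K_def snr_const_def)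
  have cc: "sqrt 48 * r * (sqrt (2 * k2) * sqrt (2 * k2)) \<le> c * r"
  proof -
    have "sqrt 48 * r * (sqrt (2 * k2) * sqrt (2 * k2)) = (sqrt 48 * (2 * k2)) * r" using k by simp
    also have "\<dots> \<le> c * r" using r by (intro mult_right_mono) (auto simp: c_def conc_const_def)
    finally show ?thesis .
  qed
  have L: "\<bar>(\<Sum>i<n. lin a i \<omega> * lin a' i \<omega>) / n - gcov p Cov a a'\<bar> \<le> c * r" if "a \<in> A" "a' \<in> A" for a a'
    using E1[OF that[unfolded A_def]] cc by linarith
  define \<sigma> where "\<sigma> = rms n (\<lambda>i. U i \<omega>)"
  have LU: "\<bar>(\<Sum>i<n. lin a i \<omega> * U i \<omega>) / n\<bar> \<le> c * r * \<sigma>" if "a \<in> A" for a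
  proof -
    have "\<bar>(\<Sum>i<n. lin a i \<omega> * U i \<omega>) / n\<bar> = \<bar>\<Sum>i<n. lin a i \<omega> * U i \<omega>\<bar> / n" by simp
    also have "\<dots> \<le> (2 * sqrt (ln (real p)) * sqrt (2 * k2) * sqrt (\<Sum>i<n. (U i \<omega>)\<^sup>2)) / n"
      using E2[OF that[unfolded A_def]] by (intro divide_right_mono) auto
    also have "sqrt (\<Sum>i<n. (U i \<omega>)\<^sup>2) = sqrt n * \<sigma>" using n by (simp add: \<sigma>_def rms_def L2_set_def)
    also have "(2 * sqrt (ln (real p)) * sqrt (2 * k2) * (sqrt n * \<sigma>)) / n = (2 * sqrt (2 * k2)) * r * \<sigma>"
      unfolding nr[symmetric] using n by (simp add: field_simps)
    also have "\<dots> \<le> c * r * \<sigma>"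
      using r by (intro mult_right_mono) (auto simp: c_def conc_const_def \<sigma>_def rms_nonneg)
    finally show ?thesis .
  qed
  have \<sigma>: "\<sigma> \<le> cU" using E3 cU unfolding \<sigma>_def rms_square[symmetric] by (rule power2_le_imp_le[OF _ less_imp_le])
  have \<sigma>0: "\<sigma> \<ge> 0" by (simp add: \<sigma>_def rms_nonneg)
  define V where "V i j = lin (vc j) i \<omega>" for i j
  define v where "v i = (\<Sum>j<p. V i j * vec_index \<gamma> j)" for i
  have v_lin: "v i = lin (vcoef p P (vec_index \<gamma>)) i \<omega>" for i
    unfolding v_def V_def vc_def vcoef_expand[symmetric] ..
  have v_uc: "v i = g * lin uc i \<omega>" for i
    unfolding v_lin uc_def vcoef_scale[symmetric] using g by simp
  have gc: "gcov p Cov a (vcoef p P (vec_index \<gamma>)) = g * gcov p Cov a uc"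
       "gcov p Cov (vcoef p P (vec_index \<gamma>)) a = g * gcov p Cov uc a" for a
    unfolding uc_def gcov_scale_right[symmetric] gcov_scale_left[symmetric] using g by simp_all
  have Lv: "\<bar>(\<Sum>i<n. lin a i \<omega> * v i) / n - gcov p Cov a (vcoef p P (vec_index \<gamma>))\<bar> \<le> c * r * g" if "a \<in> A" for a
  proof -
    have "(\<Sum>i<n. lin a i \<omega> * v i) / n - gcov p Cov a (vcoef p P (vec_index \<gamma>)) =
        g * ((\<Sum>i<n. lin a i \<omega> * lin uc i \<omega>) / n - gcov p Cov a uc)"
      unfolding gc v_uc by (simp add: right_diff_distrib sum_distrib_left mult_ac)
    then show ?thesis using L[OF that ucA] g by (simp add: abs_mult mult.commute)
  qed
  define \<theta> where "\<theta> j = vec_index (beta GA + beta GB) j / 2 + (\<Sum>l<p. P $$ (j, l) * vec_index \<gamma> l)" for j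
  have \<gamma>i: "vec_index \<gamma> l = vec_index (beta GA - beta GB) l / 2" if "l < p" for l
    using that beta_carrier[of GA] beta_carrier[of GB] by (simp add: \<gamma>_def)
  define S where "S j k = Cov GA $$ (j, k) + Cov GB $$ (j, k)" for j k
  have S_gcov: "gcov p Cov (wc j) (wc l) = S j l" if "j < p" "l < p" for j l
    unfolding gcov_def wc_def wcoef_def[abs_def] S_def unit_coef_def[abs_def] using qform_unit[OF that] by simp
  define SV where "SV j = vec_index (Sigma_V Cov *\<^sub>v \<gamma>) j" for j
  have vec\<gamma>: "Matrix.vec p (vec_index \<gamma>) = \<gamma>" using \<gamma>c by auto
  have SV_gcov: "gcov p Cov (vc j) (vcoef p P (vec_index \<gamma>)) = SV j" if "j < p" for j
    unfolding vc_def cp.gcov_v_v vec\<gamma> SV_def using that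
    by (simp add: unit_coef_def of_bool_def if_distrib[of "\<lambda>x. x * _"] cong: if_cong)
  have Vuc: "V i j = lin (vc j) i \<omega>" for i j by (rule V_def)
  have Wc: "W_mat n p xs \<omega> \<in> carrier_mat n p" by (simp add: W_mat_def X_mat_def)
  have Zc: "Z_mat n p xs \<omega> \<in> carrier_mat n p" unfolding Z_mat_def X_mat_def by (intro minus_carrier_mat) simp
  have Yc: "Y_vec n ys \<omega> \<in> carrier_vec n" by (simp add: Y_vec_def)
  have We: "W_mat n p xs \<omega> $$ (i, j) = lin (wc j) i \<omega>" if "i < n" "j < p" for i j
    unfolding wc_def by (rule W_entry[OF that])
  have Zeq: "Z_mat n p xs \<omega> $$ (i, j) = (\<Sum>k<p. W_mat n p xs \<omega> $$ (i, k) * P $$ (k, j)) + V i j" if "i < n" "j < p" for i j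
  proof -
    have u: "(\<Sum>j'<p. P $$ (k, j') * unit_coef j j') = P $$ (k, j)" for k
      using that by (simp add: unit_coef_def of_bool_def if_distrib[of "\<lambda>x. _ * x"] cong: if_cong)
    have "lin (wcoef (\<lambda>k. P $$ (k, j))) i \<omega> = (\<Sum>k<p. W_mat n p xs \<omega> $$ (i, k) * P $$ (k, j))"
      unfolding wcoef_expand[of "\<lambda>k. P $$ (k, j)"] by (intro sum.cong) (auto simp: W_entry[OF that(1)])
    then show ?thesis
      using vcoef_split[of P "unit_coef j" i \<omega>] unfolding u Z_entry[OF that] V_def vc_def by simp
  qed
  have Yeq: "vec_index (Y_vec n ys \<omega>) i = (\<Sum>j<p. W_mat n p xs \<omega> $$ (i, j) * \<theta> j) + (v i + U i \<omega>)" if i: "i < n" for i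
  proof -
    have "lin (vcoef p P (\<lambda>l. vec_index (beta GA - beta GB) l / 2)) i \<omega> = v i"
      unfolding v_lin vcoef_expand[of P "vec_index \<gamma>"] vcoef_expand[of P "\<lambda>l. vec_index (beta GA - beta GB) l / 2"]
      by (intro sum.cong) (auto simp: \<gamma>i)
    moreover have "(\<Sum>l<p. P $$ (j, l) * (vec_index (beta GA - beta GB) l / 2)) = (\<Sum>l<p. P $$ (j, l) * vec_index \<gamma> l)" for j
      by (intro sum.cong) (auto simp: \<gamma>i)
    ultimately show ?thesis using Y_entry[OF i, where P=P and \<omega>=\<omega>] unfolding \<theta>_def by (simp only:)
  qed
  have pd: "2 * k1 * (\<Sum>j<p. (y j)\<^sup>2) \<le> (\<Sum>j<p. y j * (\<Sum>k<p. y k * S j k))" for y :: "nat \<Rightarrow> real"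
  proof -
    have "gcov p Cov (wcoef y) (wcoef y) = (\<Sum>j<p. y j * (\<Sum>k<p. y k * S j k))"
      by (simp add: gcov_def wcoef_def[abs_def] qform_def S_def distrib_left sum.distrib)
    then show ?thesis using cp.gcov_w_bounds(1)[of y] by simp
  qed
  have sumW: "(\<Sum>i<n. W_mat n p xs \<omega> $$ (i, j) * f i) = (\<Sum>i<n. lin (wc j) i \<omega> * f i)" if "j < p" for j and f :: "nat \<Rightarrow> real"
    by (intro sum.cong) (auto simp: We that)
  have WW: "\<bar>(\<Sum>i<n. W_mat n p xs \<omega> $$ (i, j) * W_mat n p xs \<omega> $$ (i, k)) / n - S j k\<bar> \<le> c * r" if "j < p" "k < p" for j k
  proof -
    have "(\<Sum>i<n. W_mat n p xs \<omega> $$ (i, j) * W_mat n p xs \<omega> $$ (i, k)) = (\<Sum>i<n. lin (wc j) i \<omega> * lin (wc k) i \<omega>)"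
      by (intro sum.cong) (auto simp: We that)
    then show ?thesis using L[OF inA(1)[OF that(1)] inA(1)[OF that(2)]] S_gcov[OF that] by simp
  qed
  have WV: "\<bar>(\<Sum>i<n. W_mat n p xs \<omega> $$ (i, j) * V i k) / n\<bar> \<le> c * r" if "j < p" "k < p" for j k
    using L[OF inA(1)[OF that(1)] inA(2)[OF that(2)]] cp.gcov_w_v unfolding sumW[OF that(1)] V_def
    by (simp add: wc_def vc_def)
  have VV: "\<bar>(\<Sum>i<n. (V i j)\<^sup>2) / n - gcov p Cov (vc j) (vc j)\<bar> \<le> c * r" if "j < p" for j
    using L[OF inA(2)[OF that] inA(2)[OF that]] unfolding V_def power2_eq_square .
  have q: "2 * k1 \<le> gcov p Cov (vc j) (vc j)" "gcov p Cov (vc j) (vc j) \<le> 2 * k2" if "j < p" for j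
    using cp.gcov_v_bounds[of "unit_coef j"] sum_unit_coef[OF that] unfolding vc_def by simp_all
  have Wv: "\<bar>(\<Sum>i<n. W_mat n p xs \<omega> $$ (i, j) * v i) / n\<bar> \<le> c * r * g" if "j < p" for j
    using Lv[OF inA(1)[OF that]] cp.gcov_w_v unfolding sumW[OF that] by (simp add: wc_def)
  have Vv: "\<bar>(\<Sum>i<n. V i j * v i) / n - SV j\<bar> \<le> c * r * g" if "j < p" for j
    using Lv[OF inA(2)[OF that]] unfolding SV_gcov[OF that] V_def .
  have vv: "\<bar>(\<Sum>i<n. (v i)\<^sup>2) / n - gcov p Cov (vcoef p P (vec_index \<gamma>)) (vcoef p P (vec_index \<gamma>))\<bar> \<le> c * r * g\<^sup>2"
  proof -
    have "(\<Sum>i<n. (v i)\<^sup>2) / n - gcov p Cov (vcoef p P (vec_index \<gamma>)) (vcoef p P (vec_index \<gamma>)) =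
        g\<^sup>2 * ((\<Sum>i<n. lin uc i \<omega> * lin uc i \<omega>) / n - gcov p Cov uc uc)"
      unfolding gc v_uc by (simp add: right_diff_distrib sum_distrib_left power2_eq_square mult_ac)
    then show ?thesis using L[OF ucA ucA] g by (simp add: abs_mult mult.commute)
  qed
  have q0: "2 * k1 * g\<^sup>2 \<le> gcov p Cov (vcoef p P (vec_index \<gamma>)) (vcoef p P (vec_index \<gamma>))"
      "gcov p Cov (vcoef p P (vec_index \<gamma>)) (vcoef p P (vec_index \<gamma>)) \<le> 2 * k2 * g\<^sup>2"
    using cp.gcov_v_bounds[of "vec_index \<gamma>"] unfolding g2 by simp_all
  have Wu: "\<bar>(\<Sum>i<n. W_mat n p xs \<omega> $$ (i, j) * U i \<omega>) / n\<bar> \<le> c * r * rms n (\<lambda>i. U i \<omega>)" if "j < p" for j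
    using LU[OF inA(1)[OF that]] unfolding sumW[OF that] \<sigma>_def .
  have Vu: "\<bar>(\<Sum>i<n. V i j * U i \<omega>) / n\<bar> \<le> c * r * rms n (\<lambda>i. U i \<omega>)" if "j < p" for j
    using LU[OF inA(2)[OF that]] unfolding V_def \<sigma>_def .
  have vu: "\<bar>(\<Sum>i<n. v i * U i \<omega>) / n\<bar> \<le> c * r * g * rms n (\<lambda>i. U i \<omega>)"
  proof -
    have "(\<Sum>i<n. v i * U i \<omega>) / n = g * ((\<Sum>i<n. lin uc i \<omega> * U i \<omega>) / n)"
      unfolding v_uc by (simp add: sum_distrib_left mult_ac)
    then have "\<bar>(\<Sum>i<n. v i * U i \<omega>) / n\<bar> = g * \<bar>(\<Sum>i<n. lin uc i \<omega> * U i \<omega>) / n\<bar>" using g by (simp only: abs_mult)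
    also have "\<dots> \<le> g * (c * r * \<sigma>)" using LU[OF ucA] g by (intro mult_left_mono) auto
    finally show ?thesis by (simp add: \<sigma>_def mult_ac)
  qed
  have Pc: "P \<in> carrier_mat p p" by (rule cp.P_carrier)
  have sP: "card {k. k < p \<and> P $$ (k, j) \<noteq> 0} \<le> s" if "j < p" for j
    using max_col_sparsity_ge[of j P] Pc that s(1) by simp
  have s\<theta>: "card {j. j < p \<and> \<theta> j \<noteq> 0} \<le> s"
  proof -
    have "card {j. j < p \<and> \<theta> j \<noteq> 0} \<le> max_col_sparsity P * card {j. j < p \<and> vec_index \<gamma> j \<noteq> 0}
        + card {l. l < p \<and> vec_index (beta GA + beta GB) l / 2 \<noteq> 0}"
      unfolding \<theta>_def by (rule support_of_combination[OF Pc])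
    also have "{j. j < p \<and> vec_index \<gamma> j \<noteq> 0} = {i. i < dim_vec (beta GA - beta GB) \<and> vec_index (beta GA - beta GB) i \<noteq> 0}"
      using beta_carrier[of GB] by (auto simp: \<gamma>i)
    also have "{l. l < p \<and> vec_index (beta GA + beta GB) l / 2 \<noteq> 0} = {i. i < dim_vec (beta GA + beta GB) \<and> vec_index (beta GA + beta GB) i \<noteq> 0}"
      using beta_carrier[of GB] by auto
    finally show ?thesis using s(2) unfolding l0_norm_def by linarith
  qed
  note SLB = score_lower_bound[where W="W_mat n p xs \<omega>" and Z="Z_mat n p xs \<omega>" and Y="Y_vec n ys \<omega>" and n=n and p=p
      and P=P and V=V and \<theta>=\<theta> and \<gamma>="vec_index \<gamma>" and u="\<lambda>i. U i \<omega>" and S=S and c=c and r=r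
      and q="\<lambda>j. gcov p Cov (vc j) (vc j)" and g=g and SV=SV
      and s=s and eta=eta and t=t and Pt=Pt, folded v_def,
      OF Wc Zc Yc n Zeq Yeq pd WW WV VV q(1) q(2) Wv Vv vv q0(1) q0(2) Wu Vu vu sP s\<theta> k(1) k(2) c r g eta
        small(1) small(2) small(3) small(4) adds(1) adds(3) adds(2)]
  define Ry where "Ry = residual (W_mat n p xs \<omega>) (Y_vec n ys \<omega>) t"
  define Rv where "Rv j = residual (W_mat n p xs \<omega>) (col (Z_mat n p xs \<omega>) j) (col Pt j)" for j
  define e where "e = rms n (\<lambda>i. v i + U i \<omega>)"
  have tc: "t \<in> carrier_vec p" by (rule SLB(1))
  have e0: "0 < e" unfolding e_def by (rule SLB(2))
  have e_up: "e \<le> sqrt (2 * k2 + 2) * (g + \<sigma>)" unfolding e_def \<sigma>_def by (rule SLB(3))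
  have Ry1: "e / 2 \<le> rms n Ry" unfolding e_def Ry_def by (rule SLB(4))
  have Ry2: "rms n Ry \<le> 2 * e" unfolding e_def Ry_def by (rule SLB(5))
  have Rv1: "0 < rms n (Rv j)" if "j < p" for j unfolding Rv_def by (rule SLB(6); (assumption | rule that))
  have Rv2: "(rms n (Rv j))\<^sup>2 \<le> 4 * (2 * k2 + 1)" if "j < p" for j unfolding Rv_def by (rule SLB(7); (assumption | rule that))
  have score: "\<bar>SV j\<bar> - c * r * (g + \<sigma>) - 96 * real s * eta\<^sup>2 * sqrt (2 * k2 + 1) / k1 * e \<le> \<bar>\<Sum>i<n. Rv j i * Ry i\<bar> / n"
    if "j < p" for j
    unfolding Rv_def Ry_def e_def \<sigma>_def by (rule SLB(8); (assumption | rule that))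
  define b where "b = sqrt (2 * k2 + 2)"
  define B where "B = 4 * (2 * k2 + 1)"
  have b: "b > 0" and B: "B > 0" using k by (auto simp: b_def B_def)
  have K_eq: "K = 16 * b * sqrt B" by (simp add: K_def snr_const_def b_def B_def)
  have sig_pos: "0 < r * ((K + c) * g + (K + c) * cU)" using r K c g cU by (intro mult_pos_pos add_pos_pos) auto
  have dimSV: "dim_vec (Sigma_V Cov *\<^sub>v \<gamma>) = p"
    unfolding cp.Sigma_V_mult[OF \<gamma>c] using Cov_carrier[of GA] by simp
  obtain j where j: "j < p" and SVj: "\<bar>SV j\<bar> = linf_norm (Sigma_V Cov *\<^sub>v \<gamma>)"
    using linf_norm_attained[of "Sigma_V Cov *\<^sub>v \<gamma>"] signal sig_pos unfolding dimSV SV_def by force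
  have "(K + c) * \<sigma> \<le> (K + c) * cU" using \<sigma> K c by (intro mult_left_mono) auto
  then have "r * ((K + c) * g + (K + c) * \<sigma>) \<le> r * ((K + c) * g + (K + c) * cU)"
    using r \<sigma> K c by (intro mult_left_mono add_left_mono) auto
  then have "r * ((K + c) * (g + \<sigma>)) \<le> \<bar>SV j\<bar>" using signal SVj by (simp add: distrib_left)
  then have X: "r * K * (g + \<sigma>) \<le> \<bar>SV j\<bar> - c * r * (g + \<sigma>)" by (simp add: algebra_simps)
  have "e \<le> (g + \<sigma>) * b" using e_up unfolding b_def by (simp only: mult.commute)
  then have "e / b \<le> g + \<sigma>" using b by (simp only: pos_divide_le_eq)
  then have "r * K * (e / b) \<le> r * K * (g + \<sigma>)" using r K by (intro mult_left_mono) auto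
  moreover have "96 * real s * eta\<^sup>2 * sqrt (2 * k2 + 1) / k1 * e \<le> r * K / (2 * b) * e"
    using small(5) e0 unfolding b_def by (intro mult_right_mono) auto
  moreover have "r * K * (e / b) - r * K / (2 * b) * e = r * K / (2 * b) * e" using b by (simp add: field_simps)
  ultimately have low: "r * K / (2 * b) * e \<le> \<bar>\<Sum>i<n. Rv j i * Ry i\<bar> / n" using X score[OF j] by linarith
  define \<tau> where "\<tau> = 2 * sqrt B * sqrt (ln (real p))"
  have "\<tau> * rms n Ry \<le> \<tau> * (2 * e)" using Ry2 B lnp unfolding \<tau>_def by (intro mult_left_mono) auto
  also have "\<dots> < 8 * sqrt B * sqrt (ln (real p)) * e"
    unfolding \<tau>_def using B lnp e0 by simp
  also have "\<dots> = sqrt n * (r * K / (2 * b) * e)"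
    unfolding K_eq nr[symmetric] using b by (simp add: field_simps)
  also have "\<dots> \<le> sqrt n * (\<bar>\<Sum>i<n. Rv j i * Ry i\<bar> / n)" using low by (intro mult_left_mono) auto
  finally have large: "\<tau> * rms n Ry < sqrt n * (\<bar>\<Sum>i<n. Rv j i * Ry i\<bar> / n)" .
  have "- \<tau>\<^sup>2 / (2 * B) = - 2 * ln (real p)" using B lnp by (simp add: \<tau>_def power_mult_distrib)
  then have "2 * real p * exp (- \<tau>\<^sup>2 / (2 * B)) = 2 * real p * exp (- ln (real p)) * exp (- ln (real p))"
    by (simp add: mult_exp_exp mult.assoc)
  also have "\<dots> = 2 / real p" using p by (simp add: exp_minus field_simps)
  finally have tail: "2 * real p * exp (- \<tau>\<^sup>2 / (2 * B)) < \<alpha>" using \<alpha>(3) by simp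
  have \<tau>0: "0 \<le> \<tau>" using B lnp by (simp add: \<tau>_def)
  have Ry0: "0 < rms n Ry" using Ry1 e0 by simp
  show ?thesis
    by (rule tiers_rejects_if[OF Wc Zc Yc tc adds(2) n _ _ _ j _ \<tau>0 \<alpha>(1) \<alpha>(2) tail])
       (use Rv1 Rv2 Ry0 large in \<open>auto simp: Rv_def Ry_def B_def\<close>)
qed

text \<open>The exceptional null set of the estimators is removed from the good event; what is left is a
  measurable subset of the rejection region, as inner probability requires.\<close>

lemma power_lower_bound:
  fixes k1 k2 k3 \<delta> eta \<alpha> :: real and s :: nat and t :: "'w \<Rightarrow> real Matrix.vec" and Pt :: "'w \<Rightarrow> real Matrix.mat"
  defines "\<gamma> \<equiv> (1/2) \<cdot>\<^sub>v (beta GA - beta GB)"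
  defines "g \<equiv> l2_norm \<gamma>" and "r \<equiv> sqrt (ln (real p) / real n)" and "P \<equiv> Pi_star M p x"
    and "c \<equiv> conc_const k2" and "K \<equiv> snr_const k2"
  assumes k: "k1 > 0" "k2 > 0" "k3 > 0" "\<delta> > 0" and ev: "\<And>k ev. eigenvalue (Cov k) ev \<Longrightarrow> k1 < ev \<and> ev < k2"
    and mom: "\<And>k. (\<integral>\<^sup>+\<omega>. ennreal (\<bar>u k \<omega>\<bar> powr (2 + \<delta>)) \<partial>M) \<le> ennreal k3"
    and n: "n > 0" and p: "p \<ge> 2" and g0: "\<gamma> \<noteq> 0\<^sub>v p"
    and s: "max_col_sparsity P \<le> s" "max_col_sparsity P * l0_norm (beta GA - beta GB) + l0_norm (beta GA + beta GB) \<le> s"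
    and eta: "eta \<ge> c / sqrt (min k1 (1/2) / 2) * r"
    and small: "c * r \<le> k1 / 2" "c * r \<le> 1 / 4" "8 * real s * (c * r) \<le> 2 * k1" "32 * real s * eta\<^sup>2 / (2 * k1) \<le> 1 / 16"
      "96 * real s * eta\<^sup>2 * sqrt (2 * k2 + 1) / k1 \<le> r * K / (2 * sqrt (2 * k2 + 2))" "sqrt 48 * r \<le> 1"
    and adds: "AE \<omega> in M. is_adds eta (W_mat n p xs \<omega>) (Y_vec n ys \<omega>) (t \<omega>) \<and> Pt \<omega> \<in> carrier_mat p p \<and>
      (\<forall>j<p. is_adds eta (W_mat n p xs \<omega>) (col (Z_mat n p xs \<omega>) j) (col (Pt \<omega>) j))"
    and signal: "linf_norm (Sigma_V Cov *\<^sub>v \<gamma>) \<ge> r * ((K + c) * g + (K + c) * (2 * sqrt (k3 + 3)))"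
    and \<alpha>: "0 < \<alpha>" "\<alpha> < 1" "2 / real p < \<alpha>"
  shows "1 - (42 / real p + 2 * (k3 * (real n powr (1/4)) powr (- \<delta> / 2) + exp (- 2 * real n / (real n powr (1/4))\<^sup>2)))
    \<le> inner_prob M {\<omega> \<in> space M. tiers_rejects \<alpha> (W_mat n p xs \<omega>) (Z_mat n p xs \<omega>) (Y_vec n ys \<omega>) (t \<omega>) (Pt \<omega>)}"
proof -
  let ?c = "\<lambda>l. 1 / g * vec_index \<gamma> l"
  let ?L = "real n powr (1/4)"
  have lnp: "ln (real p) > 0" using p by simp
  have r: "r > 0" unfolding r_def using lnp n by simp
  have r2: "r\<^sup>2 = ln (real p) / n" unfolding r_def using lnp n by simp
  have \<gamma>c: "\<gamma> \<in> carrier_vec p" unfolding \<gamma>_def using beta_carrier[of GA] beta_carrier[of GB] by simp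
  have g2: "g\<^sup>2 = (\<Sum>l<p. (vec_index \<gamma> l)\<^sup>2)"
    unfolding g_def l2_norm_def using \<gamma>c by (simp add: sum_nonneg)
  have gne: "g \<noteq> 0"
  proof
    assume "g = 0"
    then have "(\<Sum>l<p. (vec_index \<gamma> l)\<^sup>2) = 0" using g2 by simp
    then have "\<forall>l<p. vec_index \<gamma> l = 0" by (simp add: sum_nonneg_eq_0_iff)
    then have "\<gamma> = 0\<^sub>v p" using \<gamma>c by (intro eq_vecI) auto
    then show False using g0 by simp
  qed
  have cn: "(\<Sum>l<p. (?c l)\<^sup>2) = 1"
  proof -
    have "(\<Sum>l<p. (?c l)\<^sup>2) = (1 / g)\<^sup>2 * g\<^sup>2" unfolding g2 by (simp only: power_mult_distrib sum_distrib_left)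
    then show ?thesis using gne by (simp add: power_divide)
  qed
  have var: "gcov p Cov a a \<le> (sqrt (2 * k2))\<^sup>2" if "a \<in> test_coefs ?c" for a
    by (rule test_coefs_var[OF k(1) ev k(2) cn that])
  have b0: "sqrt (2 * k2) > 0" and t0: "0 \<le> sqrt 48 * r" and t0': "0 \<le> 2 * sqrt (ln (real p))" and L0: "?L > 0" and k30: "0 \<le> k3"
    using k r lnp n by auto
  obtain E where E: "E \<in> events"
    "prob E \<ge> 1 - (4 * (real (card (test_coefs ?c)))\<^sup>2 * exp (- real n * (sqrt 48 * r)\<^sup>2 / 16)
      + 2 * real (card (test_coefs ?c)) * exp (- (2 * sqrt (ln (real p)))\<^sup>2 / 2)
      + 2 * (k3 * ?L powr (- \<delta> / 2) + exp (- 2 * real n / ?L\<^sup>2)))"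
    "\<And>\<omega> a a'. \<omega> \<in> E \<Longrightarrow> a \<in> test_coefs ?c \<Longrightarrow> a' \<in> test_coefs ?c \<Longrightarrow>
      \<bar>(\<Sum>i<n. lin a i \<omega> * lin a' i \<omega>) / n - gcov p Cov a a'\<bar> \<le> sqrt 48 * r * (sqrt (2 * k2) * sqrt (2 * k2))"
    "\<And>\<omega> a. \<omega> \<in> E \<Longrightarrow> a \<in> test_coefs ?c \<Longrightarrow>
      \<bar>\<Sum>i<n. lin a i \<omega> * U i \<omega>\<bar> \<le> 2 * sqrt (ln (real p)) * sqrt (2 * k2) * sqrt (\<Sum>i<n. (U i \<omega>)\<^sup>2)"
    "\<And>\<omega>. \<omega> \<in> E \<Longrightarrow> (\<Sum>i<n. (U i \<omega>)\<^sup>2) / n \<le> 4 * (k3 + 3)"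
    "E \<subseteq> space M"
    using good_event[OF n card_test_coefs(1) b0 var t0 small(6) t0' k(4) k30 L0 mom] by blast
  have card3: "real (card (test_coefs ?c)) \<le> 3 * real p" using card_test_coefs(2)[of ?c] p by linarith
  \<comment> \<open>The constant 48 makes the exponential equal to \<open>p\<^sup>-\<^sup>3\<close>,
     which beats the number \<open>9 p\<^sup>2\<close> of pairs.\<close>
  have e1: "4 * (real (card (test_coefs ?c)))\<^sup>2 * exp (- real n * (sqrt 48 * r)\<^sup>2 / 16) \<le> 36 / real p"
  proof -
    have ee: "- real n * (sqrt 48 * r)\<^sup>2 / 16 = - ln (real p) + (- ln (real p) + - ln (real p))"
      using n by (simp add: power_mult_distrib r2)
    have "exp (- real n * (sqrt 48 * r)\<^sup>2 / 16) = 1 / real p * (1 / real p * (1 / real p))"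
      unfolding ee exp_add using p by (simp add: exp_minus inverse_eq_divide)
    then have "4 * (real (card (test_coefs ?c)))\<^sup>2 * exp (- real n * (sqrt 48 * r)\<^sup>2 / 16)
        \<le> 4 * (3 * real p)\<^sup>2 * (1 / real p * (1 / real p * (1 / real p)))"
      using card3 by (simp only:) (intro mult_right_mono mult_left_mono power_mono, auto)
    also have "\<dots> = 36 / real p" using p by (simp add: power2_eq_square)
    finally show ?thesis .
  qed
  have e2: "2 * real (card (test_coefs ?c)) * exp (- (2 * sqrt (ln (real p)))\<^sup>2 / 2) \<le> 6 / real p"
  proof -
    have ee: "- (2 * sqrt (ln (real p)))\<^sup>2 / 2 = - ln (real p) + - ln (real p)"
      using lnp by (simp add: power_mult_distrib)
    have "exp (- (2 * sqrt (ln (real p)))\<^sup>2 / 2) = 1 / real p * (1 / real p)"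
      unfolding ee exp_add using p by (simp add: exp_minus inverse_eq_divide)
    then have "2 * real (card (test_coefs ?c)) * exp (- (2 * sqrt (ln (real p)))\<^sup>2 / 2) \<le> 2 * (3 * real p) * (1 / real p * (1 / real p))"
      using card3 by (simp only:) (intro mult_right_mono mult_left_mono, auto)
    also have "\<dots> = 6 / real p" using p by simp
    finally show ?thesis .
  qed
  obtain N where N: "N \<in> null_sets M" and adN: "\<And>\<omega>. \<omega> \<in> space M - N \<Longrightarrow>
      is_adds eta (W_mat n p xs \<omega>) (Y_vec n ys \<omega>) (t \<omega>) \<and> Pt \<omega> \<in> carrier_mat p p \<and>
      (\<forall>j<p. is_adds eta (W_mat n p xs \<omega>) (col (Z_mat n p xs \<omega>) j) (col (Pt \<omega>) j))"
    using AE_E3[OF adds] by blast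
  define S where "S = {\<omega> \<in> space M. tiers_rejects \<alpha> (W_mat n p xs \<omega>) (Z_mat n p xs \<omega>) (Y_vec n ys \<omega>) (t \<omega>) (Pt \<omega>)}"
  have sub: "E - N \<subseteq> S"
  proof
    fix \<omega> assume w: "\<omega> \<in> E - N"
    then have wE: "\<omega> \<in> E" and ws: "\<omega> \<in> space M - N" using E(6) by auto
    have cU: "(\<Sum>i<n. (U i \<omega>)\<^sup>2) / n \<le> (2 * sqrt (k3 + 3))\<^sup>2" "2 * sqrt (k3 + 3) > 0"
      using E(5)[OF wE] k by (simp_all add: power_mult_distrib)
    have "tiers_rejects \<alpha> (W_mat n p xs \<omega>) (Z_mat n p xs \<omega>) (Y_vec n ys \<omega>) (t \<omega>) (Pt \<omega>)"
      using adN[OF ws]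
      by (intro rejects_on_good_event[where ?k1.0=k1 and ?k2.0=k2 and s=s and eta=eta and cU="2 * sqrt (k3 + 3)",
            OF k(1,2) ev n p g0[unfolded \<gamma>_def] E(3)[OF wE, unfolded g_def \<gamma>_def r_def] E(4)[OF wE, unfolded g_def \<gamma>_def] cU
              s[unfolded P_def] eta[unfolded c_def r_def] small(1-5)[unfolded c_def r_def K_def] _ _ _
              signal[unfolded \<gamma>_def g_def r_def K_def c_def] \<alpha>]) auto
    then show "\<omega> \<in> S" using ws by (simp add: S_def)
  qed
  have EN: "E - N \<in> events" using E(1) N by auto
  have "prob E = prob (E - N)" using measure_Diff_null_set[OF E(1) N] by simp
  also have "\<dots> \<le> inner_prob M S"
    unfolding inner_prob_def using EN sub by (intro cSUP_upper bdd_aboveI[of _ 1]) auto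
  finally show ?thesis using E(2) e1 e2 unfolding S_def by linarith
qed

end

section \<open>Asymptotics\<close>

lemma noise_failure_tendsto_0:
  assumes "\<delta> > 0"
  shows "(\<lambda>n. 2 * (\<kappa> * (real n powr (1/4)) powr (- \<delta> / 2) + exp (- 2 * real n / (real n powr (1/4))\<^sup>2))) \<longlonglongrightarrow> 0"
proof -
  have inf: "filterlim (\<lambda>n. real n powr a) at_top sequentially" if "a > 0" for a
    using that by real_asymp
  have "(\<lambda>n. (real n powr (1/4)) powr (- \<delta> / 2)) \<longlonglongrightarrow> 0"
    using assms by (intro tendsto_neg_powr inf) auto
  moreover have "(\<lambda>n. exp (- 2 * real n / (real n powr (1/4))\<^sup>2)) \<longlonglongrightarrow> 0"
  proof -
    have "filterlim (\<lambda>n. - (2 * real n powr (1/2))) at_bot sequentially"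
      unfolding filterlim_uminus_at_bot
      by (simp, rule filterlim_tendsto_pos_mult_at_top[OF tendsto_const _ inf]) auto
    then have "(\<lambda>n. exp (- (2 * real n powr (1/2)))) \<longlonglongrightarrow> 0"
      by (rule filterlim_compose[OF exp_at_bot])
    moreover have "\<forall>\<^sub>F n in sequentially. exp (- (2 * real n powr (1/2))) = exp (- 2 * real n / (real n powr (1/4))\<^sup>2)"
      using eventually_gt_at_top[of 0]
    proof eventually_elim
      case (elim n)
      have "real n = real n powr (1/2) * real n powr (1/2)" using elim by (simp add: powr_add[symmetric])
      moreover have "(real n powr (1/4))\<^sup>2 = real n powr (1/2)"
        using elim by (simp add: power2_eq_square powr_add[symmetric])
      moreover have "real n powr (1/2) > 0" using elim by simp
      ultimately have "real n / (real n powr (1/4))\<^sup>2 = real n powr (1/2)" by (simp add: field_simps)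
      then show ?case by simp
    qed
    ultimately show ?thesis by (rule Lim_transform_eventually)
  qed
  ultimately have "(\<lambda>n. 2 * (\<kappa> * (real n powr (1/4)) powr (- \<delta> / 2) + exp (- 2 * real n / (real n powr (1/4))\<^sup>2)))
      \<longlonglongrightarrow> 2 * (\<kappa> * 0 + 0)"
    by (intro tendsto_intros)
  then show ?thesis by simp
qed

text \<open>The two sparsity conditions enter the finite-sample bound only through \<open>(s + s\<^sub>\<Pi>) r\<close>.  Since
  \<open>r = sqrt (ln p) / sqrt n\<close>, sparsity of order \<open>o(sqrt n / ln p)\<close> leaves a factor \<open>1 / sqrt (ln p)\<close> to spare.\<close>

lemma sparsity_rate:
  fixes p :: "nat \<Rightarrow> nat" and sP s :: "nat \<Rightarrow> nat"
  assumes sP: "(\<lambda>n. real (sP n)) \<in> o(\<lambda>n. sqrt (real n / (ln (real (p n))) ^ 3))"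
    and s: "(\<lambda>n. real (s n)) \<in> o(\<lambda>n. sqrt (real n) / ln (real (p n)))"
    and p: "filterlim p at_top sequentially"
    and lp: "(\<lambda>n. ln (real (p n))) \<in> o(\<lambda>n. sqrt (real n))" and \<nu>: "\<nu> > 0"
  shows "\<forall>\<^sub>F n in sequentially. sqrt (ln (real (p n)) / real n) \<le> \<nu>"
    and "\<forall>\<^sub>F n in sequentially. real (s n + sP n) * sqrt (ln (real (p n)) / real n) \<le> \<nu>"
    and "\<forall>\<^sub>F n in sequentially. 1 \<le> ln (real (p n))"
proof -
  have "filterlim (\<lambda>n. ln (real (p n))) at_top sequentially"
    by (intro filterlim_compose[OF ln_at_top] filterlim_compose[OF filterlim_real_sequentially] p)
  then show ln1: "\<forall>\<^sub>F n in sequentially. 1 \<le> ln (real (p n))" by (auto simp: filterlim_at_top)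
  have \<nu>2: "\<nu>\<^sup>2 > 0" "\<nu> / 2 > 0" using \<nu> by auto
  show "\<forall>\<^sub>F n in sequentially. sqrt (ln (real (p n)) / real n) \<le> \<nu>"
    using landau_o.smallD[OF lp \<nu>2(1)] ln1 eventually_gt_at_top[of 0]
  proof eventually_elim
    case (elim n)
    have "ln (real (p n)) / real n \<le> (\<nu>\<^sup>2 * sqrt (real n)) / real n"
      using elim by (intro divide_right_mono) auto
    also have "\<dots> \<le> (\<nu>\<^sup>2 * real n) / real n"
    proof (intro divide_right_mono mult_left_mono)
      have "sqrt (real n) \<le> sqrt (real n * real n)" using elim by (intro real_sqrt_le_mono) (simp add: mult_le_cancel_left1)
      then show "sqrt (real n) \<le> real n" by simp
    qed auto
    also have "\<dots> = \<nu>\<^sup>2" using elim by simp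
    finally show ?case using \<nu> by (intro real_le_lsqrt) auto
  qed
  show "\<forall>\<^sub>F n in sequentially. real (s n + sP n) * sqrt (ln (real (p n)) / real n) \<le> \<nu>"
    using landau_o.smallD[OF sP \<nu>2(2)] landau_o.smallD[OF s \<nu>2(2)] ln1 eventually_gt_at_top[of 0]
  proof eventually_elim
    case (elim n)
    define l where "l = ln (real (p n))"
    define x where "x = sqrt (real n)"
    have l: "l \<ge> 1" and x: "x > 0" using elim by (auto simp: l_def x_def)
    have sl: "1 \<le> sqrt l" "sqrt l * sqrt l = l" using l by auto
    have A: "real (s n) \<le> \<nu> / 2 * (x / l)" using elim(2) l x by (simp add: l_def x_def)
    have B: "real (sP n) \<le> \<nu> / 2 * (x / (l * sqrt l))"
    proof -
      have "sqrt (real n / l ^ 3) = x / (l * sqrt l)"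
        using l by (simp add: x_def real_sqrt_divide power3_eq_cube real_sqrt_mult)
      then show ?thesis using elim(1) l x by (simp add: l_def[symmetric])
    qed
    have r: "sqrt (l / real n) = sqrt l / x" by (simp add: real_sqrt_divide x_def)
    have "real (s n) * (sqrt l / x) \<le> (\<nu> / 2 * (x / l)) * (sqrt l / x)"
      using A l x by (intro mult_right_mono) auto
    also have "\<dots> = \<nu> / 2 * (1 / sqrt l)" using x sl l by (simp add: field_simps)
    also have "\<dots> \<le> \<nu> / 2 * 1" using \<nu> sl by (intro mult_left_mono) auto
    finally have A': "real (s n) * (sqrt l / x) \<le> \<nu> / 2" by simp
    have "real (sP n) * (sqrt l / x) \<le> (\<nu> / 2 * (x / (l * sqrt l))) * (sqrt l / x)"
      using B l x by (intro mult_right_mono) auto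
    also have "\<dots> = \<nu> / 2 * (1 / l)" using x sl l by (simp add: field_simps)
    also have "\<dots> \<le> \<nu> / 2 * 1" using \<nu> l by (intro mult_left_mono) auto
    finally have B': "real (sP n) * (sqrt l / x) \<le> \<nu> / 2" by simp
    show ?case using A' B' unfolding l_def[symmetric] r of_nat_add distrib_right by linarith
  qed
qed

theorem theorem6:
  fixes \<kappa>\<^sub>1 \<kappa>\<^sub>2 \<kappa>\<^sub>3 \<delta> :: real
  assumes "0 < \<kappa>\<^sub>1" "0 < \<kappa>\<^sub>2" "0 < \<kappa>\<^sub>3" "0 < \<delta>"
  shows "\<exists>K\<^sub>1>0. \<exists>K\<^sub>2>0. \<exists>C>0.
    \<forall>(M :: nat \<Rightarrow> 'w measure) (p :: nat \<Rightarrow> nat) Cov beta x u xs ys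
     (\<eta> :: nat \<Rightarrow> real) (theta :: nat \<Rightarrow> 'w \<Rightarrow> real Matrix.vec) (P :: nat \<Rightarrow> 'w \<Rightarrow> real Matrix.mat).
      let rate = (\<lambda>n. sqrt (ln (real (p n)) / real n));
          \<gamma> = (\<lambda>n. (1/2) \<cdot>\<^sub>v (beta n GA - beta n GB));
          s\<^sub>\<Pi> = (\<lambda>n. real (max_col_sparsity (Pi_star (M n) (p n) (x n))));
          W = (\<lambda>n. W_mat n (p n) (xs n));
          Z = (\<lambda>n. Z_mat n (p n) (xs n));
          Y = (\<lambda>n. Y_vec n (ys n))
      in
        (\<forall>\<^sub>F n in sequentially.
           two_sample_model (M n) n (p n) (Cov n) (beta n) (x n) (u n) (xs n) (ys n)) \<longrightarrow>
        (\<forall>\<^sub>F n in sequentially. \<gamma> n \<noteq> 0\<^sub>v (p n)) \<longrightarrow>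
        (\<forall>\<^sub>F n in sequentially. \<forall>k ev. eigenvalue (Cov n k) ev \<longrightarrow> \<kappa>\<^sub>1 < ev \<and> ev < \<kappa>\<^sub>2) \<longrightarrow>
        s\<^sub>\<Pi> \<in> o(\<lambda>n. sqrt (real n / (ln (real (p n))) ^ 3)) \<longrightarrow>
        (\<lambda>n. s\<^sub>\<Pi> n * real (l0_norm (beta n GA - beta n GB)) + real (l0_norm (beta n GA + beta n GB)))
          \<in> o(\<lambda>n. sqrt (real n) / ln (real (p n))) \<longrightarrow>
        (\<forall>\<^sub>F n in sequentially. \<forall>k.
           (\<integral>\<^sup>+\<omega>. ennreal (\<bar>u n k \<omega>\<bar> powr (2 + \<delta>)) \<partial>M n) \<le> ennreal \<kappa>\<^sub>3) \<longrightarrow>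
        filterlim p at_top sequentially \<longrightarrow>
        (\<lambda>n. ln (real (p n))) \<in> o(\<lambda>n. sqrt (real n)) \<longrightarrow>
        \<eta> \<in> \<Theta>(rate) \<longrightarrow>
        (\<forall>\<^sub>F n in sequentially. \<eta> n \<ge> C * rate n) \<longrightarrow>
        (\<forall>\<^sub>F n in sequentially. AE \<omega> in M n.
           is_adds (\<eta> n) (W n \<omega>) (Y n \<omega>) (theta n \<omega>) \<and>
           P n \<omega> \<in> carrier_mat (p n) (p n) \<and>
           (\<forall>j<p n. is_adds (\<eta> n) (W n \<omega>) (col (Z n \<omega>) j) (col (P n \<omega>) j))) \<longrightarrow>
        (\<forall>\<^sub>F n in sequentially.
           linf_norm (Sigma_V (Cov n) *\<^sub>v \<gamma> n) \<ge> rate n * (K\<^sub>1 * l2_norm (\<gamma> n) + K\<^sub>2)) \<longrightarrow>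
        (\<forall>\<alpha>. 0 < \<alpha> \<and> \<alpha> < 1 \<longrightarrow>
           (\<lambda>n. inner_prob (M n)
                  {\<omega> \<in> space (M n). tiers_rejects \<alpha> (W n \<omega>) (Z n \<omega>) (Y n \<omega>) (theta n \<omega>) (P n \<omega>)})
             \<longlonglongrightarrow> 1)"
proof -
  define c where "c = conc_const \<kappa>\<^sub>2"
  define K where "K = snr_const \<kappa>\<^sub>2"
  define C where "C = c / sqrt (min \<kappa>\<^sub>1 (1/2) / 2)"
  have c: "c > 0" using assms by (auto simp: c_def conc_const_def less_max_iff_disj)
  have K: "K > 0" using assms by (simp add: K_def snr_const_def)
  have C: "C > 0" using c assms by (simp add: C_def)
  have Kc: "K + c > 0" using K c by simp
  have K2: "(K + c) * (2 * sqrt (\<kappa>\<^sub>3 + 3)) > 0" using K c assms by simp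
  show ?thesis
    unfolding Let_def
  proof (rule exI[of _ "K + c"], rule conjI, rule Kc, rule exI[of _ "(K + c) * (2 * sqrt (\<kappa>\<^sub>3 + 3))"],
      rule conjI, rule K2, rule exI[of _ C], rule conjI, rule C, intro allI impI)
    fix M :: "nat \<Rightarrow> 'w measure" and p :: "nat \<Rightarrow> nat" and Cov beta x u xs ys and \<eta> :: "nat \<Rightarrow> real"
      and theta :: "nat \<Rightarrow> 'w \<Rightarrow> real Matrix.vec" and P :: "nat \<Rightarrow> 'w \<Rightarrow> real Matrix.mat" and \<alpha> :: real
    let ?r = "\<lambda>n. sqrt (ln (real (p n)) / real n)"
    let ?sP = "\<lambda>n. max_col_sparsity (Pi_star (M n) (p n) (x n))"
    let ?s = "\<lambda>n. ?sP n * l0_norm (beta n GA - beta n GB) + l0_norm (beta n GA + beta n GB)"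
    let ?\<gamma> = "\<lambda>n. (1/2) \<cdot>\<^sub>v (beta n GA - beta n GB)"
    let ?S = "\<lambda>n. {\<omega> \<in> space (M n). tiers_rejects \<alpha> (W_mat n (p n) (xs n) \<omega>) (Z_mat n (p n) (xs n) \<omega>) (Y_vec n (ys n) \<omega>) (theta n \<omega>) (P n \<omega>)}"
    let ?fail = "\<lambda>n. 42 / real (p n) + 2 * (\<kappa>\<^sub>3 * (real n powr (1/4)) powr (- \<delta> / 2) + exp (- 2 * real n / (real n powr (1/4))\<^sup>2))"
    assume model: "\<forall>\<^sub>F n in sequentially. two_sample_model (M n) n (p n) (Cov n) (beta n) (x n) (u n) (xs n) (ys n)"
      and nz: "\<forall>\<^sub>F n in sequentially. ?\<gamma> n \<noteq> 0\<^sub>v (p n)"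
      and ev: "\<forall>\<^sub>F n in sequentially. \<forall>k ev. eigenvalue (Cov n k) ev \<longrightarrow> \<kappa>\<^sub>1 < ev \<and> ev < \<kappa>\<^sub>2"
      and sP: "(\<lambda>n. real (?sP n)) \<in> o(\<lambda>n. sqrt (real n / (ln (real (p n))) ^ 3))"
      and s: "(\<lambda>n. real (?sP n) * real (l0_norm (beta n GA - beta n GB)) + real (l0_norm (beta n GA + beta n GB)))
          \<in> o(\<lambda>n. sqrt (real n) / ln (real (p n)))"
      and mom: "\<forall>\<^sub>F n in sequentially. \<forall>k. (\<integral>\<^sup>+\<omega>. ennreal (\<bar>u n k \<omega>\<bar> powr (2 + \<delta>)) \<partial>M n) \<le> ennreal \<kappa>\<^sub>3"
      and p: "filterlim p at_top sequentially"
      and lp: "(\<lambda>n. ln (real (p n))) \<in> o(\<lambda>n. sqrt (real n))"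
      and \<eta>: "\<eta> \<in> \<Theta>(?r)" and \<eta>C: "\<forall>\<^sub>F n in sequentially. C * ?r n \<le> \<eta> n"
      and adds: "\<forall>\<^sub>F n in sequentially. AE \<omega> in M n.
           is_adds (\<eta> n) (W_mat n (p n) (xs n) \<omega>) (Y_vec n (ys n) \<omega>) (theta n \<omega>) \<and>
           P n \<omega> \<in> carrier_mat (p n) (p n) \<and>
           (\<forall>j<p n. is_adds (\<eta> n) (W_mat n (p n) (xs n) \<omega>) (col (Z_mat n (p n) (xs n) \<omega>) j) (col (P n \<omega>) j))"
      and signal: "\<forall>\<^sub>F n in sequentially. ?r n * ((K + c) * l2_norm (?\<gamma> n) + (K + c) * (2 * sqrt (\<kappa>\<^sub>3 + 3)))
          \<le> linf_norm (Sigma_V (Cov n) *\<^sub>v ?\<gamma> n)"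
      and \<alpha>: "0 < \<alpha> \<and> \<alpha> < 1"
    from \<eta> obtain H where H: "H > 0" "\<forall>\<^sub>F n in sequentially. norm (\<eta> n) \<le> H * norm (?r n)"
      by (auto elim!: landau_o.bigE dest: bigthetaD1)
    have s': "(\<lambda>n. real (?s n)) \<in> o(\<lambda>n. sqrt (real n) / ln (real (p n)))" using s by simp
    note rates = sparsity_rate[OF sP s' p lp]
    have p2: "\<forall>\<^sub>F n in sequentially. 2 \<le> p n" using p by (auto simp: filterlim_at_top)
    have preal: "filterlim (\<lambda>n. real (p n)) at_top sequentially"
      by (rule filterlim_compose[OF filterlim_real_sequentially p])
    have p\<alpha>: "\<forall>\<^sub>F n in sequentially. 2 / \<alpha> < real (p n)" using preal by (auto simp: filterlim_at_top_dense)
    \<comment> \<open>\<open>\<nu>1\<close> bounds the rate and \<open>\<nu>2\<close> the product of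
       sparsity and rate, so that all smallness conditions of the finite-sample bound hold.\<close>
    define \<nu>1 where "\<nu>1 = min (min (\<kappa>\<^sub>1 / (2 * c)) (1 / (4 * c))) (min 1 (1 / sqrt 48))"
    define \<nu>2 where "\<nu>2 = min (\<kappa>\<^sub>1 / (4 * c)) (min (\<kappa>\<^sub>1 / (256 * H\<^sup>2)) (K * \<kappa>\<^sub>1 / (2 * sqrt (2 * \<kappa>\<^sub>2 + 2) * 96 * H\<^sup>2 * sqrt (2 * \<kappa>\<^sub>2 + 1))))"
    have \<nu>: "\<nu>1 > 0" "\<nu>2 > 0" using assms c K H by (auto simp: \<nu>1_def \<nu>2_def)
    have "\<forall>\<^sub>F n in sequentially. 1 - ?fail n \<le> inner_prob (M n) (?S n) \<and> inner_prob (M n) (?S n) \<le> 1"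
      using model nz ev mom \<eta>C adds signal H(2) p2 p\<alpha> rates(1)[OF \<nu>(1)] rates(2)[OF \<nu>(2)] eventually_gt_at_top[of 0]
    proof eventually_elim
      case (elim n)
      interpret two_sample_model "M n" n "p n" "Cov n" "beta n" "x n" "u n" "xs n" "ys n" by (rule elim(1))
      have r0: "?r n > 0" using elim by simp
      have r: "?r n \<le> \<kappa>\<^sub>1 / (2 * c)" "?r n \<le> 1 / (4 * c)" "?r n \<le> 1" "?r n \<le> 1 / sqrt 48"
        using elim(11) unfolding \<nu>1_def min.bounded_iff by blast+
      define \<rho> where "\<rho> = real (?s n + ?sP n) * ?r n"
      have \<rho>0: "\<rho> \<ge> 0" using r0 by (simp add: \<rho>_def)
      have \<rho>: "\<rho> \<le> \<kappa>\<^sub>1 / (4 * c)" "\<rho> \<le> \<kappa>\<^sub>1 / (256 * H\<^sup>2)"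
        "\<rho> \<le> K * \<kappa>\<^sub>1 / (2 * sqrt (2 * \<kappa>\<^sub>2 + 2) * 96 * H\<^sup>2 * sqrt (2 * \<kappa>\<^sub>2 + 1))"
        using elim(12) unfolding \<nu>2_def \<rho>_def min.bounded_iff by blast+
      have eta2: "(\<eta> n)\<^sup>2 \<le> H\<^sup>2 * (?r n)\<^sup>2"
      proof -
        have "\<bar>\<eta> n\<bar> \<le> H * ?r n" using elim(8) r0 by simp
        then have "\<bar>\<eta> n\<bar>\<^sup>2 \<le> (H * ?r n)\<^sup>2" by (intro power_mono) auto
        then show ?thesis by (simp add: power_mult_distrib del: real_sqrt_pow2_iff)
      qed
      have seta: "real (?s n + ?sP n) * (\<eta> n)\<^sup>2 \<le> H\<^sup>2 * \<rho> * ?r n"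
      proof -
        have "real (?s n + ?sP n) * (\<eta> n)\<^sup>2 \<le> real (?s n + ?sP n) * (H\<^sup>2 * (?r n)\<^sup>2)"
          using eta2 by (intro mult_left_mono) auto
        also have "\<dots> = H\<^sup>2 * \<rho> * ?r n" unfolding \<rho>_def power2_eq_square by (simp only: mult_ac)
        finally show ?thesis .
      qed
      have s1: "c * ?r n \<le> \<kappa>\<^sub>1 / 2" "c * ?r n \<le> 1 / 4"
        using r c by (simp_all add: field_simps)
      have s3: "8 * real (?s n + ?sP n) * (c * ?r n) \<le> 2 * \<kappa>\<^sub>1"
      proof -
        have "8 * c * \<rho> \<le> 8 * c * (\<kappa>\<^sub>1 / (4 * c))" using \<rho>(1) c by (intro mult_left_mono) auto
        also have "\<dots> = 2 * \<kappa>\<^sub>1" using c by simp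
        finally show ?thesis unfolding \<rho>_def by (simp only: mult_ac)
      qed
      have s4: "32 * real (?s n + ?sP n) * (\<eta> n)\<^sup>2 / (2 * \<kappa>\<^sub>1) \<le> 1 / 16"
      proof -
        have "H\<^sup>2 * \<rho> * ?r n \<le> H\<^sup>2 * (\<kappa>\<^sub>1 / (256 * H\<^sup>2)) * 1"
          using \<rho>(2) \<rho>0 r0 r(3) assms by (intro mult_mono) auto
        also have "\<dots> = \<kappa>\<^sub>1 / 256" using H by simp
        finally have "real (?s n + ?sP n) * (\<eta> n)\<^sup>2 \<le> \<kappa>\<^sub>1 / 256" using seta by linarith
        moreover have "32 * a * b / (2 * \<kappa>\<^sub>1) \<le> 1 / 16" if "a * b \<le> \<kappa>\<^sub>1 / 256" for a b :: real
          using that assms by (simp add: field_simps)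
        ultimately show ?thesis by blast
      qed
      have s5: "96 * real (?s n + ?sP n) * (\<eta> n)\<^sup>2 * sqrt (2 * \<kappa>\<^sub>2 + 1) / \<kappa>\<^sub>1 \<le> ?r n * K / (2 * sqrt (2 * \<kappa>\<^sub>2 + 2))"
      proof -
        define q where "q = sqrt (2 * \<kappa>\<^sub>2 + 1)"
        define q' where "q' = sqrt (2 * \<kappa>\<^sub>2 + 2)"
        have q: "q > 0" "q' > 0" using assms by (auto simp: q_def q'_def)
        have "96 * q / \<kappa>\<^sub>1 * (real (?s n + ?sP n) * (\<eta> n)\<^sup>2) \<le> 96 * q / \<kappa>\<^sub>1 * (H\<^sup>2 * \<rho> * ?r n)"
          using seta q assms by (intro mult_left_mono) auto
        also have "\<dots> \<le> 96 * q / \<kappa>\<^sub>1 * (H\<^sup>2 * (K * \<kappa>\<^sub>1 / (2 * q' * 96 * H\<^sup>2 * q)) * ?r n)"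
          using \<rho>(3) q r0 assms unfolding q_def[symmetric] q'_def[symmetric]
          by (intro mult_left_mono mult_right_mono) auto
        also have "\<dots> = ?r n * K / (2 * q')" using q H assms by (simp add: field_simps)
        finally show ?thesis unfolding q_def[symmetric] q'_def[symmetric] by (simp add: mult_ac)
      qed
      have s6: "sqrt 48 * ?r n \<le> 1"
      proof -
        have "sqrt 48 * ?r n \<le> sqrt 48 * (1 / sqrt 48)" using r(4) by (intro mult_left_mono) auto
        then show ?thesis by simp
      qed
      have \<alpha>p: "2 / real (p n) < \<alpha>" using elim(9,10) \<alpha> by (simp add: field_simps)
      have "1 - ?fail n \<le> inner_prob (M n) (?S n)"
        by (rule power_lower_bound[where s="?s n + ?sP n" and ?k1.0="\<kappa>\<^sub>1" and ?k2.0="\<kappa>\<^sub>2",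
              folded c_def K_def, folded C_def])
           (use assms elim s1 s3 s4 s5 s6 \<alpha> \<alpha>p in \<open>auto simp: C_def\<close>)
      moreover have "inner_prob (M n) (?S n) \<le> 1"
        unfolding inner_prob_def by (rule cSUP_least) auto
      ultimately show ?case by simp
    qed
    then have lower: "\<forall>\<^sub>F n in sequentially. 1 - ?fail n \<le> inner_prob (M n) (?S n)"
      and upper: "\<forall>\<^sub>F n in sequentially. inner_prob (M n) (?S n) \<le> 1"
      by (auto elim: eventually_mono)
    have "(\<lambda>n. 42 / real (p n)) \<longlonglongrightarrow> 0"
      by (rule tendsto_divide_0[OF tendsto_const filterlim_at_top_imp_at_infinity[OF preal]])
    then have "(\<lambda>n. 1 - ?fail n) \<longlonglongrightarrow> 1 - (0 + 0)"
      using assms by (intro tendsto_diff tendsto_add tendsto_const noise_failure_tendsto_0) auto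
    then have lim: "(\<lambda>n. 1 - ?fail n) \<longlonglongrightarrow> 1" by simp
    show "(\<lambda>n. inner_prob (M n) (?S n)) \<longlonglongrightarrow> 1"
      by (rule tendsto_sandwich[OF lower upper lim tendsto_const])
  qed
qed

end
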